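(* Let $G\in\hat{\mathcal G}$ and let $\sigma$ be a rational multiplier on $G$. Then every self-adjoint $A^\sigma\in M_d(\overline{\mathbb{Q}}(G,\sigma))$, regarded as an operator on $l^2(G)^d$, has no eigenvalue that is a Liouville transcendental number.
   Context: $\overline{\mathbb{Q}}$ is the field of algebraic numbers in $\mathbb C$. A multiplier on a discrete group $G$ is a normalized 2-cocycle $\sigma:G\times G\to U(1)$: $\sigma(b,c)\sigma(a,bc)=\sigma(ab,c)\sigma(a,b)$ and $\sigma(1,g)=\sigma(g,1)=1$. It is rational if $\sigma^r=1$ for some positive integer $r$ (so its values lie in $\overline{\mathbb{Q}}$). The twisted group algebra $\overline{\mathbb{Q}}(G,\sigma)$ consists of finite sums $\sum a_g g$, $a_g\in\overline{\mathbb{Q}}$, with $(\sum a_g g)(\sum b_h h)=\sum_k\big(\sum_{gh=k}a_gb_h\sigma(g,h)\big)k$. $A\in M_d(\overline{\mathbb{Q}}(G,\sigma))$, with matrices of coefficients $A(g)\in M_d(\overline{\mathbb{Q}})$, acts on $f\in l^2(G)^d$ by $(Af)(x)=\sum_{h\in G}A(xh^{-1})\sigma(xh^{-1},h)f(h)$; self-adjointness refers to this bounded operator. Generalized amenable extension: let $G$ be a finitely generated group with finite symmetric generating set $S$, and $H$ a discrete group. $G$ is a generalized amenable extension of $H$ if there is a set $X$ with a free left $G$-action and a commuting free right $H$-action, and a sequence of finite subsets $X_1\subset X_2\subset\cdots$ of $X/H$ with $\bigcup_k X_k=X/H$ and $\#(S\cdot X_k\setminus X_k)/\#X_k\to0$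 as $k\to\infty$. $\mathcal G$ is the smallest class of groups which contains the trivial group and is closed under: (1) if $H\in\mathcal G$ and $G$ is a generalized amenable extension of $H$, then $G\in\mathcal G$; (2) if $H\in\mathcal G$ and $U$ is a subgroup of $H$, then $U\in\mathcal G$; (3) if $G=\lim_{i\in I}G_i$ is the direct or inverse limit of a directed system of groups $G_i\in\mathcal G$, then $G\in\mathcal G$. $\hat{\mathcal G}=\{G\in\mathcal G:\ \hat G\in\mathcal G$ for every $\mathbb Z_r$-extension $\hat G$ of $G\}$, where a $\mathbb Z_r$-extension of $G$ is a group $\hat G$ with an exact sequence $1\to\mathbb Z_r\to\hat G\to G\to1$, $\mathbb Z_r$ being the cyclic group of order $r$ and $r$ ranging over all positive integers. A Liouville transcendental number is a real number $\lambda$ such that for every $n\ge1$ there are integers $p,q$ with $q>1$ and $0<|\lambda-p/q|<q^{-n}$. *)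

theory Defs
  imports
    "HOL-Analysis.Analysis"
    "HOL-Algebra.Group_Action"
    "HOL-Algebra.Elementary_Groups"
    "HOL-Algebra.Product_Groups"
    "HOL-Algebra.Ring"
begin

section \<open>Generalized amenable extensions\<close>

text \<open>A right action \<open>x \<cdot> h = \<rho> h x\<close> of a group is a left action of its opposite group.\<close>

definition opposite_group :: "'a monoid \<Rightarrow> 'a monoid" where
  "opposite_group H = H\<lparr>monoid.mult := (\<lambda>x y. y \<otimes>\<^bsub>H\<^esub> x)\<rparr>"

definition right_action :: "'h monoid \<Rightarrow> 'x set \<Rightarrow> ('h \<Rightarrow> 'x \<Rightarrow> 'x) \<Rightarrow> bool" where
  "right_action H X \<rho> \<longleftrightarrow> group_action (opposite_group H) X \<rho>"

definition free_on :: "'g monoid \<Rightarrow> 'x set \<Rightarrow> ('g \<Rightarrow> 'x \<Rightarrow> 'x) \<Rightarrow> bool" where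
  "free_on G X \<phi> \<longleftrightarrow> (\<forall>x\<in>X. \<forall>g\<in>carrier G. \<phi> g x = x \<longrightarrow> g = \<one>\<^bsub>G\<^esub>)"

definition symmetric_generating_set :: "'g monoid \<Rightarrow> 'g set \<Rightarrow> bool" where
  "symmetric_generating_set G S \<longleftrightarrow>
     S \<subseteq> carrier G \<and> (\<forall>s\<in>S. inv\<^bsub>G\<^esub> s \<in> S) \<and> generate G S = carrier G"

text \<open>
  The quotient \<open>X/H\<close> is the set \<open>orbits H X \<rho>\<close> of \<open>H\<close>-orbits; an element \<open>s\<close> of \<open>G\<close> moves an
  orbit \<open>Q\<close> to its image \<open>\<phi> s ` Q\<close>. The sets \<open>Xs k\<close> have to be nonempty for the ratios to make
  sense. (Division by zero would otherwise admit \<open>X = {}\<close>.)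

  It is no restriction that \<open>X\<close> is a subset of \<open>nat \<times> 'h\<close>: a union of an increasing sequence of
  finite sets is countable, and a free right \<open>H\<close>-set \<open>X\<close> is in bijection with \<open>X/H \<times> H\<close>.
\<close>

definition generalized_amenable_extension :: "'g monoid \<Rightarrow> 'h monoid \<Rightarrow> bool" where
  "generalized_amenable_extension G H \<longleftrightarrow>
     group G \<and> group H \<and>
     (\<exists>S. finite S \<and> symmetric_generating_set G S \<and>
       (\<exists>(X :: (nat \<times> 'h) set) \<phi> \<rho>.
          group_action G X \<phi> \<and> free_on G X \<phi> \<and>
          right_action H X \<rho> \<and> free_on H X \<rho> \<and>
          (\<forall>g\<in>carrier G. \<forall>h\<in>carrier H. \<forall>x\<in>X. \<phi> g (\<rho> h x) = \<rho> h (\<phi> g x)) \<and>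
          (\<exists>Xs :: nat \<Rightarrow> (nat \<times> 'h) set set.
             incseq Xs \<and> (\<forall>k. finite (Xs k) \<and> Xs k \<noteq> {}) \<and>
             (\<Union>k. Xs k) = orbits H X \<rho> \<and>
             (\<lambda>k. real (card ({\<phi> s ` Q | s Q. s \<in> S \<and> Q \<in> Xs k} - Xs k)) / real (card (Xs k)))
               \<longlonglongrightarrow> 0)))"


section \<open>Direct and inverse limits\<close>

definition directed_set :: "'i set \<Rightarrow> ('i \<times> 'i) set \<Rightarrow> bool" where
  "directed_set I r \<longleftrightarrow>
     preorder_on I r \<and> I \<noteq> {} \<and> (\<forall>i\<in>I. \<forall>j\<in>I. \<exists>k\<in>I. (i, k) \<in> r \<and> (j, k) \<in> r)"

definition direct_system ::
  "'i set \<Rightarrow> ('i \<times> 'i) set \<Rightarrow> ('i \<Rightarrow> 'a monoid) \<Rightarrow> ('i \<Rightarrow> 'i \<Rightarrow> 'a \<Rightarrow> 'a) \<Rightarrow> bool" where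
  "direct_system I r G f \<longleftrightarrow>
     directed_set I r \<and> (\<forall>i\<in>I. group (G i)) \<and>
     (\<forall>(i, j)\<in>r. f i j \<in> hom (G i) (G j)) \<and>
     (\<forall>i\<in>I. \<forall>x\<in>carrier (G i). f i i x = x) \<and>
     (\<forall>i j k. (i, j) \<in> r \<and> (j, k) \<in> r \<longrightarrow> (\<forall>x\<in>carrier (G i). f j k (f i j x) = f i k x))"

definition inverse_system ::
  "'i set \<Rightarrow> ('i \<times> 'i) set \<Rightarrow> ('i \<Rightarrow> 'a monoid) \<Rightarrow> ('i \<Rightarrow> 'i \<Rightarrow> 'a \<Rightarrow> 'a) \<Rightarrow> bool" where
  "inverse_system I r G f \<longleftrightarrow>
     directed_set I r \<and> (\<forall>i\<in>I. group (G i)) \<and>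
     (\<forall>(i, j)\<in>r. f i j \<in> hom (G j) (G i)) \<and>
     (\<forall>i\<in>I. \<forall>x\<in>carrier (G i). f i i x = x) \<and>
     (\<forall>i j k. (i, j) \<in> r \<and> (j, k) \<in> r \<longrightarrow> (\<forall>x\<in>carrier (G k). f i j (f j k x) = f i k x))"

text \<open>The direct limit is the disjoint union of the groups modulo eventual equality.\<close>

definition direct_limit_rel ::
  "'i set \<Rightarrow> ('i \<times> 'i) set \<Rightarrow> ('i \<Rightarrow> 'a monoid) \<Rightarrow> ('i \<Rightarrow> 'i \<Rightarrow> 'a \<Rightarrow> 'a) \<Rightarrow>
     (('i \<times> 'a) \<times> ('i \<times> 'a)) set" where
  "direct_limit_rel I r G f =
     {((i, x), (j, y)) | i x j y.
        i \<in> I \<and> x \<in> carrier (G i) \<and> j \<in> I \<and> y \<in> carrier (G j) \<and>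
        (\<exists>k\<in>I. (i, k) \<in> r \<and> (j, k) \<in> r \<and> f i k x = f j k y)}"

definition direct_limit ::
  "'i set \<Rightarrow> ('i \<times> 'i) set \<Rightarrow> ('i \<Rightarrow> 'a monoid) \<Rightarrow> ('i \<Rightarrow> 'i \<Rightarrow> 'a \<Rightarrow> 'a) \<Rightarrow>
     ('i \<times> 'a) set monoid" where
  "direct_limit I r G f =
     \<lparr>carrier = (SIGMA i:I. carrier (G i)) // direct_limit_rel I r G f,
      monoid.mult = (\<lambda>P Q. \<Union>{direct_limit_rel I r G f `` {(k, f i k x \<otimes>\<^bsub>G k\<^esub> f j k y)} | i x j y k.
                (i, x) \<in> P \<and> (j, y) \<in> Q \<and> (i, k) \<in> r \<and> (j, k) \<in> r}),
      one = (\<Union>i\<in>I. direct_limit_rel I r G f `` {(i, \<one>\<^bsub>G i\<^esub>)})\<rparr>"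

definition inverse_limit ::
  "'i set \<Rightarrow> ('i \<times> 'i) set \<Rightarrow> ('i \<Rightarrow> 'a monoid) \<Rightarrow> ('i \<Rightarrow> 'i \<Rightarrow> 'a \<Rightarrow> 'a) \<Rightarrow>
     ('i \<Rightarrow> 'a) monoid" where
  "inverse_limit I r G f =
     (product_group I G)
       \<lparr>carrier := {x \<in> carrier (product_group I G). \<forall>(i, j)\<in>r. f i j (x j) = x i}\<rparr>"


section \<open>The class \<open>\<G>\<close> and its subclass \<open>\<G>\<close>-hat\<close>

text \<open>
  HOL has no type of all groups, so the class is taken relative to a universe type \<open>'u\<close>: all groups
  and all index sets occurring in a derivation live in \<open>'u\<close>. The type \<open>'u\<close> is arbitrary, so a
  statement that is polymorphic in \<open>'u\<close> covers derivations of every size. Limits are only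
  determined up to isomorphism; in particular the class is closed under isomorphism (take the
  limit of a system with one index).
\<close>

inductive class_G_univ :: "'u monoid \<Rightarrow> bool" where
  trivial: "trivial_group G \<Longrightarrow> class_G_univ G"
| amenable_ext:
    "class_G_univ H \<Longrightarrow> generalized_amenable_extension G H \<Longrightarrow> class_G_univ G"
| subgrp: "class_G_univ H \<Longrightarrow> subgroup U H \<Longrightarrow> class_G_univ (H\<lparr>carrier := U\<rparr>)"
| direct_lim:
    "direct_system (I :: 'u set) r Gs f \<Longrightarrow> (\<And>i. i \<in> I \<Longrightarrow> class_G_univ (Gs i)) \<Longrightarrow>
       group G \<Longrightarrow> G \<cong> direct_limit I r Gs f \<Longrightarrow> class_G_univ G"
| inverse_lim:
    "inverse_system (I :: 'u set) r Gs f \<Longrightarrow> (\<And>i. i \<in> I \<Longrightarrow> class_G_univ (Gs i)) \<Longrightarrow>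
       group G \<Longrightarrow> G \<cong> inverse_limit I r Gs f \<Longrightarrow> class_G_univ G"

text \<open>Membership of a group on any type: it has a copy inside the universe that is in the class.\<close>

definition class_G :: "'u itself \<Rightarrow> 'g monoid \<Rightarrow> bool" where
  "class_G _ G \<longleftrightarrow> group G \<and> (\<exists>K :: 'u monoid. class_G_univ K \<and> G \<cong> K)"

definition cyclic_extension :: "nat \<Rightarrow> 'e monoid \<Rightarrow> 'g monoid \<Rightarrow> bool" where
  "cyclic_extension r E G \<longleftrightarrow>
     group E \<and> group G \<and>
     (\<exists>\<iota> \<pi>. \<iota> \<in> hom (integer_mod_group r) E \<and> inj_on \<iota> (carrier (integer_mod_group r)) \<and>
            \<pi> \<in> hom E G \<and> \<pi> ` carrier E = carrier G \<and>
            \<iota> ` carrier (integer_mod_group r) = kernel E G \<pi>)"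

text \<open>
  A set-theoretic section identifies the underlying set of a \<open>\<int>\<^sub>r\<close>-extension of \<open>G\<close> with
  \<open>G \<times> {0..<r}\<close>, so up to isomorphism all these extensions live on the type \<open>'g \<times> nat\<close>.
\<close>

definition class_G_hat :: "'u itself \<Rightarrow> 'g monoid \<Rightarrow> bool" where
  "class_G_hat u G \<longleftrightarrow>
     class_G u G \<and>
     (\<forall>r>0. \<forall>E :: ('g \<times> nat) monoid. cyclic_extension r E G \<longrightarrow> class_G u E)"


section \<open>Twisted group algebras\<close>

definition multiplier :: "'g monoid \<Rightarrow> ('g \<Rightarrow> 'g \<Rightarrow> complex) \<Rightarrow> bool" where
  "multiplier G \<sigma> \<longleftrightarrow>
     (\<forall>a\<in>carrier G. \<forall>b\<in>carrier G. norm (\<sigma> a b) = 1) \<and>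
     (\<forall>a\<in>carrier G. \<forall>b\<in>carrier G. \<forall>c\<in>carrier G.
        \<sigma> b c * \<sigma> a (b \<otimes>\<^bsub>G\<^esub> c) = \<sigma> (a \<otimes>\<^bsub>G\<^esub> b) c * \<sigma> a b) \<and>
     (\<forall>g\<in>carrier G. \<sigma> \<one>\<^bsub>G\<^esub> g = 1 \<and> \<sigma> g \<one>\<^bsub>G\<^esub> = 1)"

definition rational_multiplier :: "'g monoid \<Rightarrow> ('g \<Rightarrow> 'g \<Rightarrow> complex) \<Rightarrow> bool" where
  "rational_multiplier G \<sigma> \<longleftrightarrow>
     multiplier G \<sigma> \<and> (\<exists>r>0. \<forall>a\<in>carrier G. \<forall>b\<in>carrier G. \<sigma> a b ^ r = 1)"

text \<open>A finite formal sum is the function of its coefficients, extended by zero off \<open>carrier G\<close>.\<close>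

definition twisted_group_algebra ::
  "'g monoid \<Rightarrow> ('g \<Rightarrow> 'g \<Rightarrow> complex) \<Rightarrow> ('g \<Rightarrow> complex) ring" where
  "twisted_group_algebra G \<sigma> =
     \<lparr>carrier = {a. finite {g. a g \<noteq> 0} \<and> {g. a g \<noteq> 0} \<subseteq> carrier G \<and> (\<forall>g. algebraic (a g))},
      monoid.mult = (\<lambda>a b k. \<Sum>(g, h) | a g \<noteq> 0 \<and> b h \<noteq> 0 \<and> g \<otimes>\<^bsub>G\<^esub> h = k. a g * b h * \<sigma> g h),
      one = (\<lambda>g. if g = \<one>\<^bsub>G\<^esub> then 1 else 0),
      zero = (\<lambda>g. 0),
      add = (\<lambda>a b g. a g + b g)\<rparr>"

definition matrices_over :: "('a, 'm) ring_scheme \<Rightarrow> ('a ^ 'd ^ 'd) set" where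
  "matrices_over R = {A. \<forall>i j. A $ i $ j \<in> carrier R}"

definition coeff_matrix :: "('g \<Rightarrow> complex) ^ 'd ^ 'd \<Rightarrow> 'g \<Rightarrow> complex ^ 'd ^ 'd" where
  "coeff_matrix A g = (\<chi> i j. (A $ i $ j) g)"


section \<open>The action on \<open>l\<^sup>2(G)\<^sup>d\<close>\<close>

definition l2 :: "'g monoid \<Rightarrow> ('g \<Rightarrow> complex ^ 'd) set" where
  "l2 G = {f. (\<forall>x. x \<notin> carrier G \<longrightarrow> f x = 0) \<and> (\<lambda>x. (norm (f x))\<^sup>2) summable_on carrier G}"

definition l2_inner ::
  "'g monoid \<Rightarrow> ('g \<Rightarrow> complex ^ 'd) \<Rightarrow> ('g \<Rightarrow> complex ^ 'd) \<Rightarrow> complex" where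
  "l2_inner G f g = (\<Sum>\<^sub>\<infinity>x\<in>carrier G. \<Sum>i\<in>UNIV. f x $ i * cnj (g x $ i))"

text \<open>Only finitely many terms of the sum over \<open>h\<close> are nonzero.\<close>

definition twisted_op ::
  "'g monoid \<Rightarrow> ('g \<Rightarrow> 'g \<Rightarrow> complex) \<Rightarrow> ('g \<Rightarrow> complex) ^ 'd ^ 'd \<Rightarrow>
     ('g \<Rightarrow> complex ^ 'd) \<Rightarrow> 'g \<Rightarrow> complex ^ 'd" where
  "twisted_op G \<sigma> A f x =
     (if x \<in> carrier G
      then \<Sum>\<^sub>\<infinity>h\<in>carrier G.
             \<sigma> (x \<otimes>\<^bsub>G\<^esub> inv\<^bsub>G\<^esub> h) h *s (coeff_matrix A (x \<otimes>\<^bsub>G\<^esub> inv\<^bsub>G\<^esub> h) *v f h)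
      else 0)"

definition self_adjoint_on_l2 ::
  "'g monoid \<Rightarrow> (('g \<Rightarrow> complex ^ 'd) \<Rightarrow> ('g \<Rightarrow> complex ^ 'd)) \<Rightarrow> bool" where
  "self_adjoint_on_l2 G T \<longleftrightarrow> (\<forall>f\<in>l2 G. \<forall>g\<in>l2 G. l2_inner G (T f) g = l2_inner G f (T g))"

definition eigenvalue_on_l2 ::
  "'g monoid \<Rightarrow> (('g \<Rightarrow> complex ^ 'd) \<Rightarrow> ('g \<Rightarrow> complex ^ 'd)) \<Rightarrow> complex \<Rightarrow> bool" where
  "eigenvalue_on_l2 G T c \<longleftrightarrow> (\<exists>f\<in>l2 G. f \<noteq> (\<lambda>_. 0) \<and> T f = (\<lambda>x. c *s f x))"


section \<open>Liouville numbers\<close>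

definition liouville_number :: "real \<Rightarrow> bool" where
  "liouville_number l \<longleftrightarrow>
     (\<forall>n::nat\<ge>1. \<exists>p q :: int. q > 1 \<and>
        0 < \<bar>l - of_int p / of_int q\<bar> \<and> \<bar>l - of_int p / of_int q\<bar> < 1 / of_int q ^ n)"

end

theory Submission
  imports Defs "Jordan_Normal_Form.Schur_Decomposition"
begin

text \<open>
  If a matrix over the integral group ring has a Liouville number \<open>l\<close> as an eigenvalue and \<open>p/q\<close> is a
  very good approximation of \<open>l\<close>, then \<open>q A - p\<close> has the tiny eigenvalue \<open>q l - p\<close>, on an eigenspace
  whose von Neumann dimension does not depend on \<open>p/q\<close>. Integrality prevents this: the logarithm of
  the determinant of \<open>q A - p\<close>, taken on the complement of the kernel, is at least \<open>- const * ln q\<close>,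
  while the norm of \<open>q A - p\<close> is \<open>O(q)\<close>, so that the small eigenvalue cannot be compensated when
  \<open>\<bar>q l - p\<bar>\<close> is smaller than every power of \<open>1/q\<close>.

  \<^bold>\<open>The determinant bound.\<close> The predicate \<open>det_bound\<close> says that for every
  hermitian matrix \<open>a\<close> over the group ring with integral algebraic coefficients and every real
  polynomial \<open>P\<close> that dominates \<open>ln \<bar>x\<bar>\<close> off \<open>0\<close> and is nonnegative at \<open>0\<close>, the trace of \<open>P(a)\<close> is
  bounded from below in terms of the size of the coefficients. For the trivial group this holds because
  the product of the nonzero eigenvalues of an integer matrix is a nonzero integer
  (\<open>hermitian_mat_log_bound\<close>). The trace of \<open>P(a)\<close> depends on products of at most \<open>degree P\<close> group
  elements, hence the bound passes to every group that is locally embeddable into groups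
  with the bound (\<open>det_bound_locally_embeddable\<close>): subgroups, direct limits and inverse limits are of
  this kind. For a generalized amenable extension the matrix is cut down to finitely many orbits; for
  most of these orbits the short paths that contribute to the trace stay inside, and the number of
  the other orbits is negligible (\<open>det_bound_generalized_amenable_extension\<close>).

  \<^bold>\<open>From the bound to eigenvalues.\<close> The traces of the polynomials in \<open>a\<close> form a functional which is
  nonnegative on polynomials that are nonnegative on an interval containing the spectrum
  (\<open>spectral_nonneg\<close>) and which has an atom at every eigenvalue (\<open>spectral_atom\<close>). That such a
  functional cannot have an atom at a Liouville number is a statement about one real variable,
  \<open>liouville_no_atom\<close>. The delicate point there is that \<open>q A - p\<close> may have a kernel. A majorant that is
  nonnegative at the point \<open>p/q\<close> is obtained by adding a peak at this point, and among infinitely many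
  approximations one finds a \<open>p/q\<close> at which a peak has small trace, because the total mass is finite.

  \<^bold>\<open>Twisting.\<close> A rational multiplier is a power \<open>\<zeta> ^ s g h\<close> of one root of unity, and \<open>s\<close> is a cocycle
  with values in \<open>\<int>\<^sub>r\<close>. On the corresponding central extension \<open>E\<close> the twisted operator becomes a convolution
  operator with coefficients \<open>A(g) * cnj \<zeta> ^ u\<close> at \<open>(g, u)\<close>, up to a positive integer factor in the
  eigenvalue, and integer multiples of Liouville numbers are Liouville numbers. The group \<open>E\<close> lies in
  the class \<open>\<G>\<close> because the given group lies in its subclass \<open>\<G>\<close>-hat.
\<close>

section \<open>Positive functionals on polynomials\<close>

lemma poly_double_root_of_nonneg:
  fixes P :: "real poly"
  assumes ab: "a < r" "r < b" and nn: "\<And>x. a \<le> x \<Longrightarrow> x \<le> b \<Longrightarrow> 0 \<le> poly P x" and root: "poly P r = 0"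
  obtains S where "P = [:-r, 1:] * ([:-r, 1:] * S)" "\<And>x. a \<le> x \<Longrightarrow> x \<le> b \<Longrightarrow> 0 \<le> poly S x"
proof -
  obtain R where R: "P = [:-r, 1:] * R" using root poly_eq_0_iff_dvd by (metis dvdE)
  have cont: "(poly Q \<longlongrightarrow> poly Q r) (at_left r)" "(poly Q \<longlongrightarrow> poly Q r) (at_right r)" for Q :: "real poly"
    using poly_isCont[of r Q] unfolding isCont_def filterlim_at_split by blast+
  have "poly R r \<ge> 0"
  proof (rule tendsto_lowerbound[OF cont(2)])
    show "\<forall>\<^sub>F x in at_right r. 0 \<le> poly R x"
      unfolding eventually_at_right_field
    proof (intro exI[of _ b] conjI allI impI)
      fix x assume "r < x" "x < b"
      then have "0 \<le> (x - r) * poly R x" using nn[of x] ab unfolding R by (simp add: algebra_simps)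
      with \<open>r < x\<close> show "0 \<le> poly R x" by (simp add: zero_le_mult_iff)
    qed (use ab in auto)
  qed auto
  moreover have "poly R r \<le> 0"
  proof (rule tendsto_upperbound[OF cont(1)])
    show "\<forall>\<^sub>F x in at_left r. poly R x \<le> 0"
      unfolding eventually_at_left_field
    proof (intro exI[of _ a] conjI allI impI)
      fix x assume "a < x" "x < r"
      then have "0 \<le> (x - r) * poly R x" using nn[of x] ab unfolding R by (simp add: algebra_simps)
      with \<open>x < r\<close> show "poly R x \<le> 0" by (simp add: zero_le_mult_iff)
    qed (use ab in auto)
  qed auto
  ultimately obtain S where S: "R = [:-r, 1:] * S" using poly_eq_0_iff_dvd by (metis dvdE order_antisym)
  have off: "0 \<le> poly S x" if "a \<le> x" "x \<le> b" "x \<noteq> r" for x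
  proof -
    have "0 \<le> (x - r)^2 * poly S x"
      using nn[OF that(1,2)] unfolding R S by (simp add: power2_eq_square algebra_simps)
    then show ?thesis using that(3) by (simp add: zero_le_mult_iff)
  qed
  have "poly S r \<ge> 0"
  proof (rule tendsto_lowerbound[OF cont(2)])
    show "\<forall>\<^sub>F x in at_right r. 0 \<le> poly S x"
      unfolding eventually_at_right_field
      using off ab by (intro exI[of _ b]) auto
  qed auto
  with off have "0 \<le> poly S x" if "a \<le> x" "x \<le> b" for x using that by (cases "x = r") auto
  with R S that show thesis by blast
qed

text \<open>
  Nonnegativity on squares and on \<open>K\<^sup>2 - x\<^sup>2\<close> times squares is all that will be known about the
  functionals below, and it implies nonnegativity on all polynomials that are nonnegative on \<open>[-K, K]\<close>.
  The polynomials \<open>P\<close> for which every functional of this kind is nonnegative on \<open>P\<close> times squares form a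
  set \<open>T\<close> that is closed under sums, under multiplication by squares and under multiplication by
  \<open>K - x\<close> and \<open>K + x\<close>. By induction on the degree it contains every polynomial that is nonnegative on
  the interval: after subtraction of the minimal value there is a zero, which is either interior and
  hence double, or an endpoint and hence accounts for one of the two linear factors.
\<close>

lemma nonneg_on_interval_functional:
  fixes \<Lambda> :: "real poly \<Rightarrow> real"
  assumes add: "\<And>P Q. \<Lambda> (P + Q) = \<Lambda> P + \<Lambda> Q" and smult: "\<And>c P. \<Lambda> (Polynomial.smult c P) = c * \<Lambda> P"
    and K: "K > 0"
    and sq: "\<And>Q. 0 \<le> \<Lambda> (Q * Q)" and sq': "\<And>Q. 0 \<le> \<Lambda> ([:K\<^sup>2, 0, -1:] * (Q * Q))"
    and nn: "\<And>x. \<bar>x\<bar> \<le> K \<Longrightarrow> 0 \<le> poly P x"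
  shows "0 \<le> \<Lambda> P"
proof -
  define g where "g = [:K\<^sup>2, 0, -1:]"
  note sq' = sq'[folded g_def]
  \<comment> \<open>The second condition makes the set closed under the linear factors:
    \<open>2 K L = L\<^sup>2 + (K\<^sup>2 - x\<^sup>2)\<close> for \<open>L = K - x\<close> and \<open>L = K + x\<close>, and \<open>(K\<^sup>2 - x\<^sup>2)\<^sup>2\<close> is a square.\<close>
  define T where "T = {P. \<forall>Q. 0 \<le> \<Lambda> (P * (Q * Q)) \<and> 0 \<le> \<Lambda> (g * (P * (Q * Q)))}"
  have T_const: "[:c:] \<in> T" if "c \<ge> 0" for c
  proof -
    have "\<Lambda> ([:c:] * (Q * Q)) = c * \<Lambda> (Q * Q)" "\<Lambda> (g * ([:c:] * (Q * Q))) = c * \<Lambda> (g * (Q * Q))" for Q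
      by (simp_all add: smult)
    then show ?thesis using that sq sq' by (auto simp: T_def)
  qed
  have T_add: "P + Q \<in> T" if "P \<in> T" "Q \<in> T" for P Q
    using that by (auto simp: T_def add distrib_left distrib_right)
  have T_square: "P * (S * S) \<in> T" if "P \<in> T" for P S
  proof -
    have "P * (S * S) * (Q * Q) = P * ((S * Q) * (S * Q))" for Q by (simp add: algebra_simps)
    then show ?thesis using that unfolding T_def mem_Collect_eq by metis
  qed
  have T_linear: "L * P \<in> T" if "P \<in> T" and L: "Polynomial.smult (2 * K) L = L * L + g" for P L
  proof -
    have scale: "2 * K * \<Lambda> X = \<Lambda> (Polynomial.smult (2 * K) X)" for X by (simp add: smult)
    have "0 \<le> \<Lambda> (L * P * (Q * Q)) \<and> 0 \<le> \<Lambda> (g * (L * P * (Q * Q)))" for Q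
    proof -
      have "Polynomial.smult (2 * K) (L * P * (Q * Q)) = Polynomial.smult (2*K) L * (P * (Q * Q))"
        by (simp add: mult_ac)
      also have "\<dots> = P * ((L * Q) * (L * Q)) + g * (P * (Q * Q))"
        unfolding L by (simp only: distrib_left distrib_right mult_ac add_ac)
      finally have 1: "0 \<le> 2 * K * \<Lambda> (L * P * (Q * Q))" using that(1) by (simp add: scale add T_def)
      have "Polynomial.smult (2 * K) (g * (L * P * (Q * Q))) = Polynomial.smult (2*K) L * (g * (P * (Q * Q)))"
        by (simp only: mult_smult_left mult_smult_right mult_ac)
      also have "\<dots> = g * (P * ((L * Q) * (L * Q))) + P * ((g * Q) * (g * Q))"
        unfolding L by (simp only: distrib_left distrib_right mult_ac add_ac)
      finally have "2 * K * \<Lambda> (g * (L * P * (Q * Q))) = \<Lambda> (g * (P * ((L * Q) * (L * Q)))) + \<Lambda> (P * ((g * Q) * (g * Q)))"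
        by (simp only: scale add)
      moreover have "0 \<le> \<Lambda> (g * (P * ((L * Q) * (L * Q))))" "0 \<le> \<Lambda> (P * ((g * Q) * (g * Q)))"
        using that(1) unfolding T_def by blast+
      ultimately have 2: "0 \<le> 2 * K * \<Lambda> (g * (L * P * (Q * Q)))" by linarith
      show ?thesis using 1 2 K by (simp add: zero_le_mult_iff)
    qed
    then show ?thesis by (simp add: T_def)
  qed
  have "P \<in> T" if "\<And>x. \<bar>x\<bar> \<le> K \<Longrightarrow> 0 \<le> poly P x" for P
    using that
  proof (induction "degree P" arbitrary: P rule: less_induct)
    case less
    show ?case
    proof (cases "degree P = 0")
      case True
      then obtain c where "P = [:c:]" by (metis degree_eq_zeroE)
      then show ?thesis using less.prems[of 0] K T_const by auto
    next
      case False
      obtain r where r: "\<bar>r\<bar> \<le> K" and min: "\<And>x. \<bar>x\<bar> \<le> K \<Longrightarrow> poly P r \<le> poly P x"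
        using continuous_attains_inf[of "{-K..K}" "poly P"] K
        by (force simp: abs_le_iff intro!: continuous_intros)
      define M where "M = P - [:poly P r:]"
      have degM: "degree M = degree P"
        using False unfolding M_def by (metis degree_pCons_0 degree_diff_less bot_nat_0.not_eq_extremum degree_add_eq_left degree_minus diff_conv_add_uminus)
      have Mnn: "0 \<le> poly M x" if "\<bar>x\<bar> \<le> K" for x using min[OF that] by (simp add: M_def)
      have Mr: "poly M r = 0" by (simp add: M_def)
      have "M \<in> T"
      proof (cases "\<bar>r\<bar> = K")
        case False
        with r have "-K < r" "r < K" by auto
        have "0 \<le> poly M x" if "-K \<le> x" "x \<le> K" for x using Mnn that by (simp add: abs_le_iff)
        then obtain S where S1: "M = [:-r, 1:] * ([:-r, 1:] * S)" and "\<And>x. -K \<le> x \<Longrightarrow> x \<le> K \<Longrightarrow> 0 \<le> poly S x"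
          by (rule poly_double_root_of_nonneg[OF \<open>-K < r\<close> \<open>r < K\<close> _ Mr]) blast+
        then have S2: "\<And>x. \<bar>x\<bar> \<le> K \<Longrightarrow> 0 \<le> poly S x" by (simp add: abs_le_iff)
        note S = S1 S2
        have "S \<noteq> 0" using S(1) degM \<open>degree P \<noteq> 0\<close> by auto
        then have "degree S < degree P" unfolding degM[symmetric] S(1) by (simp add: degree_mult_eq del: mult_pCons_left)
        from T_square[OF less.hyps[OF this S(2)], of "[:-r,1:]"] show ?thesis
          unfolding S(1) by (simp only: mult_ac)
      next
        case True
        obtain R where R: "M = [:-r, 1:] * R" using Mr poly_eq_0_iff_dvd by (metis dvdE)
        have "R \<noteq> 0" using R degM \<open>degree P \<noteq> 0\<close> by auto
        then have degR: "degree R < degree P" unfolding degM[symmetric] R by (simp add: degree_mult_eq del: mult_pCons_left)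
        define s where "s = sgn r"
        have s: "r = s * K" "s * s = 1" "s \<noteq> 0" using True K by (auto simp: s_def sgn_if)
        define L where "L = [:K, -s:]"
        define R' where "R' = Polynomial.smult (-s) R"
        have "[:-r, 1:] = L * [:-s:]" unfolding L_def using s(1,2) by (simp add: mult.commute)
        then have M_fac: "M = L * R'" unfolding R R'_def by simp
        have off: "0 \<le> poly R' x" if "\<bar>x\<bar> \<le> K" "x \<noteq> r" for x
        proof -
          have "0 \<le> poly L x * poly R' x" using Mnn[OF that(1)] unfolding M_fac by simp
          moreover have "poly L x > 0"
            using that True K unfolding L_def s_def by (auto simp: sgn_if abs_le_iff abs_if split: if_splits)
          ultimately show ?thesis by (simp add: zero_le_mult_iff)
        qed
        have "0 \<le> poly R' r"
        proof (rule tendsto_lowerbound)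
          show "(poly R' \<longlongrightarrow> poly R' r) (at r within {-K..K})"
            using poly_isCont[of r R'] by (simp add: continuous_at_imp_continuous_at_within continuous_within[symmetric])
          show "\<forall>\<^sub>F x in at r within {-K..K}. 0 \<le> poly R' x"
            unfolding eventually_at_filter using off by (auto simp: abs_le_iff)
          show "at r within {-K..K} \<noteq> bot"
            using K r by (auto simp: trivial_limit_within islimpt_Icc abs_le_iff)
        qed
        with off have "0 \<le> poly R' x" if "\<bar>x\<bar> \<le> K" for x using that by (cases "x = r") auto
        moreover have "degree R' < degree P" using degR s by (simp add: R'_def)
        ultimately have "R' \<in> T" using less.hyps by blast
        moreover have "Polynomial.smult (2 * K) L = L * L + g"
          using s(2) by (simp add: L_def g_def power2_eq_square algebra_simps)
        ultimately show ?thesis unfolding M_fac by (rule T_linear)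
      qed
      moreover have "[:poly P r:] \<in> T" using less.prems[OF r] T_const by blast
      ultimately have "M + [:poly P r:] \<in> T" by (rule T_add)
      then show ?thesis by (simp add: M_def)
    qed
  qed
  from this[OF nn] show ?thesis unfolding T_def
    by (auto dest: spec[of _ 1])
qed

section \<open>Liouville numbers carry no atom\<close>

lemma poly_approx_from_above:
  fixes f :: "real \<Rightarrow> real"
  assumes "continuous_on {-K..K} f" "e > 0"
  obtains P where "\<And>x. \<bar>x\<bar> \<le> K \<Longrightarrow> f x \<le> poly P x" "\<And>x. \<bar>x\<bar> \<le> K \<Longrightarrow> poly P x \<le> f x + e"
proof -
  obtain g where g: "real_polynomial_function g" "\<And>x. x \<in> {-K..K} \<Longrightarrow> \<bar>f x - g x\<bar> < e/2"
    using Stone_Weierstrass_real_polynomial_function[of "{-K..K}" f "e/2"] assms by auto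
  obtain a n where an: "g = (\<lambda>x. \<Sum>i\<le>n. a i * x^i)" using g(1) real_polynomial_function_iff_sum by blast
  define P where "P = (\<Sum>i\<le>n. monom (a i) i) + [:e/2:]"
  have "poly P x = g x + e/2" for x unfolding P_def an by (simp add: poly_sum poly_monom)
  moreover have "f x \<le> g x + e/2 \<and> g x + e/2 \<le> f x + e" if "\<bar>x\<bar> \<le> K" for x
  proof -
    have "\<bar>f x - g x\<bar> < e/2" using g(2)[of x] that by (simp add: abs_le_iff)
    then show ?thesis by linarith
  qed
  ultimately show thesis by (intro that[of P]) simp_all
qed

lemma finite_separated_reals:
  fixes T :: "real set"
  assumes "finite T"
  obtains \<rho> where "\<rho> > 0" "\<And>r r'. r \<in> T \<Longrightarrow> r' \<in> T \<Longrightarrow> r \<noteq> r' \<Longrightarrow> 2 * \<rho> \<le> \<bar>r - r'\<bar>"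
proof -
  define D where "D = insert 1 ((\<lambda>(r, r'). \<bar>r - r'\<bar>) ` (T \<times> T - Id))"
  have D: "finite D" "D \<noteq> {}" "\<And>d. d \<in> D \<Longrightarrow> d > 0" using assms by (auto simp: D_def)
  show thesis
  proof (rule that[of "Min D / 2"])
    show "Min D / 2 > 0" using D by simp
    show "2 * (Min D / 2) \<le> \<bar>r - r'\<bar>" if "r \<in> T" "r' \<in> T" "r \<noteq> r'" for r r'
    proof -
      have "\<bar>r - r'\<bar> \<in> D" unfolding D_def using that by (auto intro!: image_eqI[of _ _ "(r, r')"])
      then show ?thesis using D(1) by simp
    qed
  qed
qed

lemma abs_of_int_mult_minus:
  fixes p q :: int and l :: real
  assumes "q > 1"
  shows "\<bar>of_int q * l - of_int p\<bar> = of_int q * \<bar>l - of_int p / of_int q\<bar>"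
proof -
  have "of_int q * l - of_int p = of_int q * (l - of_int p / of_int q)" using assms by (simp add: field_simps)
  then show ?thesis using assms by (simp add: abs_mult)
qed

text \<open>
  Finitely many approximations would have a positive minimal distance to \<open>l\<close>, but the approximations of
  high order come arbitrarily close.
\<close>

lemma infinite_liouville_approximants:
  fixes l :: real
  assumes "\<And>m. \<exists>p q :: int. q > 1 \<and> 0 < \<bar>of_int q * l - of_int p\<bar> \<and> \<bar>of_int q * l - of_int p\<bar> < 1 / of_int q ^ m"
  shows "infinite {of_int p / (of_int q :: real) | p q :: int.
     q > 1 \<and> 0 < \<bar>of_int q * l - of_int p\<bar> \<and> \<bar>of_int q * l - of_int p\<bar> < 1 / (of_int q ^ m :: real)}"
    (is "infinite (?S m)")
proof
  assume fin: "finite (?S m)"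
  define d where "d = Min ((\<lambda>r. \<bar>l - r\<bar>) ` ?S m)"
  have ne: "?S m \<noteq> {}" using assms[of m] by blast
  have "d > 0" unfolding d_def using fin ne by (subst Min_gr_iff) (auto simp: abs_of_int_mult_minus)
  then obtain k where k: "(1/2 :: real) ^ k < d" using real_arch_pow_inv[of d "1/2"] by auto
  obtain p q :: int where pq: "q > 1" "0 < \<bar>of_int q * l - of_int p\<bar>"
     "\<bar>of_int q * l - of_int p\<bar> < 1 / of_int q ^ (max m k)"
    using assms[of "max m k"] by blast
  have "1 / (of_int q :: real) ^ max m k \<le> 1 / of_int q ^ m"
    using pq(1) by (intro divide_left_mono power_increasing) auto
  then have "of_int p / of_int q \<in> ?S m" using pq by force
  then have "d \<le> \<bar>l - of_int p / of_int q\<bar>" unfolding d_def using fin by (intro Min_le) auto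
  also have "\<dots> \<le> of_int q * \<bar>l - of_int p / of_int q\<bar>"
    using pq(1) by (simp add: mult_le_cancel_right1)
  also have "\<dots> < 1 / of_int q ^ (max m k)" using pq by (simp add: abs_of_int_mult_minus)
  also have "\<dots> \<le> 1 / of_int q ^ k"
    using pq(1) by (intro divide_left_mono power_increasing) auto
  also have "\<dots> \<le> 1 / 2 ^ k"
    using pq(1) by (intro divide_left_mono power_mono) auto
  also have "\<dots> = (1/2) ^ k" by (simp add: power_one_over)
  finally show False using k by simp
qed

text \<open>
  Any finite number \<open>N\<close> of points of \<open>S\<close> carry disjointly supported tents, whose sum is at most \<open>1\<close>. So their
  values under \<open>\<Lambda>\<close> add up to a bounded amount, and one of them is of order \<open>1/N\<close>.
\<close>

lemma exists_peak_of_small_weight: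
  fixes \<Lambda> :: "real poly \<Rightarrow> real"
  assumes add: "\<And>P Q. \<Lambda> (P + Q) = \<Lambda> P + \<Lambda> Q" and smult: "\<And>c P. \<Lambda> (Polynomial.smult c P) = c * \<Lambda> P"
    and pos: "\<And>P. (\<And>x. \<bar>x\<bar> \<le> K \<Longrightarrow> 0 \<le> poly P x) \<Longrightarrow> 0 \<le> \<Lambda> P"
    and inf: "infinite S" and S: "\<And>r. r \<in> S \<Longrightarrow> \<bar>r\<bar> \<le> K" and e: "e > 0"
  shows "\<exists>r\<in>S. \<exists>P. (\<forall>x. \<bar>x\<bar> \<le> K \<longrightarrow> 0 \<le> poly P x) \<and> 1 \<le> poly P r \<and> \<Lambda> P \<le> e"
proof -
  obtain N :: nat where N: "2 * \<Lambda> 1 / e < N" using reals_Archimedean2 by blast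
  have one: "0 \<le> \<Lambda> 1" by (rule pos) simp
  then have N0: "N > 0" using N e by (cases N) (auto simp: field_simps)
  obtain T where T: "finite T" "card T = N" "T \<subseteq> S"
    using infinite_arbitrarily_large[OF inf] by blast
  obtain \<rho> where \<rho>: "\<rho> > 0" "\<And>r r'. r \<in> T \<Longrightarrow> r' \<in> T \<Longrightarrow> r \<noteq> r' \<Longrightarrow> 2 * \<rho> \<le> \<bar>r - r'\<bar>"
    using finite_separated_reals[OF T(1)] by blast
  define tent where "tent r x = max 0 (1 - \<bar>x - r\<bar> / \<rho>)" for r x :: real
  have tent_sum: "(\<Sum>r\<in>T. tent r x) \<le> 1" for x
  proof (cases "\<exists>r0\<in>T. tent r0 x \<noteq> 0")
    case True
    then obtain r0 where r0: "r0 \<in> T" "tent r0 x \<noteq> 0" by blast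
    have "tent r x = 0" if "r \<in> T - {r0}" for r
    proof -
      have "\<bar>x - r0\<bar> < \<rho>" using r0(2) \<rho>(1) by (auto simp: tent_def max_def field_simps split: if_splits)
      then have "\<bar>x - r\<bar> \<ge> \<rho>" using \<rho>(2)[of r r0] r0 that by auto
      then show ?thesis using \<rho>(1) by (simp add: tent_def max_def field_simps)
    qed
    then have "(\<Sum>r\<in>T. tent r x) = tent r0 x" using T(1) r0(1) by (subst sum.remove[of _ r0]) auto
    also have "\<dots> \<le> 1" using \<rho>(1) by (simp add: tent_def)
    finally show ?thesis .
  qed (simp add: sum.neutral)
  have "\<exists>P. \<forall>x. \<bar>x\<bar> \<le> K \<longrightarrow> tent r x \<le> poly P x \<and> poly P x \<le> tent r x + 1 / N" for r
  proof -
    have "continuous_on {-K..K} (tent r)" unfolding tent_def using \<rho>(1) by (intro continuous_intros) auto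
    from poly_approx_from_above[OF this, of "1 / N"] N0 show ?thesis by (metis of_nat_0_less_iff zero_less_divide_1_iff)
  qed
  then obtain P where P: "\<And>r x. \<bar>x\<bar> \<le> K \<Longrightarrow> tent r x \<le> poly (P r) x"
      "\<And>r x. \<bar>x\<bar> \<le> K \<Longrightarrow> poly (P r) x \<le> tent r x + 1 / N"
    by metis
  have \<Lambda>_sum: "\<Lambda> (sum P A) = (\<Sum>r\<in>A. \<Lambda> (P r))" if "finite A" for A
    using that by induction (use smult[of 0 0] add in auto)
  \<comment> \<open>The bound \<open>2\<close> consists of \<open>1\<close> for the tents and \<open>N * (1/N)\<close> for the approximation by polynomials.\<close>
  have "0 \<le> \<Lambda> ([:2:] - (\<Sum>r\<in>T. P r))"
  proof (rule pos)
    fix x assume x: "\<bar>x\<bar> \<le> K"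
    have "(\<Sum>r\<in>T. poly (P r) x) \<le> (\<Sum>r\<in>T. tent r x + 1 / N)" by (intro sum_mono P x)
    also have "\<dots> = (\<Sum>r\<in>T. tent r x) + 1" using T N0 by (simp add: sum.distrib)
    also have "\<dots> \<le> 2" using tent_sum[of x] by simp
    finally show "0 \<le> poly ([:2:] - (\<Sum>r\<in>T. P r)) x" by (simp add: poly_sum)
  qed
  also have "\<Lambda> ([:2:] - (\<Sum>r\<in>T. P r)) = 2 * \<Lambda> 1 - (\<Sum>r\<in>T. \<Lambda> (P r))"
    using add[of "[:2:] - (\<Sum>r\<in>T. P r)" "\<Sum>r\<in>T. P r"] smult[of 2 1] \<Lambda>_sum[OF T(1)] by (simp add: one_pCons)
  finally have total: "(\<Sum>r\<in>T. \<Lambda> (P r)) \<le> 2 * \<Lambda> 1" by simp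
  have "\<exists>r\<in>T. \<Lambda> (P r) \<le> e"
  proof (rule ccontr)
    assume "\<not> ?thesis"
    then have "(\<Sum>r\<in>T. e) \<le> (\<Sum>r\<in>T. \<Lambda> (P r))" by (intro sum_mono) auto
    then have "N * e \<le> 2 * \<Lambda> 1" using total T(2) by simp
    then show False using N e by (simp add: field_simps)
  qed
  then obtain r where r: "r \<in> T" "\<Lambda> (P r) \<le> e" by blast
  have nn: "0 \<le> poly (P r) x" if "\<bar>x\<bar> \<le> K" for x
    using P(1)[OF that, of r] by (simp add: tent_def)
  have "1 \<le> poly (P r) r" using P(1)[OF S, of r r] r T by (auto simp: tent_def)
  with r nn T(3) show ?thesis by blast
qed

text \<open>
  The functional plays the role of a measure on \<open>[-K, K]\<close>, with an atom of mass \<open>c\<close> at \<open>l\<close>, for which the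
  integral of \<open>ln \<bar>q x - p\<bar>\<close> off the point \<open>p/q\<close> is at least \<open>- E (ln q + F)\<close>. Let \<open>\<delta> = \<bar>q l - p\<bar>\<close>. The function
  \<open>ln (max \<bar>q x - p\<bar> \<delta>)\<close> is at most \<open>ln q + O(1)\<close> and equals \<open>ln \<delta>\<close> at the atom, which contributes
  \<open>c ln \<delta>\<close>. At \<open>p/q\<close> it is \<open>ln \<delta>\<close> as well, where nonnegativity is needed; this is repaired by adding
  \<open>- ln \<delta>\<close> times a peak of weight at most \<open>c/4\<close>. Hence \<open>(3/4) c ln \<delta>\<close> is bounded from below by a
  multiple of \<open>- ln q\<close>, contrary to \<open>\<delta> < q ^ (- m)\<close> for large \<open>m\<close>.
\<close>

lemma liouville_no_atom:
  fixes \<Lambda> :: "real poly \<Rightarrow> real"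
  assumes add: "\<And>P Q. \<Lambda> (P + Q) = \<Lambda> P + \<Lambda> Q" and smult: "\<And>c P. \<Lambda> (Polynomial.smult c P) = c * \<Lambda> P"
    and pos: "\<And>P. (\<And>x. \<bar>x\<bar> \<le> K \<Longrightarrow> 0 \<le> poly P x) \<Longrightarrow> 0 \<le> \<Lambda> P"
    and K: "\<bar>l\<bar> + 1 \<le> K" and c: "c > 0" and atom: "\<And>Q. c * (poly Q l)\<^sup>2 \<le> \<Lambda> (Q * Q)"
    and E: "E \<ge> 0" and F: "F \<ge> 0"
    and det: "\<And>(p :: int) (q :: int) P. q > 1 \<Longrightarrow> \<bar>of_int q * l - of_int p\<bar> \<le> 1 \<Longrightarrow> 0 \<le> poly P (of_int p / of_int q) \<Longrightarrow>
       (\<And>x. \<bar>x\<bar> \<le> K \<Longrightarrow> of_int q * x - of_int p \<noteq> 0 \<Longrightarrow> ln \<bar>of_int q * x - of_int p\<bar> \<le> poly P x) \<Longrightarrow>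
       - (E * (ln (of_int q) + F)) \<le> \<Lambda> P"
    and liouville: "\<And>m. \<exists>p q :: int. q > 1 \<and> 0 < \<bar>of_int q * l - of_int p\<bar> \<and> \<bar>of_int q * l - of_int p\<bar> < 1 / of_int q ^ m"
  shows False
proof -
  have \<Lambda>_diff: "\<Lambda> (P - Q) = \<Lambda> P - \<Lambda> Q" for P Q using add[of "P - Q" Q] by simp
  have \<Lambda>_const: "\<Lambda> [:a:] = a * \<Lambda> 1" for a using smult[of a 1] by (simp add: one_pCons)
  have one: "0 \<le> \<Lambda> 1" by (rule pos) simp
  \<comment> \<open>The hypothesis on the atom speaks of squares; a nonnegative polynomial is, up to a small error, the
    square of a polynomial that approximates its square root.\<close>
  have atom': "c * poly P l \<le> \<Lambda> P" if nn: "\<And>x. \<bar>x\<bar> \<le> K \<Longrightarrow> 0 \<le> poly P x" for P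
  proof -
    have cont: "continuous_on {-K..K} (\<lambda>x. sqrt (poly P x))" by (intro continuous_intros)
    have "bounded ((\<lambda>x. sqrt (poly P x)) ` {-K..K})"
      by (intro compact_imp_bounded compact_continuous_image cont) auto
    then obtain M where M: "\<And>x. \<bar>x\<bar> \<le> K \<Longrightarrow> \<bar>sqrt (poly P x)\<bar> \<le> M" unfolding bounded_iff by (fastforce simp: abs_le_iff)
    have M0: "M \<ge> 0" using M[of l] K by auto
    have step: "c * poly P l \<le> \<Lambda> P + e * ((2 * M + 1) * \<Lambda> 1)" if e: "0 < e" "e \<le> 1" for e
    proof -
      obtain Q where Q: "\<And>x. \<bar>x\<bar> \<le> K \<Longrightarrow> sqrt (poly P x) \<le> poly Q x" "\<And>x. \<bar>x\<bar> \<le> K \<Longrightarrow> poly Q x \<le> sqrt (poly P x) + e"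
        using poly_approx_from_above[OF cont e(1)] by blast
      have up: "(poly Q x)\<^sup>2 \<le> poly P x + e * (2 * M + 1)" if x: "\<bar>x\<bar> \<le> K" for x
      proof -
        have s0: "0 \<le> sqrt (poly P x)" using nn[OF x] by simp
        have "(poly Q x)\<^sup>2 \<le> (sqrt (poly P x) + e)\<^sup>2"
          using Q(1)[OF x] Q(2)[OF x] s0 by (intro power_mono) linarith+
        also have "\<dots> = poly P x + e * (2 * sqrt (poly P x) + e)"
          using nn[OF x] by (simp add: power2_eq_square algebra_simps flip: real_sqrt_mult)
        also have "\<dots> \<le> poly P x + e * (2 * M + 1)"
          using M[OF x] e s0 by (intro add_left_mono mult_left_mono) auto
        finally show ?thesis .
      qed
      have "0 \<le> \<Lambda> (P + [:e * (2 * M + 1):] - Q * Q)"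
        by (rule pos) (use up in \<open>auto simp: power2_eq_square\<close>)
      then have 1: "\<Lambda> (Q * Q) \<le> \<Lambda> P + e * ((2 * M + 1) * \<Lambda> 1)" by (simp add: \<Lambda>_diff add \<Lambda>_const mult_ac)
      have "poly P l \<le> (poly Q l)\<^sup>2"
        using Q(1)[of l] K nn[of l] power_mono[of "sqrt (poly P l)" "poly Q l" 2] by auto
      then have "c * poly P l \<le> c * (poly Q l)\<^sup>2" using c by simp
      with 1 atom[of Q] show ?thesis by linarith
    qed
    show ?thesis
    proof (rule field_le_epsilon)
      fix d :: real assume d: "0 < d"
      define B where "B = (2 * M + 1) * \<Lambda> 1"
      have B: "B \<ge> 0" using M0 one by (simp add: B_def)
      define e where "e = min 1 (d / (B + 1))"
      have e: "0 < e" "e \<le> 1" using d B by (auto simp: e_def)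
      have "e * B \<le> d / (B + 1) * B" using B by (intro mult_right_mono) (auto simp: e_def)
      also have "\<dots> \<le> d" using B d by (simp add: field_simps)
      finally show "c * poly P l \<le> \<Lambda> P + d" using step[OF e] unfolding B_def[symmetric] by linarith
    qed
  qed
  \<comment> \<open>\<open>C\<close> collects all terms of the final estimate that do not grow with \<open>q\<close>; division by \<open>ln 2 \<le> ln q\<close> turns
    them into a multiple of \<open>ln q\<close>, and \<open>m\<close> is chosen to beat the sum of all these multiples.\<close>
  define C where "C = \<Lambda> 1 * (ln (2 * K + 1) + 1) + c + E * F"
  have C0: "C \<ge> 0" using one c E F K by (simp add: C_def)
  obtain m :: nat where m: "(\<Lambda> 1 + E + C / ln 2) * 4 / (3 * c) < m" using reals_Archimedean2 by blast
  define S where "S = {of_int p / (of_int q :: real) | p q :: int. q > 1 \<and> 0 < \<bar>of_int q * l - of_int p\<bar> \<and>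
     \<bar>of_int q * l - of_int p\<bar> < 1 / (of_int q ^ m :: real)}"
  have infS: "infinite S" unfolding S_def by (rule infinite_liouville_approximants) (rule liouville)
  have small: "1 / (of_int q :: real) ^ m \<le> 1" if "q > 1" for q :: int using that by simp
  have S: "\<bar>r\<bar> \<le> K" if "r \<in> S" for r
  proof -
    obtain p q :: int where pq: "r = of_int p / of_int q" "q > 1" "\<bar>of_int q * l - of_int p\<bar> < 1 / (of_int q ^ m :: real)"
      using \<open>r \<in> S\<close> unfolding S_def by blast
    have "of_int q * \<bar>l - r\<bar> = \<bar>of_int q * l - of_int p\<bar>" using pq(1,2) by (simp add: abs_of_int_mult_minus)
    also have "\<dots> \<le> 1" using pq(3) small[OF pq(2)] by linarith
    finally have "of_int q * \<bar>l - r\<bar> \<le> 1" .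
    moreover have "\<bar>l - r\<bar> \<le> of_int q * \<bar>l - r\<bar>" using pq(2) by (simp add: mult_le_cancel_right1)
    ultimately show ?thesis using K by linarith
  qed
  obtain r P2 where r: "r \<in> S" and P2: "\<And>x. \<bar>x\<bar> \<le> K \<Longrightarrow> 0 \<le> poly P2 x" "1 \<le> poly P2 r" "\<Lambda> P2 \<le> c / 4"
    using exists_peak_of_small_weight[OF add smult pos infS S, of "c/4"] c by auto
  obtain p q :: int where pq: "r = of_int p / of_int q" "q > 1" "0 < \<bar>of_int q * l - of_int p\<bar>"
    "\<bar>of_int q * l - of_int p\<bar> < 1 / (of_int q ^ m :: real)"
    using r unfolding S_def by blast
  define \<delta> where "\<delta> = \<bar>of_int q * l - of_int p\<bar>"
  have \<delta>: "0 < \<delta>" "\<delta> < 1 / of_int q ^ m" "\<delta> \<le> 1" using pq(3,4) small[OF pq(2)] unfolding \<delta>_def by linarith+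
  have ln\<delta>: "ln \<delta> \<le> - (m * ln q)"
  proof -
    have "ln \<delta> \<le> ln (1 / of_int q ^ m)" using \<delta> by (intro ln_mono) auto
    also have "\<dots> = - (m * ln q)" using pq(2) by (simp add: ln_div ln_realpow)
    finally show ?thesis .
  qed
  define f where "f x = ln (max \<bar>of_int q * x - of_int p\<bar> \<delta>)" for x :: real
  have "continuous_on {-K..K} f" unfolding f_def using \<delta>(1) by (intro continuous_intros) (auto simp: max_def)
  then obtain P1 where P1: "\<And>x. \<bar>x\<bar> \<le> K \<Longrightarrow> f x \<le> poly P1 x" "\<And>x. \<bar>x\<bar> \<le> K \<Longrightarrow> poly P1 x \<le> f x + 1"
    using poly_approx_from_above[of K f 1] by auto
  have f_ge: "f x \<ge> ln \<delta>" for x unfolding f_def using \<delta>(1) by (intro ln_mono) auto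
  define P where "P = P1 + Polynomial.smult (- ln \<delta>) P2"
  have ln\<delta>0: "ln \<delta> \<le> 0" using \<delta> by simp
  have "- (E * (ln (of_int q) + F)) \<le> \<Lambda> P"
  proof (rule det[OF pq(2)])
    show "\<bar>of_int q * l - of_int p\<bar> \<le> 1" using \<delta> by (simp add: \<delta>_def)
    have "0 \<le> ln \<delta> + (- ln \<delta>) * 1" by simp
    also have "\<dots> \<le> poly P1 r + (- ln \<delta>) * poly P2 r"
      using P1(1)[OF S[OF r]] f_ge[of r] P2(2) ln\<delta>0 by (intro add_mono mult_left_mono) auto
    finally show "0 \<le> poly P (of_int p / of_int q)" by (simp add: P_def pq(1))
    fix x assume x: "\<bar>x\<bar> \<le> K" "of_int q * x - of_int p \<noteq> 0"
    have "ln \<bar>of_int q * x - of_int p\<bar> \<le> f x" unfolding f_def using x(2) \<delta> by (intro ln_mono) auto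
    also have "\<dots> \<le> poly P1 x" by (rule P1(1)[OF x(1)])
    also have "\<dots> \<le> poly P x" using P2(1)[OF x(1)] ln\<delta>0 by (simp add: P_def mult_nonpos_nonneg)
    finally show "ln \<bar>of_int q * x - of_int p\<bar> \<le> poly P x" .
  qed
  also have "\<Lambda> P = \<Lambda> P1 + (- ln \<delta>) * \<Lambda> P2" by (simp only: P_def add smult)
  also have "\<dots> \<le> \<Lambda> P1 + (- ln \<delta>) * (c / 4)" using P2(3) ln\<delta>0 by (intro add_left_mono mult_left_mono) auto
  finally have lower: "- (E * (ln (of_int q) + F)) \<le> \<Lambda> P1 - ln \<delta> * (c / 4)" by simp
  define L where "L = ln (of_int q) + ln (2 * K + 1) + 1"
  have f_le: "f x \<le> L - 1" if x: "\<bar>x\<bar> \<le> K" for x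
  proof -
    have "\<bar>of_int q * (x - l)\<bar> = of_int q * \<bar>x - l\<bar>" using pq(2) by (simp add: abs_mult)
    moreover have "of_int q * x - of_int p = of_int q * (x - l) + (of_int q * l - of_int p)" by (simp add: algebra_simps)
    ultimately have "\<bar>of_int q * x - of_int p\<bar> \<le> of_int q * \<bar>x - l\<bar> + \<delta>"
      using abs_triangle_ineq[of "of_int q * (x - l)" "of_int q * l - of_int p"] by (simp add: \<delta>_def)
    also have "\<dots> \<le> of_int q * (2 * K) + 1"
      using \<delta> pq(2) x K by (intro add_mono mult_left_mono) auto
    also have "\<dots> \<le> of_int q * (2 * K + 1)" using pq(2) by (simp add: algebra_simps)
    finally have "max \<bar>of_int q * x - of_int p\<bar> \<delta> \<le> of_int q * (2 * K + 1)"
      using \<delta>(3) pq(2) K by (auto simp: max_def algebra_simps) (smt (verit) mult_nonneg_nonneg of_int_1_less_iff)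
    then have "f x \<le> ln (of_int q * (2 * K + 1))" unfolding f_def using \<delta>(1) by (intro ln_mono) auto
    also have "\<dots> = L - 1" using pq(2) K by (simp add: L_def ln_mult)
    finally show ?thesis .
  qed
  have "f l = ln \<delta>" by (simp add: f_def \<delta>_def)
  have "c * (L - (ln \<delta> + 1)) \<le> c * poly ([:L:] - P1) l"
    using P1(2)[of l] K c \<open>f l = ln \<delta>\<close> by simp
  also have "\<dots> \<le> \<Lambda> ([:L:] - P1)"
  proof (rule atom')
    show "0 \<le> poly ([:L:] - P1) x" if "\<bar>x\<bar> \<le> K" for x using P1(2)[OF that] f_le[OF that] by simp
  qed
  also have "\<dots> = L * \<Lambda> 1 - \<Lambda> P1" by (simp add: \<Lambda>_diff \<Lambda>_const)
  finally have upper: "\<Lambda> P1 \<le> L * \<Lambda> 1 - c * L + c * ln \<delta> + c" by (simp add: algebra_simps)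
  have lnq: "ln 2 \<le> ln (of_int q :: real)" using pq(2) by (intro ln_mono) auto
  have L0: "L \<ge> 0" using pq(2) K by (simp add: L_def)
  have "c * L \<ge> 0" using c L0 by simp
  then have "- (E * (ln (of_int q) + F)) \<le> L * \<Lambda> 1 + c + (3/4) * c * ln \<delta>" using lower upper by (simp add: algebra_simps)
  also have "\<dots> \<le> L * \<Lambda> 1 + c - (3/4) * c * (m * ln q)" using ln\<delta> c mult_left_mono[OF ln\<delta>, of "(3/4)*c"] by simp
  finally have "(3/4) * c * m * ln q \<le> (\<Lambda> 1 + E) * ln q + C" by (simp add: L_def C_def algebra_simps)
  also have "C \<le> C / ln 2 * ln q" using C0 lnq by (simp add: field_simps mult_left_mono)
  finally have "(3/4) * c * m * ln q \<le> (\<Lambda> 1 + E + C / ln 2) * ln q" by (simp add: algebra_simps)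
  then have "(3/4) * c * m \<le> \<Lambda> 1 + E + C / ln 2" using lnq ln_gt_zero[of "2::real"] by (metis mult_right_le_imp_le order_less_le_trans one_less_numeral_iff semiring_norm(76))
  then show False using m c by (simp add: field_simps)
qed

section \<open>Powers of kernels and spectral functionals\<close>

text \<open>
  A kernel is an infinite matrix with finitely many nonzero entries in each row, and \<open>kpow a k z w\<close> is
  the entry of its \<open>k\<close>-th power: the sum over all paths of length \<open>k\<close> from \<open>z\<close> to \<open>w\<close>. Summation over the
  support of the row keeps the sums finite without restricting the index type.
\<close>

primrec kpow :: "('z \<Rightarrow> 'z \<Rightarrow> complex) \<Rightarrow> nat \<Rightarrow> 'z \<Rightarrow> 'z \<Rightarrow> complex" where
  "kpow a 0 z w = (if z = w then 1 else 0)"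
| "kpow a (Suc k) z w = (\<Sum>y | a z y \<noteq> 0. a z y * kpow a k y w)"

text \<open>
  Only the points that are reachable from \<open>z\<close> in \<open>k\<close> steps matter for the \<open>k\<close>-th power. Here \<open>U m\<close> is a set of
  points from which \<open>m\<close> further steps stay in the region where \<open>\<theta>\<close> is an isomorphism of kernels. All
  comparisons between different groups below are instances of this lemma.
\<close>

lemma kpow_local_iso:
  assumes nbr: "\<And>m z. z \<in> U (Suc m) \<Longrightarrow> {y'. a' (\<theta> z) y' \<noteq> 0} = \<theta> ` {y. a z y \<noteq> 0}"
    and val: "\<And>m z y. z \<in> U (Suc m) \<Longrightarrow> a z y \<noteq> 0 \<Longrightarrow> y \<in> U m \<and> a' (\<theta> z) (\<theta> y) = a z y"
    and dec: "\<And>m. U (Suc m) \<subseteq> U m" and inj: "inj_on \<theta> (U 0)" and w: "w \<in> U 0" and z: "z \<in> U k"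
  shows "kpow a' k (\<theta> z) (\<theta> w) = kpow a k z w"
  using z
proof (induction k arbitrary: z)
  case 0
  then show ?case using inj w by (auto simp: inj_on_def)
next
  case (Suc k)
  have U0: "U m \<subseteq> U 0" for m using dec by (induction m) auto
  have "inj_on \<theta> {y. a z y \<noteq> 0}" using val[OF Suc.prems] U0 by (intro inj_on_subset[OF inj]) auto
  then have "kpow a' (Suc k) (\<theta> z) (\<theta> w) = (\<Sum>y | a z y \<noteq> 0. a' (\<theta> z) (\<theta> y) * kpow a' k (\<theta> y) (\<theta> w))"
    by (simp add: nbr[OF Suc.prems] sum.reindex)
  also have "\<dots> = kpow a (Suc k) z w"
    using val[OF Suc.prems] Suc.IH by (auto intro!: sum.cong)
  finally show ?case .
qed

definition row_finite :: "('z \<Rightarrow> 'z \<Rightarrow> complex) \<Rightarrow> bool" where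
  "row_finite a \<longleftrightarrow> (\<forall>z. finite {y. a z y \<noteq> 0})"

lemma kpow_finite: "row_finite a \<Longrightarrow> finite {y. kpow a k z y \<noteq> 0}"
proof (induction k arbitrary: z)
  case (Suc k)
  have "{y. kpow a (Suc k) z y \<noteq> 0} \<subseteq> (\<Union>x\<in>{y. a z y \<noteq> 0}. {y. kpow a k x y \<noteq> 0})"
    by (auto elim!: sum.not_neutral_contains_not_neutral)
  then show ?case by (rule finite_subset) (use Suc in \<open>auto simp: row_finite_def\<close>)
qed simp

lemma kpow_add:
  assumes "row_finite a" "finite Y" "{y. kpow a m z y \<noteq> 0} \<subseteq> Y"
  shows "kpow a (m + k) z w = (\<Sum>y\<in>Y. kpow a m z y * kpow a k y w)"
  using assms(2,3)
proof (induction m arbitrary: z Y)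
  case 0
  then have "z \<in> Y" by auto
  have "(\<Sum>y\<in>Y. kpow a 0 z y * kpow a k y w) = (\<Sum>y\<in>Y. if z = y then kpow a k y w else 0)"
    by (intro sum.cong) auto
  also have "\<dots> = kpow a (0 + k) z w" using \<open>z \<in> Y\<close> 0 by simp
  finally show ?case by simp
next
  case (Suc m)
  have fin: "finite {y. a z y \<noteq> 0}" using assms(1) by (simp add: row_finite_def)
  define Y' where "Y' = Y \<union> (\<Union>x\<in>{y. a z y \<noteq> 0}. {y. kpow a m x y \<noteq> 0})"
  have Y': "finite Y'" unfolding Y'_def using Suc.prems fin kpow_finite[OF assms(1)] by auto
  have "kpow a (Suc m + k) z w = (\<Sum>x | a z x \<noteq> 0. a z x * (\<Sum>y\<in>Y'. kpow a m x y * kpow a k y w))"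
    by simp (intro sum.cong refl arg_cong2[of _ _ _ _ "(*)"] Suc.IH Y'; auto simp: Y'_def)
  also have "\<dots> = (\<Sum>x | a z x \<noteq> 0. \<Sum>y\<in>Y'. a z x * kpow a m x y * kpow a k y w)"
    by (simp add: sum_distrib_left mult.assoc)
  also have "\<dots> = (\<Sum>y\<in>Y'. \<Sum>x | a z x \<noteq> 0. a z x * kpow a m x y * kpow a k y w)"
    by (rule sum.swap)
  also have "\<dots> = (\<Sum>y\<in>Y'. kpow a (Suc m) z y * kpow a k y w)" by (simp add: sum_distrib_right)
  also have "\<dots> = (\<Sum>y\<in>Y. kpow a (Suc m) z y * kpow a k y w)"
    using Y' Suc.prems by (intro sum.mono_neutral_right) (auto simp: Y'_def)
  finally show ?case .
qed

lemma kpow_1: "row_finite a \<Longrightarrow> kpow a 1 z w = a z w"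
proof -
  assume "row_finite a"
  then have "finite {y. a z y \<noteq> 0}" by (simp add: row_finite_def)
  moreover have "kpow a 1 z w = (\<Sum>y | a z y \<noteq> 0. if y = w then a z y else 0)"
    by (auto intro!: sum.cong)
  ultimately show ?thesis by (simp add: sum.delta)
qed

definition hermitian_kernel :: "('z \<Rightarrow> 'z \<Rightarrow> complex) \<Rightarrow> bool" where
  "hermitian_kernel a \<longleftrightarrow> (\<forall>z w. a w z = cnj (a z w))"

lemma kpow_cnj:
  assumes "row_finite a" "hermitian_kernel a"
  shows "kpow a k w z = cnj (kpow a k z w)"
proof (induction k arbitrary: z)
  case (Suc k)
  define Y where "Y = {y. kpow a k w y \<noteq> 0} \<union> {y. a z y \<noteq> 0}"
  have Y: "finite Y" using assms(1) kpow_finite[OF assms(1)] by (auto simp: Y_def row_finite_def)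
  have "kpow a (k + 1) w z = (\<Sum>y\<in>Y. kpow a k w y * kpow a 1 y z)"
    by (rule kpow_add[OF assms(1) Y]) (auto simp: Y_def)
  also have "\<dots> = (\<Sum>y\<in>Y. cnj (a z y * kpow a k y w))"
  proof (rule sum.cong)
    fix y
    have "a y z = cnj (a z y)" using assms(2) unfolding hermitian_kernel_def by blast
    then show "kpow a k w y * kpow a 1 y z = cnj (a z y * kpow a k y w)"
      by (simp only: kpow_1[OF assms(1)] Suc.IH[of y] complex_cnj_mult mult.commute)
  qed simp
  also have "\<dots> = cnj (kpow a (Suc k) z w)"
    unfolding cnj_sum[symmetric] kpow.simps using Y by (intro arg_cong[of _ _ cnj] sum.mono_neutral_right) (auto simp: Y_def)
  finally show ?case by simp
qed simp

definition row_bound :: "real \<Rightarrow> ('z \<Rightarrow> 'z \<Rightarrow> complex) \<Rightarrow> bool" where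
  "row_bound \<kappa> a \<longleftrightarrow> row_finite a \<and> (\<forall>z. (\<Sum>y | a z y \<noteq> 0. norm (a z y)) \<le> \<kappa>)"

lemma norm_kpow_le:
  assumes "row_bound \<kappa> a"
  shows "norm (kpow a k z w) \<le> \<kappa> ^ k"
proof (induction k arbitrary: z)
  case (Suc k)
  have "0 \<le> (\<Sum>y | a z y \<noteq> 0. norm (a z y))" by (intro sum_nonneg) auto
  then have \<kappa>: "\<kappa> \<ge> 0" using assms unfolding row_bound_def by (meson order_trans)
  have "norm (kpow a (Suc k) z w) \<le> (\<Sum>y | a z y \<noteq> 0. norm (a z y) * norm (kpow a k y w))"
    unfolding kpow.simps by (rule order_trans[OF norm_sum]) (simp add: norm_mult)
  also have "\<dots> \<le> (\<Sum>y | a z y \<noteq> 0. norm (a z y) * \<kappa> ^ k)"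
    by (intro sum_mono mult_left_mono Suc.IH) auto
  also have "\<dots> = (\<Sum>y | a z y \<noteq> 0. norm (a z y)) * \<kappa> ^ k" by (simp add: sum_distrib_right)
  also have "\<dots> \<le> \<kappa> * \<kappa> ^ k" using assms \<kappa> by (intro mult_right_mono) (auto simp: row_bound_def)
  finally show ?case by simp
qed simp

text \<open>
  Cauchy and Schwarz with the weights \<open>\<bar>a z y\<bar>\<close>; the column sums that appear after exchanging the
  summations are row sums, by hermitian symmetry.
\<close>

lemma schur_test:
  assumes rb: "row_bound \<kappa> a" and herm: "hermitian_kernel a" and Z: "finite Z" and Y: "finite Y" "{y. v y \<noteq> 0} \<subseteq> Y"
  shows "(\<Sum>z\<in>Z. (norm (\<Sum>y | a z y \<noteq> 0. a z y * v y))\<^sup>2) \<le> \<kappa>\<^sup>2 * (\<Sum>y\<in>Y. (norm (v y))\<^sup>2)"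
proof -
  have fin: "finite {y. a z y \<noteq> 0}" for z using rb by (simp add: row_bound_def row_finite_def)
  have rs: "(\<Sum>y\<in>T. norm (a z y)) \<le> \<kappa>" if "finite T" for z T
  proof -
    have "(\<Sum>y\<in>T. norm (a z y)) = (\<Sum>y\<in>T \<inter> {y. a z y \<noteq> 0}. norm (a z y))"
      using that by (intro sum.mono_neutral_right) auto
    also have "\<dots> \<le> (\<Sum>y | a z y \<noteq> 0. norm (a z y))" by (intro sum_mono2 fin) auto
    also have "\<dots> \<le> \<kappa>" using rb by (simp add: row_bound_def)
    finally show ?thesis .
  qed
  have \<kappa>: "\<kappa> \<ge> 0" using rs[of "{}"] by simp
  have norm_sym: "norm (a z y) = norm (a y z)" for y z
  proof -
    have "a z y = cnj (a y z)" using herm unfolding hermitian_kernel_def by blast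
    then show ?thesis by (simp only: complex_mod_cnj)
  qed
  have row: "(norm (\<Sum>y | a z y \<noteq> 0. a z y * v y))\<^sup>2 \<le> \<kappa> * (\<Sum>y\<in>Y. norm (a z y) * (norm (v y))\<^sup>2)" for z
  proof -
    have "(\<Sum>y | a z y \<noteq> 0. a z y * v y) = (\<Sum>y\<in>{y. a z y \<noteq> 0} \<inter> Y. a z y * v y)"
      using Y fin by (intro sum.mono_neutral_right) auto
    also have "\<dots> = (\<Sum>y\<in>Y. a z y * v y)" using Y by (intro sum.mono_neutral_left) auto
    finally have "norm (\<Sum>y | a z y \<noteq> 0. a z y * v y) \<le> (\<Sum>y\<in>Y. norm (a z y) * norm (v y))"
      by (simp add: norm_sum flip: norm_mult)
    also have "\<dots> = (\<Sum>y\<in>Y. sqrt (norm (a z y)) * (sqrt (norm (a z y)) * norm (v y)))"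
      by (simp flip: mult.assoc)
    finally have "(norm (\<Sum>y | a z y \<noteq> 0. a z y * v y))\<^sup>2 \<le> (\<Sum>y\<in>Y. sqrt (norm (a z y)) * (sqrt (norm (a z y)) * norm (v y)))\<^sup>2"
      by (intro power_mono) auto
    also have "\<dots> \<le> (\<Sum>y\<in>Y. (sqrt (norm (a z y)))\<^sup>2) * (\<Sum>y\<in>Y. (sqrt (norm (a z y)) * norm (v y))\<^sup>2)"
      by (rule Cauchy_Schwarz_ineq_sum)
    also have "\<dots> = (\<Sum>y\<in>Y. norm (a z y)) * (\<Sum>y\<in>Y. norm (a z y) * (norm (v y))\<^sup>2)"
      by (simp add: power_mult_distrib)
    also have "\<dots> \<le> \<kappa> * (\<Sum>y\<in>Y. norm (a z y) * (norm (v y))\<^sup>2)"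
      using Y by (intro mult_right_mono rs sum_nonneg) auto
    finally show ?thesis .
  qed
  have "(\<Sum>z\<in>Z. (norm (\<Sum>y | a z y \<noteq> 0. a z y * v y))\<^sup>2) \<le> (\<Sum>z\<in>Z. \<kappa> * (\<Sum>y\<in>Y. norm (a z y) * (norm (v y))\<^sup>2))"
    by (intro sum_mono row)
  also have "\<dots> = \<kappa> * (\<Sum>z\<in>Z. \<Sum>y\<in>Y. norm (a z y) * (norm (v y))\<^sup>2)" by (simp add: sum_distrib_left)
  also have "\<dots> = \<kappa> * (\<Sum>y\<in>Y. \<Sum>z\<in>Z. norm (a z y) * (norm (v y))\<^sup>2)" by (subst sum.swap) simp
  also have "\<dots> = \<kappa> * (\<Sum>y\<in>Y. (\<Sum>z\<in>Z. norm (a y z)) * (norm (v y))\<^sup>2)"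
    unfolding sum_distrib_right by (intro arg_cong2[of _ _ _ _ "(*)"] sum.cong refl norm_sym)
  also have "\<dots> \<le> \<kappa> * (\<Sum>y\<in>Y. \<kappa> * (norm (v y))\<^sup>2)"
    by (intro mult_left_mono sum_mono mult_right_mono rs Z \<kappa>) auto
  also have "\<dots> = \<kappa>\<^sup>2 * (\<Sum>y\<in>Y. (norm (v y))\<^sup>2)" by (simp add: sum_distrib_left power2_eq_square mult.assoc)
  finally show ?thesis .
qed

text \<open>
  The linear functional with given values \<open>\<mu> k\<close> on the powers \<open>x ^ k\<close>. Applied to the entries of the powers
  of a kernel \<open>a\<close> it yields the entries of \<open>P(a)\<close>, and applied to the powers of a number it is evaluation.
\<close>

definition moment_functional :: "(nat \<Rightarrow> complex) \<Rightarrow> real poly \<Rightarrow> complex" where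
  "moment_functional \<mu> P = (\<Sum>k\<le>degree P. of_real (coeff P k) * \<mu> k)"

lemma moment_functional_eq:
  assumes "degree P \<le> n"
  shows "moment_functional \<mu> P = (\<Sum>k\<le>n. of_real (coeff P k) * \<mu> k)"
  unfolding moment_functional_def using assms
  by (intro sum.mono_neutral_left) (auto simp: coeff_eq_0)

lemma moment_functional_add: "moment_functional \<mu> (P + Q) = moment_functional \<mu> P + moment_functional \<mu> Q"
proof -
  have "degree (P + Q) \<le> max (degree P) (degree Q)" by (rule degree_add_le_max)
  then show ?thesis
    by (subst (1 2 3) moment_functional_eq[of _ "max (degree P) (degree Q)"])
       (simp_all add: sum.distrib distrib_right)
qed

lemma moment_functional_smult: "moment_functional \<mu> (Polynomial.smult c P) = of_real c * moment_functional \<mu> P"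
  by (subst moment_functional_eq[OF degree_smult_le]) (simp add: moment_functional_def sum_distrib_left mult.assoc)

lemma moment_functional_pCons:
  "moment_functional \<mu> (pCons c P) = of_real c * \<mu> 0 + moment_functional (\<lambda>k. \<mu> (Suc k)) P"
proof -
  have "moment_functional \<mu> (pCons c P) = (\<Sum>k\<le>Suc (degree P). of_real (coeff (pCons c P) k) * \<mu> k)"
    by (rule moment_functional_eq) (rule degree_pCons_le)
  then show ?thesis unfolding sum.atMost_Suc_shift by (simp add: moment_functional_def)
qed

lemma moment_functional_0 [simp]: "moment_functional \<mu> 0 = 0"
  by (simp add: moment_functional_def)

lemma moment_functional_mult:
  "moment_functional \<mu> (P * Q) = moment_functional (\<lambda>i. moment_functional (\<lambda>j. \<mu> (i + j)) Q) P"
proof (induction P arbitrary: \<mu>)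
  case (pCons c P)
  then show ?case
    by (simp add: moment_functional_add moment_functional_smult moment_functional_pCons)
qed simp

lemma moment_functional_sum:
  "moment_functional (\<lambda>k. \<Sum>z\<in>Z. \<mu> z k) P = (\<Sum>z\<in>Z. moment_functional (\<mu> z) P)"
  unfolding moment_functional_def by (subst sum.swap) (simp add: sum_distrib_left)

lemma moment_functional_cmult:
  "moment_functional (\<lambda>k. c * \<mu> k) P = c * moment_functional \<mu> P"
  "moment_functional (\<lambda>k. \<mu> k * c) P = moment_functional \<mu> P * c"
  by (simp_all add: moment_functional_def sum_distrib_left sum_distrib_right mult_ac)

lemma moment_functional_cnj: "moment_functional (\<lambda>k. cnj (\<mu> k)) P = cnj (moment_functional \<mu> P)"
  by (simp add: moment_functional_def)

lemma moment_functional_power: "moment_functional (\<lambda>k. of_real l ^ k) P = of_real (poly P l)"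
  by (simp add: moment_functional_def poly_altdef)

text \<open>
  The diagonal entry of \<open>P(a)\<close> at \<open>w\<close>, that is, the integral of \<open>P\<close> with respect to the spectral measure
  of \<open>a\<close> at the basis vector \<open>w\<close>.
\<close>

definition spectral :: "('z \<Rightarrow> 'z \<Rightarrow> complex) \<Rightarrow> 'z \<Rightarrow> real poly \<Rightarrow> real" where
  "spectral a w P = Re (moment_functional (\<lambda>k. kpow a k w w) P)"

lemma spectral_linear:
  "spectral a w (P + Q) = spectral a w P + spectral a w Q"
  "spectral a w (Polynomial.smult c P) = c * spectral a w P"
  by (simp_all add: spectral_def moment_functional_add moment_functional_smult)

lemma poly_vector_support:
  assumes "row_finite a"
  obtains Z where "finite Z" "\<And>k z. k \<le> n \<Longrightarrow> kpow a k w z \<noteq> 0 \<Longrightarrow> z \<in> Z"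
proof (rule that[of "\<Union>k\<le>n. {z. kpow a k w z \<noteq> 0}"])
  show "finite (\<Union>k\<le>n. {z. kpow a k w z \<noteq> 0})" using kpow_finite[OF assms] by auto
qed auto

text \<open>
  \<open>\<langle>Q(a) Q(a) e\<^sub>w, e\<^sub>w\<rangle>\<close> is the square of the norm of the finitely supported vector \<open>Q(a) e\<^sub>w\<close>.
\<close>

lemma spectral_square:
  assumes "row_finite a" "hermitian_kernel a" "finite Z"
    and Z: "\<And>k z. k \<le> degree Q \<Longrightarrow> kpow a k w z \<noteq> 0 \<Longrightarrow> z \<in> Z"
  shows "spectral a w (Q * Q) = (\<Sum>z\<in>Z. (norm (moment_functional (\<lambda>k. kpow a k z w) Q))\<^sup>2)"
proof -
  let ?v = "\<lambda>z. moment_functional (\<lambda>k. kpow a k z w) Q"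
  have "moment_functional (\<lambda>k. kpow a k w w) (Q * Q)
      = (\<Sum>i\<le>degree Q. of_real (coeff Q i) * moment_functional (\<lambda>j. kpow a (i + j) w w) Q)"
    unfolding moment_functional_mult by (rule moment_functional_def)
  also have "\<dots> = (\<Sum>i\<le>degree Q. of_real (coeff Q i) * moment_functional (\<lambda>j. \<Sum>z\<in>Z. cnj (kpow a i z w) * kpow a j z w) Q)"
  proof (intro sum.cong refl arg_cong2[of _ _ _ _ "(*)"] arg_cong2[of _ _ _ _ moment_functional] ext)
    fix i j assume "i \<in> {..degree Q}"
    then have "kpow a (i + j) w w = (\<Sum>z\<in>Z. kpow a i w z * kpow a j z w)"
      using Z by (intro kpow_add assms) auto
    then show "kpow a (i + j) w w = (\<Sum>z\<in>Z. cnj (kpow a i z w) * kpow a j z w)"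
      by (simp flip: kpow_cnj[OF assms(1,2)])
  qed
  also have "\<dots> = (\<Sum>i\<le>degree Q. of_real (coeff Q i) * (\<Sum>z\<in>Z. cnj (kpow a i z w) * ?v z))"
    by (simp add: moment_functional_sum moment_functional_cmult)
  also have "\<dots> = moment_functional (\<lambda>i. \<Sum>z\<in>Z. cnj (kpow a i z w) * ?v z) Q"
    by (rule moment_functional_def[symmetric])
  also have "\<dots> = (\<Sum>z\<in>Z. cnj (?v z) * ?v z)"
    by (simp add: moment_functional_sum moment_functional_cmult moment_functional_cnj)
  also have "\<dots> = of_real (\<Sum>z\<in>Z. (norm (?v z))\<^sup>2)"
    unfolding of_real_sum by (intro sum.cong refl) (subst complex_norm_square, rule mult.commute)
  finally show ?thesis by (simp only: spectral_def Re_complex_of_real)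
qed

text \<open>
  On squares the functional is a squared norm, and \<open>K\<^sup>2 - x\<^sup>2\<close> times a square is handled by the Schur test,
  which says that \<open>a\<close> has norm at most \<open>\<kappa>\<close>.
\<close>

lemma spectral_nonneg:
  assumes rb: "row_bound \<kappa> a" and herm: "hermitian_kernel a" and K: "\<kappa> \<le> K" "0 < K"
    and nn: "\<And>x. \<bar>x\<bar> \<le> K \<Longrightarrow> 0 \<le> poly P x"
  shows "0 \<le> spectral a w P"
proof (rule nonneg_on_interval_functional[OF spectral_linear K(2) _ _ nn])
  have rf: "row_finite a" using rb by (simp add: row_bound_def)
  have "0 \<le> (\<Sum>y | a w y \<noteq> 0. norm (a w y))" by (intro sum_nonneg) auto
  then have \<kappa>: "0 \<le> \<kappa>" using rb unfolding row_bound_def by (meson order_trans)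
  show "0 \<le> spectral a w (Q * Q)" for Q
  proof -
    obtain Z where Z: "finite Z" "\<And>k z. k \<le> degree Q \<Longrightarrow> kpow a k w z \<noteq> 0 \<Longrightarrow> z \<in> Z"
      using poly_vector_support[OF rf] by metis
    show ?thesis by (subst spectral_square[OF rf herm Z]) (auto intro: sum_nonneg)
  qed
  show "0 \<le> spectral a w ([:K\<^sup>2, 0, -1:] * (Q * Q))" for Q
  proof -
    obtain Z where Z: "finite Z" "\<And>k z. k \<le> Suc (degree Q) \<Longrightarrow> kpow a k w z \<noteq> 0 \<Longrightarrow> z \<in> Z"
      using poly_vector_support[OF rf] by metis
    have Z1: "k \<le> degree Q \<Longrightarrow> kpow a k w z \<noteq> 0 \<Longrightarrow> z \<in> Z" for k z using Z(2)[of k z] by simp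
    have Z2: "k \<le> degree (pCons 0 Q) \<Longrightarrow> kpow a k w z \<noteq> 0 \<Longrightarrow> z \<in> Z" for k z
      using Z(2)[of k z] degree_pCons_le[of 0 Q] by linarith
    define v where "v z = moment_functional (\<lambda>k. kpow a k z w) Q" for z
    have v': "moment_functional (\<lambda>k. kpow a k z w) (pCons 0 Q) = (\<Sum>y | a z y \<noteq> 0. a z y * v y)" for z
      by (simp add: v_def moment_functional_pCons moment_functional_sum moment_functional_cmult)
    have "{z. v z \<noteq> 0} \<subseteq> Z"
    proof clarify
      fix z assume "v z \<noteq> 0"
      then obtain k where "k \<le> degree Q" "kpow a k z w \<noteq> 0"
        unfolding v_def moment_functional_def by (auto elim!: sum.not_neutral_contains_not_neutral)
      then show "z \<in> Z" using Z1[of k z] kpow_cnj[OF rf herm, of k w z] by simp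
    qed
    then have supp: "{z. v z \<noteq> 0} \<subseteq> Z" .
    have "spectral a w (pCons 0 Q * pCons 0 Q)
        = (\<Sum>z\<in>Z. (norm (moment_functional (\<lambda>k. kpow a k z w) (pCons 0 Q)))\<^sup>2)"
      by (rule spectral_square[OF rf herm Z(1) Z2])
    also have "\<dots> = (\<Sum>z\<in>Z. (norm (\<Sum>y | a z y \<noteq> 0. a z y * v y))\<^sup>2)" by (simp only: v')
    also have "\<dots> \<le> \<kappa>\<^sup>2 * (\<Sum>z\<in>Z. (norm (v z))\<^sup>2)"
      by (rule schur_test[OF rb herm Z(1) Z(1) supp])
    also have "\<dots> \<le> K\<^sup>2 * (\<Sum>z\<in>Z. (norm (v z))\<^sup>2)"
      using K \<kappa> by (intro mult_right_mono power_mono sum_nonneg) auto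
    also have "(\<Sum>z\<in>Z. (norm (v z))\<^sup>2) = spectral a w (Q * Q)"
      unfolding v_def by (rule spectral_square[OF rf herm Z(1) Z1, symmetric])
    finally have "spectral a w (pCons 0 Q * pCons 0 Q) \<le> K\<^sup>2 * spectral a w (Q * Q)" .
    moreover have "[:K\<^sup>2, 0, -1:] * (Q * Q) = Polynomial.smult (K\<^sup>2) (Q * Q) + Polynomial.smult (-1) (pCons 0 Q * pCons 0 Q)"
      by simp
    ultimately show ?thesis by (simp only: spectral_linear)
  qed
qed

lemma kpow_eigenvector:
  assumes "row_finite a" and eig: "\<And>z. (\<Sum>y | a z y \<noteq> 0. a z y * f y) = of_real l * f z"
    and "finite Z" "{z. kpow a k w z \<noteq> 0} \<subseteq> Z"
  shows "(\<Sum>z\<in>Z. kpow a k w z * f z) = of_real l ^ k * f w"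
  using assms(3,4)
proof (induction k arbitrary: w Z)
  case 0
  then have "w \<in> Z" by auto
  have "(\<Sum>z\<in>Z. kpow a 0 w z * f z) = (\<Sum>z\<in>Z. if w = z then f z else 0)" by (intro sum.cong) auto
  also have "\<dots> = f w" using \<open>w \<in> Z\<close> 0(1) by simp
  finally show ?case by simp
next
  case (Suc k)
  have fin: "finite {y. a w y \<noteq> 0}" using assms(1) by (simp add: row_finite_def)
  define Z' where "Z' = Z \<union> (\<Union>x\<in>{y. a w y \<noteq> 0}. {y. kpow a k x y \<noteq> 0})"
  have Z': "finite Z'" unfolding Z'_def using Suc.prems fin kpow_finite[OF assms(1)] by auto
  have "(\<Sum>z\<in>Z. kpow a (Suc k) w z * f z) = (\<Sum>z\<in>Z'. kpow a (Suc k) w z * f z)"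
    using Z' Suc.prems by (intro sum.mono_neutral_left) (auto simp: Z'_def)
  also have "\<dots> = (\<Sum>z\<in>Z'. \<Sum>y | a w y \<noteq> 0. a w y * (kpow a k y z * f z))"
    by (simp add: sum_distrib_right mult.assoc)
  also have "\<dots> = (\<Sum>y | a w y \<noteq> 0. \<Sum>z\<in>Z'. a w y * (kpow a k y z * f z))"
    by (rule sum.swap)
  also have "\<dots> = (\<Sum>y | a w y \<noteq> 0. a w y * (\<Sum>z\<in>Z'. kpow a k y z * f z))"
    by (simp only: sum_distrib_left)
  also have "\<dots> = (\<Sum>y | a w y \<noteq> 0. a w y * (of_real l ^ k * f y))"
    by (intro sum.cong refl arg_cong2[of _ _ _ _ "(*)"] Suc.IH Z') (auto simp: Z'_def)
  also have "\<dots> = of_real l ^ k * (\<Sum>y | a w y \<noteq> 0. a w y * f y)" by (simp add: sum_distrib_left mult_ac)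
  finally show ?case by (simp add: eig)
qed

text \<open>
  An eigenvector \<open>f\<close> with \<open>\<parallel>f\<parallel>\<^sup>2 \<le> S\<close> satisfies \<open>Q(l) f(w) = \<langle>f, Q(a) e\<^sub>w\<rangle>\<close>, a finite sum, to which the Cauchy-Schwarz
  inequality applies. So the spectral measure at \<open>w\<close> has an atom of mass at least \<open>\<bar>f w\<bar>\<^sup>2 / S\<close> at \<open>l\<close>.
\<close>

lemma spectral_atom:
  assumes rf: "row_finite a" and herm: "hermitian_kernel a"
    and eig: "\<And>z. (\<Sum>y | a z y \<noteq> 0. a z y * f y) = of_real l * f z"
    and bounded: "\<And>Z. finite Z \<Longrightarrow> (\<Sum>z\<in>Z. (norm (f z))\<^sup>2) \<le> S"
  shows "(norm (f w))\<^sup>2 * (poly Q l)\<^sup>2 \<le> S * spectral a w (Q * Q)"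
proof -
  obtain Z where Z: "finite Z" "\<And>k z. k \<le> degree Q \<Longrightarrow> kpow a k w z \<noteq> 0 \<Longrightarrow> z \<in> Z"
    using poly_vector_support[OF rf] by metis
  define v where "v z = moment_functional (\<lambda>k. kpow a k z w) Q" for z
  have "of_real (poly Q l) * f w = moment_functional (\<lambda>k. of_real l ^ k * f w) Q"
    by (simp add: moment_functional_cmult moment_functional_power)
  also have "\<dots> = moment_functional (\<lambda>k. \<Sum>z\<in>Z. kpow a k w z * f z) Q"
    unfolding moment_functional_def using Z
    by (intro sum.cong refl arg_cong2[of _ _ _ _ "(*)"] kpow_eigenvector[symmetric] rf eig) auto
  also have "\<dots> = (\<Sum>z\<in>Z. cnj (v z) * f z)"
    by (simp add: moment_functional_sum moment_functional_cmult v_def kpow_cnj[OF rf herm, of _ w] moment_functional_cnj)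
  finally have "norm (f w) * \<bar>poly Q l\<bar> = norm (\<Sum>z\<in>Z. cnj (v z) * f z)"
    by (metis mult.commute norm_mult norm_of_real)
  also have "\<dots> \<le> (\<Sum>z\<in>Z. norm (v z) * norm (f z))"
    by (rule order_trans[OF norm_sum]) (simp add: norm_mult)
  finally have "(norm (f w) * \<bar>poly Q l\<bar>)\<^sup>2 \<le> (\<Sum>z\<in>Z. norm (v z) * norm (f z))\<^sup>2"
    by (intro power_mono) auto
  also have "\<dots> \<le> (\<Sum>z\<in>Z. (norm (v z))\<^sup>2) * (\<Sum>z\<in>Z. (norm (f z))\<^sup>2)" by (rule Cauchy_Schwarz_ineq_sum)
  also have "\<dots> \<le> (\<Sum>z\<in>Z. (norm (v z))\<^sup>2) * S" by (intro mult_left_mono bounded Z sum_nonneg) auto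
  also have "(\<Sum>z\<in>Z. (norm (v z))\<^sup>2) = spectral a w (Q * Q)"
    unfolding v_def by (rule spectral_square[OF rf herm Z, symmetric])
  finally show ?thesis by (simp add: power_mult_distrib mult.commute)
qed

section \<open>Integral hermitian matrices\<close>

text \<open>
  Polynomials with this property stand in for \<open>ln \<bar>x\<bar>\<close>. The condition at \<open>0\<close> expresses that the
  determinant disregards the kernel.
\<close>

definition log_majorant :: "real \<Rightarrow> real poly \<Rightarrow> bool" where
  "log_majorant \<kappa> P \<longleftrightarrow> 0 \<le> poly P 0 \<and> (\<forall>x. x \<noteq> 0 \<and> \<bar>x\<bar> \<le> \<kappa> \<longrightarrow> ln \<bar>x\<bar> \<le> poly P x)"

text \<open>
  Up to sign, the product of the nonzero roots is the lowest nonzero coefficient, which is an integer.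
\<close>

lemma prod_nonzero_roots_int_poly:
  fixes p :: "int poly" and es :: "complex list"
  assumes p: "map_poly of_int p = (\<Prod>e\<leftarrow>es. [:- e, 1:])"
  shows "1 \<le> (\<Prod>e\<leftarrow>filter (\<lambda>e. e \<noteq> 0) es. norm e)"
proof -
  let ?es' = "filter (\<lambda>e. e \<noteq> 0) es"
  define q where "q = (\<Prod>e\<leftarrow>?es'. [:- e, 1:])"
  have "\<exists>m. (\<Prod>e\<leftarrow>es. [:- e, 1:]) = monom 1 m * q" unfolding q_def
  proof (induction es)
    case (Cons e es)
    then obtain m where m: "(\<Prod>e\<leftarrow>es. [:- e, 1:]) = monom 1 m * (\<Prod>e\<leftarrow>filter (\<lambda>e. e \<noteq> 0) es. [:- e, 1:])" by blast
    show ?case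
    proof (cases "e = 0")
      case True
      then show ?thesis by (intro exI[of _ "Suc m"]) (simp add: m monom_Suc)
    next
      case False
      have "(\<Prod>e\<leftarrow>e # es. [:- e, 1:]) = monom 1 m * ([:- e, 1:] * (\<Prod>e\<leftarrow>filter (\<lambda>e. e \<noteq> 0) es. [:- e, 1:]))"
        by (simp only: list.map prod_list.Cons m mult.left_commute)
      then show ?thesis using False by (intro exI[of _ m]) simp
    qed
  next
    case Nil
    show ?case by (rule exI[of _ 0]) (simp add: monom_0)
  qed
  then obtain m where m: "(\<Prod>e\<leftarrow>es. [:- e, 1:]) = monom 1 m * q" by blast
  have "norm (poly q 0) = (\<Prod>e\<leftarrow>?es'. norm e)"
    unfolding q_def by (induction es) (auto simp: norm_mult)
  moreover have "poly q 0 = coeff (monom 1 m * q) m" by (simp add: coeff_monom_mult poly_0_coeff_0)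
  then have "poly q 0 = of_int (coeff p m)" by (simp add: p[symmetric] m[symmetric])
  moreover have "poly q 0 \<noteq> 0" unfolding q_def by (induction es) auto
  ultimately show ?thesis by (simp flip: of_int_abs)
qed

lemma vec_nonzero_entry:
  assumes "v \<in> carrier_vec n" "v \<noteq> 0\<^sub>v n"
  shows "\<exists>i<n. vec_index v i \<noteq> 0"
proof (rule ccontr)
  assume "\<not> ?thesis"
  then have "v = 0\<^sub>v n" using assms(1) by (intro eq_vecI) auto
  then show False using assms(2) by simp
qed

lemma eigenvalue_le_row_sum:
  fixes R :: "complex mat"
  assumes R: "R \<in> carrier_mat n n" and ev: "eigenvalue R e"
    and row: "\<And>i. i < n \<Longrightarrow> (\<Sum>j<n. norm (R $$ (i, j))) \<le> \<kappa>"
  shows "norm e \<le> \<kappa>"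
proof -
  obtain v where v: "v \<in> carrier_vec n" "v \<noteq> 0\<^sub>v n" "R *\<^sub>v v = e \<cdot>\<^sub>v v"
    using ev R unfolding eigenvalue_def eigenvector_def by auto
  from vec_nonzero_entry[OF v(1,2)] obtain i0 where i0: "i0 < n" "vec_index v i0 \<noteq> 0" by blast
  obtain i where i: "i < n" "\<And>j. j < n \<Longrightarrow> norm (vec_index v j) \<le> norm (vec_index v i)"
  proof -
    let ?S = "(\<lambda>j. norm (vec_index v j)) ` {..<n}"
    have "Max ?S \<in> ?S" using i0 by (intro Max_in) auto
    then show thesis using that by (auto simp: image_iff) (metis Max_ge finite_imageI finite_lessThan imageI lessThan_iff)
  qed
  have vi: "norm (vec_index v i) > 0" using i(2)[OF i0(1)] i0(2) by (meson zero_less_norm_iff order_less_le_trans)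
  have "e * vec_index v i = (\<Sum>j<n. R $$ (i, j) * vec_index v j)"
    using arg_cong[OF v(3), of "\<lambda>w. vec_index w i"] R v(1) i(1)
    by (simp add: scalar_prod_def atLeast0LessThan)
  then have "norm e * norm (vec_index v i) = norm (\<Sum>j<n. R $$ (i, j) * vec_index v j)" by (metis norm_mult)
  also have "\<dots> \<le> (\<Sum>j<n. norm (R $$ (i, j)) * norm (vec_index v j))"
    by (rule order_trans[OF norm_sum]) (simp add: norm_mult)
  also have "\<dots> \<le> (\<Sum>j<n. norm (R $$ (i, j)) * norm (vec_index v i))"
    by (intro sum_mono mult_left_mono i(2)) auto
  also have "\<dots> = (\<Sum>j<n. norm (R $$ (i, j))) * norm (vec_index v i)" by (simp add: sum_distrib_right)
  also have "\<dots> \<le> \<kappa> * norm (vec_index v i)" by (intro mult_right_mono row i) auto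
  finally show ?thesis using vi by simp
qed

lemma upper_triangular_pow:
  fixes B :: "complex mat"
  assumes B: "B \<in> carrier_mat n n" "upper_triangular B"
  shows "upper_triangular (B ^\<^sub>m k) \<and> (\<forall>i<n. (B ^\<^sub>m k) $$ (i, i) = (B $$ (i, i)) ^ k)"
proof (induction k)
  case 0
  then show ?case using B by simp
next
  case (Suc k)
  have C: "B ^\<^sub>m k \<in> carrier_mat n n" using B by simp
  have prod: "(B ^\<^sub>m Suc k) $$ (i, j) = (\<Sum>l<n. (B ^\<^sub>m k) $$ (i, l) * B $$ (l, j))" if "i < n" "j < n" for i j
    using B C that by (simp add: scalar_prod_def atLeast0LessThan)
  have "(B ^\<^sub>m k) $$ (i, l) * B $$ (l, j) = 0" if "i < n" "l < n" "j < n" "j < i \<or> (j = i \<and> l \<noteq> i)" for i j l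
    using Suc B C that upper_triangularD[of "B ^\<^sub>m k" l i] upper_triangularD[of B j l]
    by (cases l i rule: linorder_cases) auto
  note z = this
  show ?case
  proof (intro conjI allI impI upper_triangularI)
    fix i j assume "j < i" "i < dim_row (B ^\<^sub>m Suc k)"
    then have ij: "i < n" "j < n" "j < i" using B by auto
    show "(B ^\<^sub>m Suc k) $$ (i, j) = 0" unfolding prod[OF ij(1,2)] using z ij by (intro sum.neutral) auto
  next
    fix i assume i: "i < n"
    have "(B ^\<^sub>m Suc k) $$ (i, i) = (\<Sum>l\<in>{i}. (B ^\<^sub>m k) $$ (i, l) * B $$ (l, i))"
      unfolding prod[OF i i] using z i by (intro sum.mono_neutral_right) auto
    then show "(B ^\<^sub>m Suc k) $$ (i, i) = (B $$ (i, i)) ^ Suc k" using Suc i by simp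
  qed
qed

lemma trace_mult_commute:
  fixes X Y :: "complex mat"
  assumes "X \<in> carrier_mat n n" "Y \<in> carrier_mat n n"
  shows "(\<Sum>i<n. (X * Y) $$ (i, i)) = (\<Sum>i<n. (Y * X) $$ (i, i))"
proof -
  have "(\<Sum>i<n. (X * Y) $$ (i, i)) = (\<Sum>i<n. \<Sum>l<n. X $$ (i, l) * Y $$ (l, i))"
    using assms by (simp add: scalar_prod_def atLeast0LessThan)
  also have "\<dots> = (\<Sum>l<n. \<Sum>i<n. X $$ (i, l) * Y $$ (l, i))" by (rule sum.swap)
  also have "\<dots> = (\<Sum>i<n. (Y * X) $$ (i, i))"
    using assms by (simp add: scalar_prod_def atLeast0LessThan mult.commute)
  finally show ?thesis .
qed

text \<open>
  Triangularization: the trace is invariant under similarity, and the diagonal of a power of a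
  triangular matrix consists of the powers of its diagonal entries.
\<close>

lemma trace_pow_eq_sum_roots:
  fixes A :: "complex mat"
  assumes A: "A \<in> carrier_mat n n" and cp: "char_poly A = (\<Prod>e\<leftarrow>es. [:- e, 1:])"
  shows "(\<Sum>i<n. (A ^\<^sub>m k) $$ (i, i)) = (\<Sum>e\<leftarrow>es. e ^ k)"
proof -
  obtain B P Q where BPQ: "schur_decomposition A es = (B, P, Q)" by (cases "schur_decomposition A es")
  from schur_decomposition[OF A cp BPQ]
  have sim: "similar_mat_wit A B P Q" and ut: "upper_triangular B" and diag: "diag_mat B = es" by auto
  from similar_mat_witD2[OF A sim] have carr: "B \<in> carrier_mat n n" "P \<in> carrier_mat n n" "Q \<in> carrier_mat n n" "Q * P = 1\<^sub>m n"
    by auto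
  have Bk: "B ^\<^sub>m k \<in> carrier_mat n n" using carr by simp
  have "(\<Sum>i<n. (A ^\<^sub>m k) $$ (i, i)) = (\<Sum>i<n. (P * B ^\<^sub>m k * Q) $$ (i, i))"
    by (simp only: similar_mat_wit_pow_id[OF sim])
  also have "\<dots> = (\<Sum>i<n. (Q * (P * B ^\<^sub>m k)) $$ (i, i))"
    using carr Bk by (intro trace_mult_commute) auto
  also have "Q * (P * B ^\<^sub>m k) = B ^\<^sub>m k"
    using assoc_mult_mat[of Q n n P n "B ^\<^sub>m k" n] carr Bk by simp
  also have "(\<Sum>i<n. (B ^\<^sub>m k) $$ (i, i)) = (\<Sum>i<n. (B $$ (i, i)) ^ k)"
    using upper_triangular_pow[OF carr(1) ut, of k] by simp
  also have "\<dots> = (\<Sum>e\<leftarrow>es. e ^ k)"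
    using carr(1) unfolding diag[symmetric] diag_mat_def by (simp add: interv_sum_list_conv_sum_set_nat atLeast0LessThan o_def)
  finally show ?thesis .
qed

lemma hermitian_mat_eigenvalue_real:
  fixes A :: "complex mat"
  assumes A: "A \<in> carrier_mat n n" and herm: "\<And>i j. i < n \<Longrightarrow> j < n \<Longrightarrow> A $$ (j, i) = cnj (A $$ (i, j))"
    and ev: "eigenvalue A e"
  shows "e = of_real (Re e)"
proof -
  obtain v where v: "v \<in> carrier_vec n" "v \<noteq> 0\<^sub>v n" "A *\<^sub>v v = e \<cdot>\<^sub>v v"
    using ev A unfolding eigenvalue_def eigenvector_def by auto
  let ?v = "vec_index v"
  have row: "(\<Sum>j<n. A $$ (i, j) * ?v j) = e * ?v i" if "i < n" for i
    using arg_cong[OF v(3), of "\<lambda>w. vec_index w i"] A v(1) that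
    by (simp add: scalar_prod_def atLeast0LessThan)
  define q where "q = (\<Sum>i<n. \<Sum>j<n. cnj (?v i) * A $$ (i, j) * ?v j)"
  define N where "N = (\<Sum>i<n. (norm (?v i))\<^sup>2)"
  have "q = (\<Sum>i<n. cnj (?v i) * (e * ?v i))"
    unfolding q_def by (intro sum.cong refl) (simp add: row[symmetric] sum_distrib_left mult.assoc)
  also have "\<dots> = (\<Sum>i<n. e * of_real ((norm (?v i))\<^sup>2))"
    by (intro sum.cong refl) (subst complex_norm_square, simp add: mult_ac)
  also have "\<dots> = e * of_real N" by (simp add: N_def sum_distrib_left)
  finally have qe: "q = e * of_real N" .
  have "cnj q = (\<Sum>i<n. \<Sum>j<n. cnj (?v j) * A $$ (j, i) * ?v i)"
    unfolding q_def cnj_sum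
  proof (intro sum.cong refl)
    fix i j assume "i \<in> {..<n}" "j \<in> {..<n}"
    then have "A $$ (j, i) = cnj (A $$ (i, j))" by (intro herm) auto
    then show "cnj (cnj (?v i) * A $$ (i, j) * ?v j) = cnj (?v j) * A $$ (j, i) * ?v i"
      by (simp only: complex_cnj_mult complex_cnj_cnj mult_ac)
  qed
  also have "\<dots> = q" unfolding q_def by (rule sum.swap)
  finally have "cnj q = q" .
  then have "cnj (e * of_real N) = e * of_real N" by (simp only: qe)
  then have eN: "cnj e * of_real N = e * of_real N" by (simp only: complex_cnj_mult complex_cnj_complex_of_real)
  have "of_real N \<noteq> (0 :: complex)"
  proof
    assume "of_real N = (0 :: complex)"
    then have "N = 0" by simp
    then have "\<forall>i<n. ?v i = 0" unfolding N_def by (subst (asm) sum_nonneg_eq_0_iff) auto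
    then show False using vec_nonzero_entry[OF v(1,2)] by blast
  qed
  with eN have "cnj e = e" by (metis mult_right_cancel)
  then have "Im (cnj e) = Im e" by (rule arg_cong)
  then have "Im e = 0" unfolding cnj.sel by linarith
  then show ?thesis by (intro complex_eqI) simp_all
qed

lemma sum_lessThan_mult:
  fixes f :: "nat \<Rightarrow> 'a :: comm_monoid_add"
  shows "(\<Sum>p<D * n. f p) = (\<Sum>t<D. \<Sum>j<n. f (t * n + j))"
proof -
  have "(\<Sum>p<D * n. f p) = (\<Sum>t<D. sum f {t * n..<t * n + n})" by (rule sum.nat_group[symmetric])
  also have "\<dots> = (\<Sum>t<D. \<Sum>j<n. f (t * n + j))"
  proof (rule sum.cong[OF refl])
    fix t
    have "sum f {t * n..<t * n + n} = sum f {0 + t * n..<n + t * n}" by (simp add: add.commute)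
    also have "\<dots> = (\<Sum>j<n. f (t * n + j))" by (simp only: sum.shift_bounds_nat_ivl atLeast0LessThan add.commute)
    finally show "sum f {t * n..<t * n + n} = (\<Sum>j<n. f (t * n + j))" .
  qed
  finally show ?thesis .
qed

text \<open>
  Rows and columns of \<open>R\<close> are indexed by \<open>s * n + i\<close> with \<open>s < D\<close> and \<open>i < n\<close>. The hypothesis says that the map
  \<open>v \<mapsto> \<omega> \<otimes> v\<close> intertwines \<open>A\<close> and \<open>R\<close>, so that \<open>R\<close> has an invariant subspace on which it acts as \<open>A\<close>. As
  \<open>\<omega> 0 = 1\<close>, the vectors \<open>\<omega> \<otimes> e\<^sub>q\<close> together with the basis vectors of index at least \<open>n\<close> form a basis, and
  in this basis \<open>R\<close> is block triangular.
\<close>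

lemma char_poly_compression_factor:
  fixes A R :: "complex mat" and \<omega> :: "nat \<Rightarrow> complex"
  assumes A: "A \<in> carrier_mat n n" and R: "R \<in> carrier_mat (D * n) (D * n)" and n: "0 < n" and D: "0 < D" and \<omega>0: "\<omega> 0 = 1"
    and inter: "\<And>i j s. i < n \<Longrightarrow> j < n \<Longrightarrow> s < D \<Longrightarrow> (\<Sum>t<D. R $$ (s * n + i, t * n + j) * \<omega> t) = \<omega> s * A $$ (i, j)"
  obtains C where "C \<in> carrier_mat (D * n - n) (D * n - n)" "char_poly R = char_poly A * char_poly C"
proof -
  define N where "N = D * n"
  have nN: "n \<le> N" using D by (simp add: N_def)
  \<comment> \<open>\<open>S 1\<close> is the matrix of the change of basis; it is unipotent, and \<open>S (-1)\<close> is its inverse.\<close>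
  define S where "S \<epsilon> = mat N N (\<lambda>(p, q). if p = q then 1 else if q < n \<and> p mod n = q then \<epsilon> * \<omega> (p div n) else 0)" for \<epsilon> :: complex
  have S: "S \<epsilon> \<in> carrier_mat N N" for \<epsilon> by (simp add: S_def)
  have R': "R \<in> carrier_mat N N" using R by (simp add: N_def)
  have S_low: "(\<Sum>p<N. f p * S 1 $$ (p, q)) = (\<Sum>t<D. f (t * n + q) * \<omega> t)" if q: "q < n" for f q
  proof -
    have "(\<Sum>p<N. f p * S 1 $$ (p, q)) = (\<Sum>t<D. \<Sum>j<n. f (t * n + j) * S 1 $$ (t * n + j, q))"
      unfolding N_def by (rule sum_lessThan_mult)
    also have "\<dots> = (\<Sum>t<D. \<Sum>j<n. if j = q then f (t * n + j) * \<omega> t else 0)"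
    proof (intro sum.cong refl)
      fix t j assume tj: "t \<in> {..<D}" "j \<in> {..<n}"
      have lt: "t * n + j < N" "q < N"
      proof -
        have "t * n + j < Suc t * n" using tj by simp
        also have "\<dots> \<le> N" unfolding N_def using tj by (intro mult_le_mono1) auto
        finally show "t * n + j < N" .
        show "q < N" using q nN by simp
      qed
      have "t = 0" if "t * n + j = q" using that q tj by (cases t) auto
      then show "f (t * n + j) * S 1 $$ (t * n + j, q) = (if j = q then f (t * n + j) * \<omega> t else 0)"
        using lt tj q \<omega>0 by (auto simp: S_def)
    qed
    also have "\<dots> = (\<Sum>t<D. f (t * n + q) * \<omega> t)" using q by simp
    finally show ?thesis .
  qed
  have S_row: "(\<Sum>q<N. S \<epsilon> $$ (p, q) * f q) = f p + (if p < n then 0 else \<epsilon> * \<omega> (p div n) * f (p mod n))"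
    if p: "p < N" for p f \<epsilon>
  proof -
    have pm1: "p mod n < n" using n by simp
    have pm2: "p \<noteq> p mod n" if "\<not> p < n" using that pm1 by linarith
    note pm = pm1 pm2
    have "(\<Sum>q<N. S \<epsilon> $$ (p, q) * f q) = (\<Sum>q<N. (if q = p then f q else 0) + (if q = p mod n then (if p < n then 0 else \<epsilon> * \<omega> (p div n) * f q) else 0))"
    proof (intro sum.cong refl)
      fix q assume "q \<in> {..<N}"
      then show "S \<epsilon> $$ (p, q) * f q = (if q = p then f q else 0) + (if q = p mod n then (if p < n then 0 else \<epsilon> * \<omega> (p div n) * f q) else 0)"
        using p pm(1) pm(2) by (cases "p < n") (auto simp: S_def)
    qed
    also have "\<dots> = f p + (if p < n then 0 else \<epsilon> * \<omega> (p div n) * f (p mod n))"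
      using p pm(1) nN by (simp add: sum.distrib)
    finally show ?thesis .
  qed
  have prod: "(X * Y) $$ (p, q) = (\<Sum>k<N. X $$ (p, k) * Y $$ (k, q))"
    if "X \<in> carrier_mat N N" "Y \<in> carrier_mat N N" "p < N" "q < N" for X Y :: "complex mat" and p q
    using that by (simp add: scalar_prod_def atLeast0LessThan)
  have SS: "S \<epsilon> * S (-\<epsilon>) = 1\<^sub>m N" for \<epsilon>
  proof (rule eq_matI)
    fix p q assume "p < dim_row (1\<^sub>m N)" "q < dim_col (1\<^sub>m N)"
    then have pq: "p < N" "q < N" by auto
    have pm1: "p mod n < n" using n by simp
    have pm2: "p \<noteq> p mod n" if "\<not> p < n" using that pm1 by linarith
    note pm = pm1 pm2
    show "(S \<epsilon> * S (-\<epsilon>)) $$ (p, q) = 1\<^sub>m N $$ (p, q)"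
      unfolding prod[OF S S pq] S_row[OF pq(1)]
      using pq pm nN by (cases "p < n") (auto simp: S_def)
  qed (use S in auto)
  define B where "B = S (-1) * R * S 1"
  have B: "B \<in> carrier_mat N N" unfolding B_def by (rule mult_carrier_mat[OF mult_carrier_mat[OF S R'] S])
  have RS_carrier: "R * S 1 \<in> carrier_mat N N" by (rule mult_carrier_mat[OF R' S])
  have B_eq: "B = S (-1) * (R * S 1)" unfolding B_def by (rule assoc_mult_mat[OF S R' S])
  have sim: "similar_mat R B"
  proof -
    have 1: "S 1 * S (-1) = 1\<^sub>m N" "S (-1) * S 1 = 1\<^sub>m N" using SS[of 1] SS[of "-1"] by auto
    have "S 1 * B = S 1 * S (-1) * (R * S 1)" unfolding B_eq by (rule assoc_mult_mat[OF S S RS_carrier, symmetric])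
    also have "\<dots> = R * S 1" by (simp only: 1 left_mult_one_mat[OF RS_carrier])
    finally have "S 1 * B * S (-1) = R * (S 1 * S (-1))" using assoc_mult_mat[OF R' S S] by simp
    also have "\<dots> = R" using 1 R' by simp
    finally have "R = S 1 * B * S (-1)" by (rule sym)
    with 1 have "similar_mat_wit R B (S 1) (S (-1))" using B R' S by (intro similar_mat_witI[of _ _ N])
    then show ?thesis unfolding similar_mat_def by blast
  qed
  have B_col: "B $$ (p, q) = (if p < n then A $$ (p, q) else 0)" if p: "p < N" and q: "q < n" for p q
  proof -
    have qN: "q < N" using q nN by simp
    have RS: "(R * S 1) $$ (p, q) = \<omega> (p div n) * A $$ (p mod n, q)" if "p < N" for p
    proof -
      have "(R * S 1) $$ (p, q) = (\<Sum>t<D. R $$ (p, t * n + q) * \<omega> t)"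
        unfolding prod[OF R' S that qN] by (rule S_low[OF q])
      also have "p = p div n * n + p mod n" by simp
      also have "(\<Sum>t<D. R $$ (p div n * n + p mod n, t * n + q) * \<omega> t) = \<omega> (p div n) * A $$ (p mod n, q)"
        using that n q by (intro inter) (auto simp: N_def less_mult_imp_div_less)
      finally show ?thesis by simp
    qed
    have "B $$ (p, q) = (S (-1) * (R * S 1)) $$ (p, q)" by (simp only: B_eq)
    also have "\<dots> = (\<Sum>k<N. S (-1) $$ (p, k) * (R * S 1) $$ (k, q))"
      by (rule prod[OF S RS_carrier p qN])
    also have "\<dots> = (R * S 1) $$ (p, q) + (if p < n then 0 else - 1 * \<omega> (p div n) * (R * S 1) $$ (p mod n, q))"
      by (rule S_row[OF p])
    also have "\<dots> = (if p < n then A $$ (p, q) else 0)"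
    proof -
      have "p mod n < n" using n by simp
      then have pm: "p mod n < N" "p mod n div n = 0" using nN by auto
      show ?thesis using p pm \<omega>0 by (simp add: RS)
    qed
    finally show ?thesis .
  qed
  define C where "C = mat (N - n) (N - n) (\<lambda>(p, q). B $$ (p + n, q + n))"
  define B12 where "B12 = mat n (N - n) (\<lambda>(p, q). B $$ (p, q + n))"
  have block: "B = four_block_mat A B12 (0\<^sub>m (N - n) n) C"
    by (rule eq_matI) (use A B nN B_col in \<open>auto simp: B12_def C_def\<close>)
  have lin: "\<exists>es. char_poly X = (\<Prod>e\<leftarrow>es. [:- e, 1:])" if "X \<in> carrier_mat m m" for X :: "complex mat" and m
    using char_poly_factorized[OF that] by blast
  have C: "C \<in> carrier_mat (N - n) (N - n)" "B12 \<in> carrier_mat n (N - n)" by (simp_all add: C_def B12_def)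
  have "char_poly R = char_poly B" by (rule char_poly_similar[OF sim])
  also have "\<dots> = char_poly A * char_poly C"
    by (rule char_poly_0_block[OF block lin[OF A] lin[OF C(1)] A C(2,1)])
  finally show thesis using that C(1) by (simp add: N_def)
qed

lemma poly_linear_factors_eq_0: "poly (\<Prod>e\<leftarrow>es. [:- e, 1:]) x = 0 \<longleftrightarrow> x \<in> set es" for x :: complex
  by (induction es) auto

lemma ln_prod_list_norm:
  fixes es :: "complex list"
  assumes "0 \<notin> set es"
  shows "ln (\<Prod>e\<leftarrow>es. norm e) = (\<Sum>e\<leftarrow>es. ln (norm e))"
  using assms
proof (induction es)
  case (Cons e es)
  have pos: "0 \<notin> set xs \<Longrightarrow> 0 < (\<Prod>e\<leftarrow>xs. norm e)" for xs :: "complex list"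
    by (induction xs) auto
  show ?case using Cons pos[of es] by (simp add: ln_mult_pos)
qed simp

text \<open>
  The entries of \<open>A\<close> are algebraic numbers, realized by integer matrices through the common vector \<open>\<omega>\<close>. By the
  previous lemma the eigenvalues of \<open>A\<close> are among those of an integer matrix of size \<open>D * n\<close>. Its nonzero
  eigenvalues multiply to at least \<open>1\<close> in absolute value, and each of them is at most \<open>\<kappa>\<close>. So those
  that belong to \<open>A\<close> multiply to at least \<open>\<kappa> ^ (- D * n)\<close>.
\<close>

lemma hermitian_mat_log_bound:
  fixes A :: "complex mat" and m :: "nat \<Rightarrow> nat \<Rightarrow> nat \<Rightarrow> nat \<Rightarrow> int" and \<omega> :: "nat \<Rightarrow> complex"
  assumes A: "A \<in> carrier_mat n n" and herm: "\<And>i j. i < n \<Longrightarrow> j < n \<Longrightarrow> A $$ (j, i) = cnj (A $$ (i, j))"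
    and D: "0 < D" and \<omega>0: "\<omega> 0 = 1" and \<kappa>: "1 \<le> \<kappa>"
    and inter: "\<And>i j s. i < n \<Longrightarrow> j < n \<Longrightarrow> s < D \<Longrightarrow> (\<Sum>t<D. of_int (m i j s t) * \<omega> t) = A $$ (i, j) * \<omega> s"
    and row: "\<And>i s. i < n \<Longrightarrow> s < D \<Longrightarrow> (\<Sum>j<n. \<Sum>t<D. real_of_int \<bar>m i j s t\<bar>) \<le> \<kappa>"
    and maj: "log_majorant \<kappa> P"
  shows "- (real n * D * ln \<kappa>) \<le> (\<Sum>i<n. Re (moment_functional (\<lambda>k. (A ^\<^sub>m k) $$ (i, i)) P))"
proof (cases "n = 0")
  case False
  then have n: "0 < n" by simp
  define RZ where "RZ = mat (D * n) (D * n) (\<lambda>(p, q). m (p mod n) (q mod n) (p div n) (q div n))"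
  define R :: "complex mat" where "R = map_mat of_int RZ"
  have RZ: "RZ \<in> carrier_mat (D * n) (D * n)" by (simp add: RZ_def)
  have R: "R \<in> carrier_mat (D * n) (D * n)" by (simp add: R_def RZ_def)
  have lt: "s * n + i < D * n" if "s < D" "i < n" for s i
  proof -
    have "s * n + i < Suc s * n" using that by simp
    also have "\<dots> \<le> D * n" using that by (intro mult_le_mono1) auto
    finally show ?thesis .
  qed
  have R_entry: "R $$ (s * n + i, t * n + j) = of_int (m i j s t)" if "s < D" "i < n" "t < D" "j < n" for s i t j
    using that lt by (simp add: R_def RZ_def)
  obtain C where C: "C \<in> carrier_mat (D * n - n) (D * n - n)" and cpR: "char_poly R = char_poly A * char_poly C"
  proof (rule char_poly_compression_factor[where \<omega> = \<omega>, OF A R n D \<omega>0])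
    fix i j s assume "i < n" "j < n" "s < D"
    then have "(\<Sum>t<D. R $$ (s * n + i, t * n + j) * \<omega> t) = (\<Sum>t<D. of_int (m i j s t) * \<omega> t)"
      by (intro sum.cong refl arg_cong2[of _ _ _ _ "(*)"] R_entry) auto
    then show "(\<Sum>t<D. R $$ (s * n + i, t * n + j) * \<omega> t) = \<omega> s * A $$ (i, j)"
      using inter[OF \<open>i < n\<close> \<open>j < n\<close> \<open>s < D\<close>] by (simp only: mult.commute)
  qed
  obtain es where es: "char_poly A = (\<Prod>e\<leftarrow>es. [:- e, 1:])" using char_poly_factorized[OF A] by blast
  obtain cs where cs: "char_poly C = (\<Prod>e\<leftarrow>cs. [:- e, 1:])" "length cs = D * n - n" using char_poly_factorized[OF C] by blast
  have cpR': "char_poly R = (\<Prod>e\<leftarrow>es @ cs. [:- e, 1:])" by (simp add: cpR es cs)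
  have root: "norm e \<le> \<kappa>" if "e \<in> set (es @ cs)" for e
  proof (rule eigenvalue_le_row_sum[OF R])
    have "poly (char_poly R) e = 0" unfolding cpR' using that by (subst poly_linear_factors_eq_0) auto
    then show "eigenvalue R e" using eigenvalue_root_char_poly[OF R] by simp
    fix p assume p: "p < D * n"
    define i s where "i = p mod n" and "s = p div n"
    have isp: "p = s * n + i" "i < n" "s < D" using p n by (auto simp: i_def s_def less_mult_imp_div_less)
    have "(\<Sum>q<D * n. norm (R $$ (p, q))) = (\<Sum>t<D. \<Sum>j<n. real_of_int \<bar>m i j s t\<bar>)"
      unfolding sum_lessThan_mult isp(1) using isp by (intro sum.cong refl) (simp add: R_entry)
    also have "\<dots> \<le> \<kappa>" using row[OF isp(2,3)] by (subst sum.swap)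
    finally show "(\<Sum>q<D * n. norm (R $$ (p, q))) \<le> \<kappa>" .
  qed
  have real: "e = of_real (Re e)" if "e \<in> set es" for e
  proof (rule hermitian_mat_eigenvalue_real[OF A herm])
    have "poly (char_poly A) e = 0" unfolding es using that by (subst poly_linear_factors_eq_0) auto
    then show "eigenvalue A e" using eigenvalue_root_char_poly[OF A] by simp
  qed
  have "map_poly of_int (char_poly RZ) = (\<Prod>e\<leftarrow>es @ cs. [:- e, 1:])"
    unfolding cpR'[symmetric] R_def by (rule of_int_hom.char_poly_hom[OF RZ, symmetric])
  then have "1 \<le> (\<Prod>e\<leftarrow>filter (\<lambda>e. e \<noteq> 0) (es @ cs). norm e)" by (rule prod_nonzero_roots_int_poly)
  then have "0 \<le> ln (\<Prod>e\<leftarrow>filter (\<lambda>e. e \<noteq> 0) (es @ cs). norm e)" by simp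
  also have "\<dots> = (\<Sum>e\<leftarrow>filter (\<lambda>e. e \<noteq> 0) (es @ cs). ln (norm e))"
    by (rule ln_prod_list_norm) simp
  finally have all: "0 \<le> (\<Sum>e\<leftarrow>filter (\<lambda>e. e \<noteq> 0) es. ln (norm e)) + (\<Sum>e\<leftarrow>filter (\<lambda>e. e \<noteq> 0) cs. ln (norm e))" by simp
  have "(\<Sum>e\<leftarrow>filter (\<lambda>e. e \<noteq> 0) cs. ln (norm e)) \<le> (\<Sum>e\<leftarrow>filter (\<lambda>e. e \<noteq> 0) cs. ln \<kappa>)"
    using root by (intro sum_list_mono ln_mono) auto
  also have "\<dots> = length (filter (\<lambda>e. e \<noteq> 0) cs) * ln \<kappa>" by (simp add: sum_list_triv)
  also have "\<dots> \<le> real n * D * ln \<kappa>"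
  proof (rule mult_right_mono)
    have "length (filter (\<lambda>e. e \<noteq> 0) cs) \<le> D * n" using length_filter_le[of "\<lambda>e. e \<noteq> 0" cs] cs(2) by linarith
    then have "real (length (filter (\<lambda>e. e \<noteq> 0) cs)) \<le> real (D * n)" by (rule of_nat_mono)
    then show "real (length (filter (\<lambda>e. e \<noteq> 0) cs)) \<le> real n * D" by (simp add: mult.commute)
  qed (use \<kappa> in simp)
  finally have "- (real n * D * ln \<kappa>) \<le> (\<Sum>e\<leftarrow>filter (\<lambda>e. e \<noteq> 0) es. ln (norm e))" using all by linarith
  also have "\<dots> \<le> (\<Sum>e\<leftarrow>es. poly P (Re e))"
  proof -
    have "(\<Sum>e\<leftarrow>filter (\<lambda>e. e \<noteq> 0) es'. ln (norm e)) \<le> (\<Sum>e\<leftarrow>es'. poly P (Re e))" if "set es' \<subseteq> set es" for es'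
      using that
    proof (induction es')
      case (Cons e es')
      then have e: "e \<in> set es" by simp
      have ne: "norm e = \<bar>Re e\<bar>" using real[OF e] by (metis norm_of_real)
      have "ln \<bar>Re e\<bar> \<le> poly P (Re e)" if "e \<noteq> 0"
      proof -
        have "Re e \<noteq> 0" "\<bar>Re e\<bar> \<le> \<kappa>" using ne that root[of e] e by auto
        then show ?thesis using maj unfolding log_majorant_def by blast
      qed
      moreover have "0 \<le> poly P 0" using maj by (simp add: log_majorant_def)
      ultimately show ?case using Cons ne by (auto intro: add_mono)
    qed simp
    then show ?thesis by blast
  qed
  also have "\<dots> = Re (\<Sum>e\<leftarrow>es. moment_functional (\<lambda>k. e ^ k) P)"
  proof -
    have "moment_functional (\<lambda>k. e ^ k) P = of_real (poly P (Re e))" if "e \<in> set es" for e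
      using moment_functional_power[of "Re e" P] real[OF that] by simp
    then have "(\<Sum>e\<leftarrow>es. moment_functional (\<lambda>k. e ^ k) P) = (\<Sum>e\<leftarrow>es. of_real (poly P (Re e)))"
      by (simp cong: map_cong)
    also have "Re \<dots> = (\<Sum>e\<leftarrow>es. poly P (Re e))" by (induction es) auto
    finally show ?thesis by simp
  qed
  also have "(\<Sum>e\<leftarrow>es. moment_functional (\<lambda>k. e ^ k) P) = moment_functional (\<lambda>k. \<Sum>e\<leftarrow>es. e ^ k) P"
    by (induction es) (simp_all add: moment_functional_def sum.distrib distrib_left)
  also have "\<dots> = moment_functional (\<lambda>k. \<Sum>i<n. (A ^\<^sub>m k) $$ (i, i)) P"
    by (simp only: trace_pow_eq_sum_roots[OF A es])
  also have "Re \<dots> = (\<Sum>i<n. Re (moment_functional (\<lambda>k. (A ^\<^sub>m k) $$ (i, i)) P))"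
    by (simp add: moment_functional_sum)
  finally show ?thesis .
qed simp

section \<open>The determinant bound for group rings\<close>

text \<open>
  The numbers that act on the vector \<open>\<omega>\<close> through an integer matrix with entries at most \<open>c\<close> in absolute value.
  For \<open>\<omega> \<noteq> 0\<close> these are algebraic integers, in a form that keeps track of their size and of a common
  module on which they act.
\<close>

definition int_rep :: "nat \<Rightarrow> (nat \<Rightarrow> complex) \<Rightarrow> nat \<Rightarrow> complex set" where
  "int_rep D \<omega> c = {z. \<exists>m :: nat \<Rightarrow> nat \<Rightarrow> int. (\<forall>s<D. \<forall>t<D. \<bar>m s t\<bar> \<le> int c) \<and>
     (\<forall>s<D. (\<Sum>t<D. of_int (m s t) * \<omega> t) = z * \<omega> s)}"

lemma zero_in_int_rep: "0 \<in> int_rep D \<omega> c"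
  unfolding int_rep_def by (auto intro!: exI[of _ "\<lambda>_ _. 0"])

text \<open>
  Compare the two sides of \<open>m \<omega> = z \<omega>\<close> in the coordinate where \<open>\<bar>\<omega>\<bar>\<close> is maximal; \<open>\<omega> 0 = 1\<close> makes this maximum
  positive.
\<close>

lemma norm_int_rep_le:
  assumes z: "z \<in> int_rep D \<omega> c" and D: "0 < D" and \<omega>: "\<omega> 0 = 1"
  shows "norm z \<le> D * c"
proof -
  obtain m :: "nat \<Rightarrow> nat \<Rightarrow> int" where m: "\<And>s t. s < D \<Longrightarrow> t < D \<Longrightarrow> \<bar>m s t\<bar> \<le> int c"
    "\<And>s. s < D \<Longrightarrow> (\<Sum>t<D. of_int (m s t) * \<omega> t) = z * \<omega> s"
    using z unfolding int_rep_def by blast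
  let ?W = "(\<lambda>t. norm (\<omega> t)) ` {..<D}"
  have "Max ?W \<in> ?W" using D by (intro Max_in) auto
  then obtain s where s: "s < D" "Max ?W = norm (\<omega> s)" by auto
  have max: "norm (\<omega> t) \<le> norm (\<omega> s)" if "t < D" for t using that s(2) Max_ge[of ?W "norm (\<omega> t)"] by auto
  have "1 \<le> norm (\<omega> s)" using max[OF D] \<omega> by simp
  then have pos: "0 < norm (\<omega> s)" by linarith
  have "norm z * norm (\<omega> s) = norm (\<Sum>t<D. of_int (m s t) * \<omega> t)" using m(2)[OF s(1)] by (simp add: norm_mult)
  also have "\<dots> \<le> (\<Sum>t<D. real c * norm (\<omega> s))"
  proof (rule sum_norm_le)
    fix t assume t: "t \<in> {..<D}"
    have "\<bar>real_of_int (m s t)\<bar> \<le> real c" using m(1)[OF s(1), of t] t by (metis lessThan_iff of_int_abs of_int_le_iff of_int_of_nat_eq)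
    then show "norm (of_int (m s t) * \<omega> t) \<le> real c * norm (\<omega> s)"
      using t by (simp add: norm_mult) (intro mult_mono max, auto)
  qed
  also have "\<dots> = (D * c) * norm (\<omega> s)" by simp
  finally show ?thesis using pos by (simp only: mult_le_cancel_right_pos)
qed

text \<open>
  The matrix of the convolution operator on \<open>l\<^sup>2(G)\<^sup>n\<close>, indexed by pairs of a coordinate and a group element.
\<close>

definition conv_kernel :: "('g, 'b) monoid_scheme \<Rightarrow> (nat \<Rightarrow> nat \<Rightarrow> 'g \<Rightarrow> complex) \<Rightarrow> nat \<times> 'g \<Rightarrow> nat \<times> 'g \<Rightarrow> complex" where
  "conv_kernel G a = (\<lambda>(i, x) (j, y). if x \<in> carrier G \<and> y \<in> carrier G then a i j (x \<otimes>\<^bsub>G\<^esub> inv\<^bsub>G\<^esub> y) else 0)"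

definition hermitian_coeffs ::
  "('g, 'b) monoid_scheme \<Rightarrow> nat \<Rightarrow> nat \<Rightarrow> (nat \<Rightarrow> complex) \<Rightarrow> nat \<Rightarrow> nat \<Rightarrow> (nat \<Rightarrow> nat \<Rightarrow> 'g \<Rightarrow> complex) \<Rightarrow> bool" where
  "hermitian_coeffs G n D \<omega> c N a \<longleftrightarrow>
     (\<forall>i j g. a i j g \<noteq> 0 \<longrightarrow> i < n \<and> j < n \<and> g \<in> carrier G) \<and>
     (\<forall>i. finite {(j, g). a i j g \<noteq> 0} \<and> card {(j, g). a i j g \<noteq> 0} \<le> N) \<and>
     (\<forall>i j. \<forall>g\<in>carrier G. a j i (inv\<^bsub>G\<^esub> g) = cnj (a i j g)) \<and>
     (\<forall>i j g. a i j g \<in> int_rep D \<omega> c)"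

text \<open>
  The von Neumann trace of \<open>P(a)\<close>.
\<close>

definition poly_trace :: "('g, 'b) monoid_scheme \<Rightarrow> nat \<Rightarrow> (nat \<Rightarrow> nat \<Rightarrow> 'g \<Rightarrow> complex) \<Rightarrow> real poly \<Rightarrow> real" where
  "poly_trace G n a P = (\<Sum>i<n. spectral (conv_kernel G a) (i, \<one>\<^bsub>G\<^esub>) P)"

text \<open>
  The number \<open>N * D * c\<close> is an upper bound for the norm of the operator given by \<open>a\<close>, since each of the at
  most \<open>N\<close> nonzero entries of a row is at most \<open>D * c\<close>. The bound has to be uniform in \<open>P\<close>; only its
  logarithmic dependence on \<open>c\<close> matters, because \<open>c\<close> grows like \<open>q\<close> when \<open>a\<close> is replaced by \<open>q a - p\<close>.
\<close>

definition det_bound :: "('g, 'b) monoid_scheme \<Rightarrow> bool" where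
  "det_bound G \<longleftrightarrow> group G \<and>
     (\<forall>n a D \<omega> c N P. 0 < D \<longrightarrow> \<omega> 0 = 1 \<longrightarrow> 0 < c \<longrightarrow> 0 < N \<longrightarrow> hermitian_coeffs G n D \<omega> c N a \<longrightarrow>
        log_majorant (real (N * D * c)) P \<longrightarrow> - (real n * D * ln (real (N * D * c))) \<le> poly_trace G n a P)"

lemma det_boundD:
  assumes "det_bound G" "0 < D" "\<omega> 0 = 1" "0 < c" "0 < N" "hermitian_coeffs G n D \<omega> c N a" "log_majorant (real (N * D * c)) P"
  shows "- (real n * D * ln (real (N * D * c))) \<le> poly_trace G n a P"
  using assms(1)[unfolded det_bound_def, THEN conjunct2, THEN spec[of _ n], THEN spec[of _ a], THEN spec[of _ D],
      THEN spec[of _ \<omega>], THEN spec[of _ c], THEN spec[of _ N], THEN spec[of _ P]] assms(2-)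
  by simp

text \<open>
  The row at \<open>(i, x)\<close> is a translate of the coefficients, so that it has the same number of nonzero entries
  as the \<open>i\<close>-th row of \<open>a\<close>.
\<close>

lemma conv_kernel_row:
  fixes G (structure)
  assumes "group G" and x: "x \<in> carrier G" and sub: "{g. \<exists>i j. a i j g \<noteq> 0} \<subseteq> carrier G"
  shows "{w. conv_kernel G a (i, x) w \<noteq> 0} = (\<lambda>(j, g). (j, inv\<^bsub>G\<^esub> g \<otimes>\<^bsub>G\<^esub> x)) ` {(j, g). a i j g \<noteq> 0}"
    and "\<And>j g. g \<in> carrier G \<Longrightarrow> conv_kernel G a (i, x) (j, inv\<^bsub>G\<^esub> g \<otimes>\<^bsub>G\<^esub> x) = a i j g"
    and "inj_on (\<lambda>(j, g). (j, inv\<^bsub>G\<^esub> g \<otimes>\<^bsub>G\<^esub> x)) {(j, g). a i j g \<noteq> 0}"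
proof -
  interpret group G by fact
  have supp: "g \<in> carrier G" if "a i j g \<noteq> 0" for i j g using sub that by blast
  have quot: "x \<otimes> inv (inv g \<otimes> x) = g" if "g \<in> carrier G" for g
    using that x by (simp add: inv_mult_group m_assoc[symmetric])
  show val: "conv_kernel G a (i, x) (j, inv g \<otimes> x) = a i j g" if "g \<in> carrier G" for j g
    using that x by (simp add: conv_kernel_def quot)
  show "{w. conv_kernel G a (i, x) w \<noteq> 0} = (\<lambda>(j, g). (j, inv g \<otimes> x)) ` {(j, g). a i j g \<noteq> 0}"
  proof (intro equalityI subsetI)
    fix w assume "w \<in> {w. conv_kernel G a (i, x) w \<noteq> 0}"
    then obtain j y where w: "w = (j, y)" "y \<in> carrier G" "a i j (x \<otimes> inv y) \<noteq> 0"
      by (cases w) (auto simp: conv_kernel_def split: if_splits)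
    have "inv (x \<otimes> inv y) \<otimes> x = y" using w(2) x by (simp add: inv_mult_group m_assoc)
    then show "w \<in> (\<lambda>(j, g). (j, inv g \<otimes> x)) ` {(j, g). a i j g \<noteq> 0}"
      using w by (auto intro!: image_eqI[of _ _ "(j, x \<otimes> inv y)"])
  qed (use val supp in force)
  show "inj_on (\<lambda>(j, g). (j, inv g \<otimes> x)) {(j, g). a i j g \<noteq> 0}"
    using supp quot by (intro inj_onI) (auto, metis)
qed

lemma conv_kernel_outside: "x \<notin> carrier G \<Longrightarrow> conv_kernel G a (i, x) w = 0"
  by (cases w) (simp add: conv_kernel_def)

lemma hermitian_coeffsD:
  assumes "hermitian_coeffs G n D \<omega> c N a"
  shows "a i j g \<noteq> 0 \<Longrightarrow> i < n" "a i j g \<noteq> 0 \<Longrightarrow> j < n" "a i j g \<noteq> 0 \<Longrightarrow> g \<in> carrier G"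
    and "finite {(j, g). a i j g \<noteq> 0}" "card {(j, g). a i j g \<noteq> 0} \<le> N"
    and "g \<in> carrier G \<Longrightarrow> a j i (inv\<^bsub>G\<^esub> g) = cnj (a i j g)" "a i j g \<in> int_rep D \<omega> c"
  using assms unfolding hermitian_coeffs_def by blast+

lemma hermitian_coeffs_support: "hermitian_coeffs G n D \<omega> c N a \<Longrightarrow> {g. \<exists>i j. a i j g \<noteq> 0} \<subseteq> carrier G"
  unfolding hermitian_coeffs_def by blast

lemma hermitian_coeffs_finite_support:
  assumes "hermitian_coeffs G n D \<omega> c N a"
  shows "finite {g. \<exists>i j. a i j g \<noteq> 0}"
proof (rule finite_subset)
  show "{g. \<exists>i j. a i j g \<noteq> 0} \<subseteq> (\<Union>i<n. snd ` {(j, g). a i j g \<noteq> 0})"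
    using hermitian_coeffsD(1)[OF assms] by (force simp: image_iff)
  show "finite (\<Union>i<n. snd ` {(j, g). a i j g \<noteq> 0})"
    using hermitian_coeffsD(4)[OF assms] by (intro finite_UN_I finite_imageI) auto
qed

lemma conv_kernel_hermitian:
  fixes G :: "('g, 'b) monoid_scheme" (structure)
  assumes "group G" "hermitian_coeffs G n D \<omega> c N a"
  shows "hermitian_kernel (conv_kernel G a)"
  unfolding hermitian_kernel_def
proof (intro allI)
  interpret group G by fact
  fix z w :: "nat \<times> 'g"
  obtain i x j y where zw: "z = (i, x)" "w = (j, y)" by (cases z, cases w)
  have "a j i (y \<otimes> inv x) = cnj (a i j (x \<otimes> inv y))" if "x \<in> carrier G" "y \<in> carrier G"
    using hermitian_coeffsD(6)[OF assms(2), of "x \<otimes> inv y" j i] that by (simp add: inv_mult_group)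
  then show "conv_kernel G a w z = cnj (conv_kernel G a z w)" by (simp add: zw conv_kernel_def)
qed

lemma conv_kernel_row_bound:
  assumes "group G" and a: "hermitian_coeffs G n D \<omega> c N a" and D: "0 < D" "\<omega> 0 = 1"
  shows "row_bound (real (N * D * c)) (conv_kernel G a)"
proof -
  have *: "finite {y. conv_kernel G a z y \<noteq> 0} \<and> (\<Sum>y | conv_kernel G a z y \<noteq> 0. norm (conv_kernel G a z y)) \<le> real (N * D * c)" for z
  proof -
    obtain i x where z: "z = (i, x)" by (cases z)
    show ?thesis
    proof (cases "x \<in> carrier G")
      case True
      note row = conv_kernel_row[where a = a and i = i, OF assms(1) True hermitian_coeffs_support[OF a]]
      have "(\<Sum>y | conv_kernel G a z y \<noteq> 0. norm (conv_kernel G a z y)) = (\<Sum>(j, g) | a i j g \<noteq> 0. norm (a i j g))"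
        unfolding z row(1) sum.reindex[OF row(3)] using row(2) hermitian_coeffsD(3)[OF a] by (intro sum.cong) auto
      also have "\<dots> \<le> real (card {(j, g). a i j g \<noteq> 0}) * (D * c)"
        using norm_int_rep_le[OF hermitian_coeffsD(7)[OF a] D] by (intro sum_bounded_above) auto
      also have "\<dots> \<le> real N * (D * c)" by (intro mult_right_mono of_nat_mono hermitian_coeffsD(5)[OF a]) simp
      finally have "(\<Sum>y | conv_kernel G a z y \<noteq> 0. norm (conv_kernel G a z y)) \<le> real N * (D * c)" .
      moreover have "finite {y. conv_kernel G a z y \<noteq> 0}"
        unfolding z row(1) by (rule finite_imageI[OF hermitian_coeffsD(4)[OF a]])
      ultimately show ?thesis by (simp add: mult.assoc)
    qed (simp add: z conv_kernel_outside)
  qed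
  then show ?thesis by (auto simp: row_bound_def row_finite_def)
qed

lemma spectral_local_cong:
  assumes "\<And>k. k \<le> degree P \<Longrightarrow> kpow a' k z z = kpow a k w w"
  shows "spectral a' z P = spectral a w P"
  unfolding spectral_def moment_functional_def using assms by (intro arg_cong[of _ _ Re] sum.cong) auto

lemma word_balls:
  fixes G :: "('g, 'b) monoid_scheme"
  assumes G: "group G" and T: "finite T" "T \<subseteq> carrier G"
  obtains B where "\<And>m. finite (B m)" "\<And>m. B m \<subseteq> carrier G" "\<And>m. \<one>\<^bsub>G\<^esub> \<in> B m" "\<And>m. B m \<subseteq> B (Suc m)"
    "\<And>t x m. t \<in> T \<Longrightarrow> x \<in> B m \<Longrightarrow> t \<otimes>\<^bsub>G\<^esub> x \<in> B (Suc m)"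
proof -
  interpret group G by fact
  define B where "B = rec_nat {\<one>\<^bsub>G\<^esub>} (\<lambda>_ X. X \<union> (\<lambda>(t, x). t \<otimes>\<^bsub>G\<^esub> x) ` (T \<times> X))"
  have B0: "B 0 = {\<one>\<^bsub>G\<^esub>}" and BS: "B (Suc m) = B m \<union> (\<lambda>(t, x). t \<otimes>\<^bsub>G\<^esub> x) ` (T \<times> B m)" for m by (simp_all add: B_def)
  show thesis
  proof (rule that[of B])
    show "finite (B m)" for m by (induction m) (use T in \<open>auto simp: B0 BS\<close>)
    show "B m \<subseteq> carrier G" for m by (induction m) (use T in \<open>auto simp: B0 BS\<close>)
    show "\<one>\<^bsub>G\<^esub> \<in> B m" for m by (induction m) (auto simp: B0 BS)
  qed (auto simp: BS)
qed

text \<open>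
  Transport the coefficients along an embedding \<open>\<phi>\<close> of a ball in the word metric of the support of \<open>a\<close>.
  If the radius exceeds the degree of \<open>P\<close>, then all closed paths that contribute to the trace of \<open>P(a)\<close> stay in
  the ball, and the two traces agree.
\<close>

lemma det_bound_locally_embeddable:
  fixes G :: "('g, 'b) monoid_scheme"
  assumes G: "group G"
    and loc: "\<And>F. finite F \<Longrightarrow> F \<subseteq> carrier G \<Longrightarrow>
       \<exists>(H :: ('h, 'c) monoid_scheme) \<phi>. det_bound H \<and> \<phi> ` F \<subseteq> carrier H \<and> inj_on \<phi> F \<and>
         (\<forall>x\<in>F. \<forall>y\<in>F. x \<otimes>\<^bsub>G\<^esub> y \<in> F \<longrightarrow> \<phi> (x \<otimes>\<^bsub>G\<^esub> y) = \<phi> x \<otimes>\<^bsub>H\<^esub> \<phi> y)"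
  shows "det_bound G"
  unfolding det_bound_def
proof (intro conjI allI impI)
  show "group G" by fact
  interpret G: group G by fact
  fix n a D \<omega> c N P
  assume D: "0 < D" "\<omega> 0 = 1" and pos: "0 < c" "0 < N" and a: "hermitian_coeffs G n D \<omega> c N a" and maj: "log_majorant (real (N * D * c)) P"
  note aD = hermitian_coeffsD[OF a]
  \<comment> \<open>\<open>T\<close> is symmetric because \<open>a\<close> is hermitian; the unit is included to make it nonempty also for \<open>a = 0\<close>.\<close>
  define T where "T = insert \<one>\<^bsub>G\<^esub> {g. \<exists>i j. a i j g \<noteq> 0}"
  have T_carrier: "T \<subseteq> carrier G" using aD(3) by (auto simp: T_def)
  have T_fin: "finite T" unfolding T_def using hermitian_coeffs_finite_support[OF a] by simp
  have T_inv: "inv\<^bsub>G\<^esub> t \<in> T" if t: "t \<in> T" for t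
  proof (cases "t = \<one>\<^bsub>G\<^esub>")
    case False
    then obtain i j where ij: "a i j t \<noteq> 0" using t by (auto simp: T_def)
    then have "a j i (inv\<^bsub>G\<^esub> t) \<noteq> 0" using aD(6)[of t j i] aD(3)[OF ij] by simp
    then show ?thesis by (auto simp: T_def)
  qed (simp add: T_def)
  obtain B where B_fin: "\<And>m. finite (B m)" and B_carrier: "\<And>m. B m \<subseteq> carrier G" and B_one: "\<And>m. \<one>\<^bsub>G\<^esub> \<in> B m"
    and B_inc: "\<And>m. B m \<subseteq> B (Suc m)" and B_mult: "\<And>t x m. t \<in> T \<Longrightarrow> x \<in> B m \<Longrightarrow> t \<otimes>\<^bsub>G\<^esub> x \<in> B (Suc m)"
    using word_balls[OF G T_fin T_carrier] by blast
  have B_mono: "B m \<subseteq> B m'" if "m \<le> m'" for m m' using B_inc that by (rule lift_Suc_mono_le)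
  have T_B: "t \<in> B 1" if "t \<in> T" for t
    using B_mult[OF that B_one[of 0]] subsetD[OF T_carrier that] by simp
  define M where "M = degree P"
  define F where "F = B (Suc M)"
  have F: "finite F" "F \<subseteq> carrier G" using B_fin B_carrier by (auto simp: F_def)
  have TF: "T \<subseteq> F" using T_B B_mono[of 1 "Suc M"] unfolding F_def by auto
  have BF: "B m \<subseteq> F" if "m \<le> Suc M" for m using B_mono[OF that] by (simp add: F_def)
  obtain H :: "('h, 'c) monoid_scheme" and \<phi> where H: "det_bound H" and \<phi>: "\<phi> ` F \<subseteq> carrier H" "inj_on \<phi> F"
     "\<And>x y. x \<in> F \<Longrightarrow> y \<in> F \<Longrightarrow> x \<otimes>\<^bsub>G\<^esub> y \<in> F \<Longrightarrow> \<phi> (x \<otimes>\<^bsub>G\<^esub> y) = \<phi> x \<otimes>\<^bsub>H\<^esub> \<phi> y"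
    using loc[OF F] by blast
  have gH: "group H" using H by (simp add: det_bound_def)
  interpret H: group H by fact
  have oneF: "\<one>\<^bsub>G\<^esub> \<in> F" using TF by (auto simp: T_def)
  have \<phi>_in: "\<phi> x \<in> carrier H" if "x \<in> F" for x using that \<phi>(1) by auto
  have \<phi>_one: "\<phi> \<one>\<^bsub>G\<^esub> = \<one>\<^bsub>H\<^esub>"
    using \<phi>(3)[OF oneF oneF] oneF \<phi>_in[OF oneF] by (simp add: H.l_cancel_one')
  have \<phi>_inv: "\<phi> (inv\<^bsub>G\<^esub> t) = inv\<^bsub>H\<^esub> (\<phi> t)" if t: "t \<in> T" for t
  proof -
    have tF: "t \<in> F" "inv\<^bsub>G\<^esub> t \<in> F" "t \<in> carrier G" using t T_inv TF T_carrier by auto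
    have "\<phi> (inv\<^bsub>G\<^esub> t) \<otimes>\<^bsub>H\<^esub> \<phi> t = \<one>\<^bsub>H\<^esub>"
      using \<phi>(3)[OF tF(2,1)] tF(3) oneF \<phi>_one by simp
    then have "inv\<^bsub>H\<^esub> (\<phi> t) = \<phi> (inv\<^bsub>G\<^esub> t)" by (rule H.inv_equality[OF _ \<phi>_in[OF tF(1)] \<phi>_in[OF tF(2)]])
    then show ?thesis by (rule sym)
  qed
  define a' where "a' i j h = (if h \<in> \<phi> ` T then a i j (the_inv_into T \<phi> h) else 0)" for i j h
  have injT: "inj_on \<phi> T" using \<phi>(2) TF by (rule inj_on_subset)
  have a'_\<phi>: "a' i j (\<phi> t) = a i j t" if "t \<in> T" for i j t
    using that injT by (simp add: a'_def the_inv_into_f_f)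
  have a'_nz: "\<exists>t\<in>T. h = \<phi> t \<and> a i j t \<noteq> 0" if "a' i j h \<noteq> 0" for i j h
    using that a'_\<phi> unfolding a'_def by (auto split: if_splits)
  have a_T: "t \<in> T" if "a i j t \<noteq> 0" for i j t using that by (auto simp: T_def)
  have supp': "{(j, h). a' i j h \<noteq> 0} = (\<lambda>(j, g). (j, \<phi> g)) ` {(j, g). a i j g \<noteq> 0}" for i
  proof (intro equalityI subsetI)
    fix w assume "w \<in> {(j, h). a' i j h \<noteq> 0}"
    then obtain j h where w: "w = (j, h)" "a' i j h \<noteq> 0" by auto
    from a'_nz[OF w(2)] obtain t where "h = \<phi> t" "a i j t \<noteq> 0" by blast
    then show "w \<in> (\<lambda>(j, g). (j, \<phi> g)) ` {(j, g). a i j g \<noteq> 0}"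
      using w(1) by (auto intro!: image_eqI[of _ _ "(j, t)"])
  next
    fix w assume "w \<in> (\<lambda>(j, g). (j, \<phi> g)) ` {(j, g). a i j g \<noteq> 0}"
    then obtain j t where w: "w = (j, \<phi> t)" "a i j t \<noteq> 0" by auto
    then show "w \<in> {(j, h). a' i j h \<noteq> 0}" using a'_\<phi>[OF a_T[OF w(2)]] by simp
  qed
  have a': "hermitian_coeffs H n D \<omega> c N a'"
    unfolding hermitian_coeffs_def
  proof (intro conjI allI impI ballI)
    fix i j h assume "a' i j h \<noteq> 0"
    from a'_nz[OF this] obtain t where t: "t \<in> T" "h = \<phi> t" "a i j t \<noteq> 0" by blast
    show "i < n" "j < n" "h \<in> carrier H" using aD(1,2)[OF t(3)] t TF \<phi>_in by auto
  next
    fix i show "finite {(j, h). a' i j h \<noteq> 0}" unfolding supp' using aD(4) by (rule finite_imageI)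
    show "card {(j, h). a' i j h \<noteq> 0} \<le> N" unfolding supp' using card_image_le[OF aD(4)] aD(5) order_trans by blast
  next
    fix i j h assume h: "h \<in> carrier H"
    show "a' j i (inv\<^bsub>H\<^esub> h) = cnj (a' i j h)"
    proof (cases "h \<in> \<phi> ` T")
      case True
      then obtain t where t: "t \<in> T" "h = \<phi> t" by blast
      then have "a' j i (inv\<^bsub>H\<^esub> h) = a j i (inv\<^bsub>G\<^esub> t)" using a'_\<phi>[OF T_inv[OF t(1)]] \<phi>_inv by simp
      then show ?thesis using aD(6)[of t j i] t T_carrier a'_\<phi> by auto
    next
      case False
      have "inv\<^bsub>H\<^esub> h \<notin> \<phi> ` T"
      proof
        assume "inv\<^bsub>H\<^esub> h \<in> \<phi> ` T"
        then obtain t where t: "t \<in> T" "inv\<^bsub>H\<^esub> h = \<phi> t" by blast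
        have "h = inv\<^bsub>H\<^esub> (inv\<^bsub>H\<^esub> h)" using h by (rule H.inv_inv[symmetric])
        also have "\<dots> = \<phi> (inv\<^bsub>G\<^esub> t)" unfolding t(2) by (rule \<phi>_inv[OF t(1), symmetric])
        finally have "h = \<phi> (inv\<^bsub>G\<^esub> t)" .
        then show False using False T_inv[OF t(1)] by blast
      qed
      then show ?thesis using False by (simp add: a'_def)
    qed
  next
    fix i j h show "a' i j h \<in> int_rep D \<omega> c" using aD(7) zero_in_int_rep by (simp add: a'_def)
  qed
  \<comment> \<open>From a point of \<open>U m\<close> one can make \<open>m\<close> steps without leaving the ball of radius \<open>M\<close>.\<close>
  define U where "U m = (if m \<le> M then (UNIV :: nat set) \<times> B (M - m) else {})" for m :: nat
  have kpow_eq: "kpow (conv_kernel H a') k (i, \<one>\<^bsub>H\<^esub>) (i, \<one>\<^bsub>H\<^esub>) = kpow (conv_kernel G a) k (i, \<one>\<^bsub>G\<^esub>) (i, \<one>\<^bsub>G\<^esub>)"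
    if k: "k \<le> M" for i k
  proof -
    let ?\<theta> = "\<lambda>(j :: nat, x). (j, \<phi> x)"
    have step: "x \<in> B (M - Suc m) \<and> Suc m \<le> M" if "(j, x) \<in> U (Suc m)" for j x m
      using that by (auto simp: U_def split: if_splits)
    have key: "x \<in> F" "x \<in> carrier G" "inv\<^bsub>G\<^esub> t \<otimes>\<^bsub>G\<^esub> x \<in> B (M - m)" "inv\<^bsub>H\<^esub> (\<phi> t) \<otimes>\<^bsub>H\<^esub> \<phi> x = \<phi> (inv\<^bsub>G\<^esub> t \<otimes>\<^bsub>G\<^esub> x)"
      if "x \<in> B (M - Suc m)" "Suc m \<le> M" "t \<in> T" for x t m
    proof -
      have "B (M - Suc m) \<subseteq> F" "B (M - m) \<subseteq> F" by (rule BF, simp)+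
      then show xF: "x \<in> F" using that(1) by blast
      then show "x \<in> carrier G" using F by auto
      have "Suc (M - Suc m) = M - m" using that by simp
      then show B': "inv\<^bsub>G\<^esub> t \<otimes>\<^bsub>G\<^esub> x \<in> B (M - m)" using B_mult[OF T_inv[OF that(3)] that(1)] by simp
      then have "inv\<^bsub>G\<^esub> t \<otimes>\<^bsub>G\<^esub> x \<in> F" using \<open>B (M - m) \<subseteq> F\<close> by blast
      then show "inv\<^bsub>H\<^esub> (\<phi> t) \<otimes>\<^bsub>H\<^esub> \<phi> x = \<phi> (inv\<^bsub>G\<^esub> t \<otimes>\<^bsub>G\<^esub> x)"
        using \<phi>(3)[of "inv\<^bsub>G\<^esub> t" x] T_inv[OF that(3)] TF xF \<phi>_inv[OF that(3)] by auto
    qed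
    have "kpow (conv_kernel H a') k (?\<theta> (i, \<one>\<^bsub>G\<^esub>)) (?\<theta> (i, \<one>\<^bsub>G\<^esub>)) = kpow (conv_kernel G a) k (i, \<one>\<^bsub>G\<^esub>) (i, \<one>\<^bsub>G\<^esub>)"
    proof (rule kpow_local_iso[where U = U])
      fix m and z :: "nat \<times> 'g" assume z: "z \<in> U (Suc m)"
      obtain j x where zx: "z = (j, x)" by (cases z)
      note x = step[OF z[unfolded zx], THEN conjunct1] step[OF z[unfolded zx], THEN conjunct2]
      have oneT: "\<one>\<^bsub>G\<^esub> \<in> T" by (simp add: T_def)
      note rowG = conv_kernel_row[where a = a and i = j, OF G key(2)[OF x oneT] hermitian_coeffs_support[OF a]]
      note rowH = conv_kernel_row[where a = a' and i = j, OF gH \<phi>_in[OF key(1)[OF x oneT]] hermitian_coeffs_support[OF a']]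
      show "{y'. conv_kernel H a' (?\<theta> z) y' \<noteq> 0} = ?\<theta> ` {y. conv_kernel G a z y \<noteq> 0}"
        unfolding zx prod.case rowG(1) rowH(1) supp' image_image
        using key(4)[OF x] a_T by (intro image_cong) auto
      fix y assume "conv_kernel G a z y \<noteq> 0"
      then have "y \<in> {y. conv_kernel G a (j, x) y \<noteq> 0}" by (simp add: zx)
      then obtain j' t where y: "y = (j', inv\<^bsub>G\<^esub> t \<otimes>\<^bsub>G\<^esub> x)" "a j j' t \<noteq> 0" unfolding rowG(1) by auto
      have t: "t \<in> T" using a_T y(2) by blast
      have "conv_kernel H a' (?\<theta> z) (?\<theta> y) = a' j j' (\<phi> t)"
        using rowH(2)[of "\<phi> t" j'] key(4)[OF x t] TF t \<phi>_in by (auto simp: zx y)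
      also have "\<dots> = conv_kernel G a z y"
        using rowG(2)[of t j'] t T_carrier a'_\<phi> by (auto simp: zx y)
      finally show "y \<in> U m \<and> conv_kernel H a' (?\<theta> z) (?\<theta> y) = conv_kernel G a z y"
        using key(3)[OF x t] x(2) by (simp add: U_def y)
    next
      fix m
      have "B (M - Suc m) \<subseteq> B (M - m)" by (rule B_mono) simp
      then show "U (Suc m) \<subseteq> U m" by (auto simp: U_def)
    next
      show "inj_on ?\<theta> (U 0)" using \<phi>(2) BF[of M] by (auto simp: U_def inj_on_def)
    qed (use B_one k in \<open>auto simp: U_def\<close>)
    then show ?thesis by (simp add: \<phi>_one)
  qed
  have eq: "poly_trace H n a' P = poly_trace G n a P"
    unfolding poly_trace_def
  proof (rule sum.cong[OF refl])
    fix i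
    show "spectral (conv_kernel H a') (i, \<one>\<^bsub>H\<^esub>) P = spectral (conv_kernel G a) (i, \<one>\<^bsub>G\<^esub>) P"
      by (rule spectral_local_cong) (rule kpow_eq, simp add: M_def)
  qed
  have "- (real n * D * ln (real (N * D * c))) \<le> poly_trace H n a' P"
    by (rule det_boundD[where \<omega> = \<omega>, OF H D pos a' maj])
  then show "- (real n * D * ln (real (N * D * c))) \<le> poly_trace G n a P" by (simp only: eq)
qed

section \<open>Trivial groups, subgroups and limits\<close>

lemma kpow_support_subset:
  assumes "\<forall>z w. a z w \<noteq> 0 \<longrightarrow> w \<in> Y" and "kpow a k z w \<noteq> 0"
  shows "w \<in> Y \<or> w = z"
  using assms(2)
proof (induction k arbitrary: z)
  case (Suc k)
  from Suc.prems obtain y where y: "a z y \<noteq> 0" "kpow a k y w \<noteq> 0"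
    by (auto elim!: sum.not_neutral_contains_not_neutral)
  show ?case using Suc.IH[OF y(2)] assms(1) y(1) by auto
qed (simp split: if_splits)

lemma det_bound_trivial:
  fixes G :: "'g monoid"
  assumes "trivial_group G"
  shows "det_bound G"
  unfolding det_bound_def
proof (intro conjI allI impI)
  show G: "group G" using assms by (simp add: trivial_group_def)
  interpret G: group G by fact
  have carr: "carrier G = {\<one>\<^bsub>G\<^esub>}" using assms by (simp add: trivial_group_def)
  fix n a D \<omega> c N P
  assume D: "0 < D" "\<omega> 0 = 1" and pos: "0 < c" "0 < N" and a: "hermitian_coeffs G n D \<omega> c N a" and maj: "log_majorant (real (N * D * c)) P"
  note aD = hermitian_coeffsD[OF a]
  let ?K = "conv_kernel G a"
  define A where "A = mat n n (\<lambda>(i, j). a i j \<one>\<^bsub>G\<^esub>)"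
  have A: "A \<in> carrier_mat n n" by (simp add: A_def)
  have A_entry: "A $$ (i, j) = a i j \<one>\<^bsub>G\<^esub>" if "i < n" "j < n" for i j using that by (simp add: A_def)
  have rb: "row_bound (real (N * D * c)) ?K" by (rule conv_kernel_row_bound[where \<omega> = \<omega>, OF G a D])
  then have rf: "row_finite ?K" by (simp add: row_bound_def)
  have K_one: "?K (i, \<one>\<^bsub>G\<^esub>) (j, \<one>\<^bsub>G\<^esub>) = a i j \<one>\<^bsub>G\<^esub>" for i j by (simp add: conv_kernel_def)
  define Y where "Y = (\<lambda>j. (j, \<one>\<^bsub>G\<^esub>)) ` {..<n}"
  have supp: "w \<in> Y" if "?K z w \<noteq> 0" for z w
    using that aD(2) carr unfolding Y_def by (cases z; cases w) (force simp: conv_kernel_def split: if_splits)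
  have pow: "kpow ?K k (i, \<one>\<^bsub>G\<^esub>) (j, \<one>\<^bsub>G\<^esub>) = (A ^\<^sub>m k) $$ (i, j)" if "i < n" "j < n" for i j k
    using that
  proof (induction k arbitrary: i j)
    case 0
    then show ?case using A by simp
  next
    case (Suc k)
    have "kpow ?K (k + 1) (i, \<one>\<^bsub>G\<^esub>) (j, \<one>\<^bsub>G\<^esub>) = (\<Sum>y\<in>Y. kpow ?K k (i, \<one>\<^bsub>G\<^esub>) y * kpow ?K 1 y (j, \<one>\<^bsub>G\<^esub>))"
    proof (rule kpow_add[OF rf])
      show "{y. kpow ?K k (i, \<one>\<^bsub>G\<^esub>) y \<noteq> 0} \<subseteq> Y"
      proof
        fix y assume "y \<in> {y. kpow ?K k (i, \<one>\<^bsub>G\<^esub>) y \<noteq> 0}"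
        then have "y \<in> Y \<or> y = (i, \<one>\<^bsub>G\<^esub>)" using supp by (intro kpow_support_subset[of ?K Y]) auto
        then show "y \<in> Y" using Suc.prems(1) by (auto simp: Y_def)
      qed
    qed (simp add: Y_def)
    also have "\<dots> = (\<Sum>l<n. (A ^\<^sub>m k) $$ (i, l) * A $$ (l, j))"
      unfolding Y_def kpow_1[OF rf] using Suc by (subst sum.reindex) (auto simp: inj_on_def K_one A_entry intro!: sum.cong)
    also have "\<dots> = (A ^\<^sub>m Suc k) $$ (i, j)"
      using Suc.prems A by (simp add: scalar_prod_def atLeast0LessThan)
    finally show ?case by simp
  qed
  have "\<exists>m :: nat \<Rightarrow> nat \<Rightarrow> int. (z = 0 \<longrightarrow> m = (\<lambda>_ _. 0)) \<and> (z \<in> int_rep D \<omega> c \<longrightarrow> (\<forall>s<D. \<forall>t<D. \<bar>m s t\<bar> \<le> int c) \<and>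
     (\<forall>s<D. (\<Sum>t<D. of_int (m s t) * \<omega> t) = z * \<omega> s))" for z
  proof (cases "z = 0 \<or> z \<notin> int_rep D \<omega> c")
    case False
    then show ?thesis unfolding int_rep_def by blast
  qed (auto intro!: exI[of _ "\<lambda>_ _. 0"])
  \<comment> \<open>A choice of integer matrices with \<open>0\<close> represented by the zero matrix, so that their rows inherit the sparsity
    of \<open>a\<close>.\<close>
  then obtain \<mu> :: "complex \<Rightarrow> nat \<Rightarrow> nat \<Rightarrow> int" where \<mu>: "\<mu> 0 = (\<lambda>_ _. 0)"
    "\<And>z s t. z \<in> int_rep D \<omega> c \<Longrightarrow> s < D \<Longrightarrow> t < D \<Longrightarrow> \<bar>\<mu> z s t\<bar> \<le> int c"
    "\<And>z s. z \<in> int_rep D \<omega> c \<Longrightarrow> s < D \<Longrightarrow> (\<Sum>t<D. of_int (\<mu> z s t) * \<omega> t) = z * \<omega> s"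
    by metis
  have "- (real n * D * ln (real (N * D * c))) \<le> (\<Sum>i<n. Re (moment_functional (\<lambda>k. (A ^\<^sub>m k) $$ (i, i)) P))"
  proof (rule hermitian_mat_log_bound[where \<omega> = \<omega> and m = "\<lambda>i j. \<mu> (A $$ (i, j))", OF A _ D _ _ _ maj])
    show "A $$ (j, i) = cnj (A $$ (i, j))" if "i < n" "j < n" for i j
      using aD(6)[of "\<one>\<^bsub>G\<^esub>" j i] that by (simp add: A_entry)
    show "1 \<le> real (N * D * c)" using D pos by (simp add: Suc_le_eq flip: of_nat_mult)
    show "(\<Sum>t<D. of_int (\<mu> (A $$ (i, j)) s t) * \<omega> t) = A $$ (i, j) * \<omega> s" if "i < n" "j < n" "s < D" for i j s
      using that by (intro \<mu>(3)) (simp_all add: A_entry aD(7))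
    fix i s assume is': "i < n" "s < D"
    define J where "J = {j. a i j \<one>\<^bsub>G\<^esub> \<noteq> 0}"
    have "(\<lambda>j. (j, \<one>\<^bsub>G\<^esub>)) ` J \<subseteq> {(j, g). a i j g \<noteq> 0}" by (auto simp: J_def)
    then have "card ((\<lambda>j. (j, \<one>\<^bsub>G\<^esub>)) ` J) \<le> N" using card_mono[OF aD(4)] aD(5) order_trans by blast
    then have J: "card J \<le> N" by (simp add: card_image inj_on_def)
    have Jn: "J \<subseteq> {..<n}" using aD(2) by (auto simp: J_def)
    have "(\<Sum>j<n. \<Sum>t<D. real_of_int \<bar>\<mu> (A $$ (i, j)) s t\<bar>) = (\<Sum>j\<in>J. \<Sum>t<D. real_of_int \<bar>\<mu> (A $$ (i, j)) s t\<bar>)"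
      using Jn is' by (intro sum.mono_neutral_right) (auto simp: A_entry J_def \<mu>(1))
    also have "\<dots> \<le> (\<Sum>j\<in>J. \<Sum>t<D. real c)"
    proof (intro sum_mono)
      fix j t assume "j \<in> J" "t \<in> {..<D}"
      then have "\<bar>\<mu> (A $$ (i, j)) s t\<bar> \<le> int c" using Jn is' by (intro \<mu>(2)) (auto simp: A_entry aD(7))
      then show "real_of_int \<bar>\<mu> (A $$ (i, j)) s t\<bar> \<le> real c" by linarith
    qed
    also have "\<dots> = real (card J * (D * c))" by simp
    also have "\<dots> \<le> real (N * (D * c))" using J by (intro of_nat_mono mult_le_mono1)
    finally show "(\<Sum>j<n. \<Sum>t<D. real_of_int \<bar>\<mu> (A $$ (i, j)) s t\<bar>) \<le> real (N * D * c)" by (simp add: mult.assoc)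
  qed
  also have "\<dots> = poly_trace G n a P"
    unfolding poly_trace_def spectral_def by (intro sum.cong refl) (simp add: pow)
  finally show "- (real n * D * ln (real (N * D * c))) \<le> poly_trace G n a P" .
qed

lemma det_bound_subgroup:
  fixes H :: "'h monoid"
  assumes "det_bound H" "subgroup U H"
  shows "det_bound (H\<lparr>carrier := U\<rparr>)"
proof (rule det_bound_locally_embeddable)
  have H: "group H" using assms(1) by (simp add: det_bound_def)
  show "group (H\<lparr>carrier := U\<rparr>)" by (rule subgroup.subgroup_is_group[OF assms(2) H])
  fix F assume "F \<subseteq> carrier (H\<lparr>carrier := U\<rparr>)"
  then have "F \<subseteq> carrier H" using subgroup.subset[OF assms(2)] by auto
  with assms(1) show "\<exists>(K :: 'h monoid) \<phi>. det_bound K \<and> \<phi> ` F \<subseteq> carrier K \<and> inj_on \<phi> F \<and>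
      (\<forall>x\<in>F. \<forall>y\<in>F. x \<otimes>\<^bsub>H\<lparr>carrier := U\<rparr>\<^esub> y \<in> F \<longrightarrow> \<phi> (x \<otimes>\<^bsub>H\<lparr>carrier := U\<rparr>\<^esub> y) = \<phi> x \<otimes>\<^bsub>K\<^esub> \<phi> y)"
    by (intro exI[of _ H] exI[of _ "\<lambda>x. x"]) auto
qed

lemma det_bound_iso:
  fixes G :: "'g monoid" and K :: "'k monoid"
  assumes G: "group G" and K: "det_bound K" and iso: "G \<cong> K"
  shows "det_bound G"
proof (rule det_bound_locally_embeddable[OF G])
  obtain h where h: "h \<in> hom G K" "inj_on h (carrier G)" "h ` carrier G = carrier K"
    using iso unfolding is_iso_def iso_iff by (auto simp: iso_iff)
  fix F assume F: "F \<subseteq> carrier G"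
  show "\<exists>(K :: 'k monoid) \<phi>. det_bound K \<and> \<phi> ` F \<subseteq> carrier K \<and> inj_on \<phi> F \<and>
      (\<forall>x\<in>F. \<forall>y\<in>F. x \<otimes>\<^bsub>G\<^esub> y \<in> F \<longrightarrow> \<phi> (x \<otimes>\<^bsub>G\<^esub> y) = \<phi> x \<otimes>\<^bsub>K\<^esub> \<phi> y)"
    using K F h inj_on_subset[OF h(2) F] by (intro exI[of _ K] exI[of _ h]) (auto intro!: hom_mult)
qed

lemma directed_set_upper_bound:
  assumes "directed_set I r" "finite A" "A \<subseteq> I"
  obtains k where "k \<in> I" "\<And>i. i \<in> A \<Longrightarrow> (i, k) \<in> r"
proof -
  have tr: "(i, k) \<in> r" if "(i, j) \<in> r" "(j, k) \<in> r" for i j k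
    using assms(1) that unfolding directed_set_def preorder_on_def by (blast dest: transD)
  have "\<exists>k\<in>I. \<forall>i\<in>A. (i, k) \<in> r"
    using assms(2,3)
  proof (induction A)
    case empty
    then show ?case using assms(1) unfolding directed_set_def by blast
  next
    case (insert x A)
    then obtain k where k: "k \<in> I" "\<forall>i\<in>A. (i, k) \<in> r" by blast
    obtain k' where "k' \<in> I" "(x, k') \<in> r" "(k, k') \<in> r"
      using assms(1) insert.prems k(1) unfolding directed_set_def by blast
    then show ?case using k tr by blast
  qed
  then show thesis using that by blast
qed

text \<open>
  Finitely many elements are separated by finitely many coordinates, hence by a single coordinate of large
  index, and coordinates are homomorphisms.
\<close>

lemma det_bound_inverse_limit:
  fixes G :: "'g monoid" and Gs :: "'i \<Rightarrow> 'a monoid"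
  assumes sys: "inverse_system I r Gs f" and Gs: "\<And>i. i \<in> I \<Longrightarrow> det_bound (Gs i)"
    and G: "group G" and iso: "G \<cong> inverse_limit I r Gs f"
  shows "det_bound G"
proof (rule det_bound_locally_embeddable[OF G])
  let ?L = "inverse_limit I r Gs f"
  obtain h where h: "h \<in> hom G ?L" "inj_on h (carrier G)" "h ` carrier G = carrier ?L"
    using iso unfolding is_iso_def iso_iff by (auto simp: iso_iff)
  have dir: "directed_set I r" using sys by (simp add: inverse_system_def)
  have L: "x \<in> (\<Pi>\<^sub>E i\<in>I. carrier (Gs i)) \<and> (\<forall>(i, j)\<in>r. f i j (x j) = x i)" if "x \<in> carrier ?L" for x
    using that by (simp add: inverse_limit_def)
  have hL: "h x \<in> carrier ?L" if "x \<in> carrier G" for x using h(3) that by blast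
  fix F assume F: "finite F" "F \<subseteq> carrier G"
  have "\<exists>i\<in>I. h x i \<noteq> h y i" if "x \<in> F" "y \<in> F" "x \<noteq> y" for x y
  proof (rule ccontr)
    assume "\<not> ?thesis"
    moreover have "h x \<in> (\<Pi>\<^sub>E i\<in>I. carrier (Gs i))" "h y \<in> (\<Pi>\<^sub>E i\<in>I. carrier (Gs i))"
      using L[OF hL] F(2) that by blast+
    ultimately have "h x = h y" by (intro PiE_ext) auto
    then show False using h(2) F(2) that by (auto dest: inj_onD)
  qed
  then obtain d where d: "\<And>x y. x \<in> F \<Longrightarrow> y \<in> F \<Longrightarrow> x \<noteq> y \<Longrightarrow> d x y \<in> I \<and> h x (d x y) \<noteq> h y (d x y)" by metis
  obtain k where k: "k \<in> I" "\<And>i. i \<in> (\<lambda>(x, y). d x y) ` (F \<times> F - Id) \<Longrightarrow> (i, k) \<in> r"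
  proof (rule directed_set_upper_bound[OF dir])
    show "finite ((\<lambda>(x, y). d x y) ` (F \<times> F - Id))" using F(1) by simp
    show "(\<lambda>(x, y). d x y) ` (F \<times> F - Id) \<subseteq> I" using d by auto
  qed blast
  have inj: "inj_on (\<lambda>x. h x k) F"
  proof (rule inj_onI, rule ccontr)
    fix x y assume xy: "x \<in> F" "y \<in> F" "h x k = h y k" "x \<noteq> y"
    have "(d x y, k) \<in> r" by (rule k(2)) (use xy in \<open>auto intro!: image_eqI[of _ _ "(x, y)"]\<close>)
    then have "f (d x y) k (h x k) = h x (d x y)" "f (d x y) k (h y k) = h y (d x y)"
      using L[OF hL] F(2) xy by blast+
    then show False using d[OF xy(1,2,4)] xy(3) by simp
  qed
  have mult: "h (x \<otimes>\<^bsub>G\<^esub> y) k = h x k \<otimes>\<^bsub>Gs k\<^esub> h y k" if "x \<in> F" "y \<in> F" for x y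
  proof -
    have "h (x \<otimes>\<^bsub>G\<^esub> y) = h x \<otimes>\<^bsub>?L\<^esub> h y" using h(1) that F(2) by (intro hom_mult) auto
    then show ?thesis using k(1) by (simp add: inverse_limit_def)
  qed
  have "h x k \<in> carrier (Gs k)" if "x \<in> F" for x using L[OF hL, of x] that F(2) k(1) by (auto simp: PiE_def Pi_def)
  then show "\<exists>(K :: 'a monoid) \<phi>. det_bound K \<and> \<phi> ` F \<subseteq> carrier K \<and> inj_on \<phi> F \<and>
      (\<forall>x\<in>F. \<forall>y\<in>F. x \<otimes>\<^bsub>G\<^esub> y \<in> F \<longrightarrow> \<phi> (x \<otimes>\<^bsub>G\<^esub> y) = \<phi> x \<otimes>\<^bsub>K\<^esub> \<phi> y)"
    using Gs[OF k(1)] inj mult by (intro exI[of _ "Gs k"] exI[of _ "\<lambda>x. h x k"]) auto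
qed

text \<open>
  Finitely many elements and the relations between their products are already visible at a single index,
  provided it is large enough.
\<close>

lemma det_bound_direct_limit:
  fixes G :: "'g monoid" and Gs :: "'i \<Rightarrow> 'a monoid"
  assumes sys: "direct_system I r Gs f" and Gs: "\<And>i. i \<in> I \<Longrightarrow> det_bound (Gs i)"
    and G: "group G" and iso: "G \<cong> direct_limit I r Gs f"
  shows "det_bound G"
proof (rule det_bound_locally_embeddable[OF G])
  let ?L = "direct_limit I r Gs f" and ?R = "direct_limit_rel I r Gs f"
  obtain h where h: "h \<in> hom G ?L" "inj_on h (carrier G)" "h ` carrier G = carrier ?L"
    using iso unfolding is_iso_def iso_iff by (auto simp: iso_iff)
  have dir: "directed_set I r" using sys by (simp add: direct_system_def)
  have r: "r \<subseteq> I \<times> I" "\<And>i. i \<in> I \<Longrightarrow> (i, i) \<in> r" "\<And>i j k. (i, j) \<in> r \<Longrightarrow> (j, k) \<in> r \<Longrightarrow> (i, k) \<in> r"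
    using dir unfolding directed_set_def preorder_on_def refl_on_def by (blast dest: transD)+
  have ub: "\<exists>k\<in>I. (i, k) \<in> r \<and> (j, k) \<in> r" if "i \<in> I" "j \<in> I" for i j
    using dir that unfolding directed_set_def by blast
  have f_hom: "f i j \<in> hom (Gs i) (Gs j)" if "(i, j) \<in> r" for i j using sys that unfolding direct_system_def by blast
  have f_in: "f i j x \<in> carrier (Gs j)" if "(i, j) \<in> r" "x \<in> carrier (Gs i)" for i j x
    using hom_in_carrier[OF f_hom] that by blast
  have f_mult: "f i j (x \<otimes>\<^bsub>Gs i\<^esub> y) = f i j x \<otimes>\<^bsub>Gs j\<^esub> f i j y"
    if "(i, j) \<in> r" "x \<in> carrier (Gs i)" "y \<in> carrier (Gs i)" for i j x y
    using hom_mult[OF f_hom] that by blast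
  have f_comp: "f j k (f i j x) = f i k x" if "(i, j) \<in> r" "(j, k) \<in> r" "x \<in> carrier (Gs i)" for i j k x
    using sys that unfolding direct_system_def by blast
  have grp: "group (Gs i)" if "i \<in> I" for i using sys that unfolding direct_system_def by blast
  have R: "(j, b) \<in> ?R `` {(i, a)} \<longleftrightarrow> i \<in> I \<and> a \<in> carrier (Gs i) \<and> j \<in> I \<and> b \<in> carrier (Gs j) \<and>
      (\<exists>k\<in>I. (i, k) \<in> r \<and> (j, k) \<in> r \<and> f i k a = f j k b)" for i j a b
    by (simp add: direct_limit_rel_def)
  have R_refl: "(i, a) \<in> ?R `` {(i, a)}" if "i \<in> I" "a \<in> carrier (Gs i)" for i a
    unfolding R using that r(2) by blast
  have R_sub: "?R `` {(i, a)} \<subseteq> ?R `` {(j, b)}"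
    if ij: "i \<in> I" "j \<in> I" "a \<in> carrier (Gs i)" "b \<in> carrier (Gs j)" "(i, m) \<in> r" "(j, m) \<in> r" "f i m a = f j m b" for i j a b m
  proof (rule subsetI)
    fix w assume w: "w \<in> ?R `` {(i, a)}"
    obtain l c where lc: "w = (l, c)" by (cases w)
    from w[unfolded lc] obtain k where k: "l \<in> I" "c \<in> carrier (Gs l)" "k \<in> I" "(i, k) \<in> r" "(l, k) \<in> r" "f i k a = f l k c"
      unfolding R by blast
    have "m \<in> I" using ij r(1) by blast
    then obtain k' where k': "k' \<in> I" "(k, k') \<in> r" "(m, k') \<in> r" using ub[OF k(3)] by blast
    have "f j k' b = f m k' (f j m b)" using f_comp[OF ij(6) k'(3) ij(4)] by simp
    also have "\<dots> = f i k' a" using f_comp[OF ij(5) k'(3) ij(3)] ij(7) by simp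
    also have "\<dots> = f k k' (f i k a)" using f_comp[OF k(4) k'(2) ij(3)] by simp
    also have "\<dots> = f l k' c" using f_comp[OF k(5) k'(2) k(2)] k(6) by simp
    finally have "(l, c) \<in> ?R `` {(j, b)}" unfolding R using ij k k' r(3) by blast
    then show "w \<in> ?R `` {(j, b)}" by (simp only: lc)
  qed
  have "\<exists>i a. i \<in> I \<and> a \<in> carrier (Gs i) \<and> h x = ?R `` {(i, a)}" if "x \<in> carrier G" for x
  proof -
    have "h x \<in> carrier ?L" using h(3) that by blast
    then show ?thesis unfolding direct_limit_def by (auto elim!: quotientE)
  qed
  then obtain \<iota> \<alpha> where rep: "\<And>x. x \<in> carrier G \<Longrightarrow> \<iota> x \<in> I" "\<And>x. x \<in> carrier G \<Longrightarrow> \<alpha> x \<in> carrier (Gs (\<iota> x))"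
    "\<And>x. x \<in> carrier G \<Longrightarrow> h x = ?R `` {(\<iota> x, \<alpha> x)}" by metis
  have mult: "\<exists>m\<in>I. (\<iota> x, m) \<in> r \<and> (\<iota> y, m) \<in> r \<and> (\<iota> (x \<otimes>\<^bsub>G\<^esub> y), m) \<in> r \<and>
      f (\<iota> (x \<otimes>\<^bsub>G\<^esub> y)) m (\<alpha> (x \<otimes>\<^bsub>G\<^esub> y)) = f (\<iota> x) m (\<alpha> x) \<otimes>\<^bsub>Gs m\<^esub> f (\<iota> y) m (\<alpha> y)"
    if x: "x \<in> carrier G" and y: "y \<in> carrier G" for x y
  proof -
    interpret G: group G by fact
    have xy: "x \<otimes>\<^bsub>G\<^esub> y \<in> carrier G" using x y by simp
    obtain k where k: "k \<in> I" "(\<iota> x, k) \<in> r" "(\<iota> y, k) \<in> r" using ub rep(1) x y by blast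
    define p where "p = f (\<iota> x) k (\<alpha> x) \<otimes>\<^bsub>Gs k\<^esub> f (\<iota> y) k (\<alpha> y)"
    have fx: "f (\<iota> x) k (\<alpha> x) \<in> carrier (Gs k)" "f (\<iota> y) k (\<alpha> y) \<in> carrier (Gs k)" using f_in k rep(2) x y by blast+
    have p: "p \<in> carrier (Gs k)" unfolding p_def by (rule group.subgroup_self[OF grp[OF k(1)], THEN subgroup.m_closed]) (rule fx)+
    have "(k, p) \<in> h x \<otimes>\<^bsub>?L\<^esub> h y"
      unfolding direct_limit_def monoid.simps p_def
      using R_refl[OF k(1) p] R_refl[OF rep(1,2)[OF x]] R_refl[OF rep(1,2)[OF y]] k
      unfolding p_def rep(3)[OF x] rep(3)[OF y] by blast
    then have "(k, p) \<in> h (x \<otimes>\<^bsub>G\<^esub> y)" using hom_mult[OF h(1) x y] by simp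
    then obtain m where m: "m \<in> I" "(\<iota> (x \<otimes>\<^bsub>G\<^esub> y), m) \<in> r" "(k, m) \<in> r" "f (\<iota> (x \<otimes>\<^bsub>G\<^esub> y)) m (\<alpha> (x \<otimes>\<^bsub>G\<^esub> y)) = f k m p"
      unfolding rep(3)[OF xy] R by blast
    have "f k m p = f k m (f (\<iota> x) k (\<alpha> x)) \<otimes>\<^bsub>Gs m\<^esub> f k m (f (\<iota> y) k (\<alpha> y))"
      unfolding p_def by (rule f_mult[OF m(3) fx])
    also have "\<dots> = f (\<iota> x) m (\<alpha> x) \<otimes>\<^bsub>Gs m\<^esub> f (\<iota> y) m (\<alpha> y)"
      by (simp only: f_comp[OF k(2) m(3) rep(2)[OF x]] f_comp[OF k(3) m(3) rep(2)[OF y]])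
    finally show ?thesis using m r(3)[OF k(2) m(3)] r(3)[OF k(3) m(3)] by (intro bexI[of _ m]) simp_all
  qed
  then obtain \<mu> where \<mu>: "\<And>x y. x \<in> carrier G \<Longrightarrow> y \<in> carrier G \<Longrightarrow> \<mu> x y \<in> I \<and> (\<iota> x, \<mu> x y) \<in> r \<and> (\<iota> y, \<mu> x y) \<in> r \<and> (\<iota> (x \<otimes>\<^bsub>G\<^esub> y), \<mu> x y) \<in> r \<and>
      f (\<iota> (x \<otimes>\<^bsub>G\<^esub> y)) (\<mu> x y) (\<alpha> (x \<otimes>\<^bsub>G\<^esub> y)) = f (\<iota> x) (\<mu> x y) (\<alpha> x) \<otimes>\<^bsub>Gs (\<mu> x y)\<^esub> f (\<iota> y) (\<mu> x y) (\<alpha> y)"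
    by metis
  fix F assume F: "finite F" "F \<subseteq> carrier G"
  obtain m where m: "m \<in> I" "\<And>i. i \<in> (\<lambda>(x, y). \<mu> x y) ` (F \<times> F) \<Longrightarrow> (i, m) \<in> r"
  proof (rule directed_set_upper_bound[OF dir])
    show "finite ((\<lambda>(x, y). \<mu> x y) ` (F \<times> F))" using F(1) by simp
    show "(\<lambda>(x, y). \<mu> x y) ` (F \<times> F) \<subseteq> I" using \<mu> F(2) by auto
  qed blast
  define \<phi> where "\<phi> x = f (\<iota> x) m (\<alpha> x)" for x
  have \<mu>m: "(\<mu> x y, m) \<in> r" if "x \<in> F" "y \<in> F" for x y by (rule m(2)) (use that in \<open>auto intro!: image_eqI[of _ _ "(x, y)"]\<close>)
  have \<iota>m: "(\<iota> x, m) \<in> r" if "x \<in> F" for x using \<mu>m[OF that that] \<mu>[of x x] F(2) that r(3) by blast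
  have \<phi>_in: "\<phi> x \<in> carrier (Gs m)" if "x \<in> F" for x
    unfolding \<phi>_def using f_in[OF \<iota>m[OF that]] rep(2) F(2) that by blast
  have \<phi>_inj: "inj_on \<phi> F"
  proof (rule inj_onI)
    fix x y assume xy: "x \<in> F" "y \<in> F" "\<phi> x = \<phi> y"
    have c: "x \<in> carrier G" "y \<in> carrier G" using xy F(2) by auto
    have "h x = h y"
      unfolding rep(3)[OF c(1)] rep(3)[OF c(2)]
      using R_sub[OF rep(1)[OF c(1)] rep(1)[OF c(2)] rep(2)[OF c(1)] rep(2)[OF c(2)] \<iota>m[OF xy(1)] \<iota>m[OF xy(2)]]
        R_sub[OF rep(1)[OF c(2)] rep(1)[OF c(1)] rep(2)[OF c(2)] rep(2)[OF c(1)] \<iota>m[OF xy(2)] \<iota>m[OF xy(1)]] xy(3)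
      unfolding \<phi>_def by auto
    then show "x = y" using h(2) c by (auto dest: inj_onD)
  qed
  have \<phi>_mult: "\<phi> (x \<otimes>\<^bsub>G\<^esub> y) = \<phi> x \<otimes>\<^bsub>Gs m\<^esub> \<phi> y" if "x \<in> F" "y \<in> F" "x \<otimes>\<^bsub>G\<^esub> y \<in> F" for x y
  proof -
    have c: "x \<in> carrier G" "y \<in> carrier G" "x \<otimes>\<^bsub>G\<^esub> y \<in> carrier G" using that F(2) by auto
    define u where "u = \<mu> x y"
    note u = \<mu>[OF c(1,2), folded u_def] and um = \<mu>m[OF that(1,2), folded u_def]
    have "\<phi> (x \<otimes>\<^bsub>G\<^esub> y) = f u m (f (\<iota> (x \<otimes>\<^bsub>G\<^esub> y)) u (\<alpha> (x \<otimes>\<^bsub>G\<^esub> y)))"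
      unfolding \<phi>_def using f_comp[OF _ um rep(2)[OF c(3)]] u by simp
    also have "\<dots> = f u m (f (\<iota> x) u (\<alpha> x) \<otimes>\<^bsub>Gs u\<^esub> f (\<iota> y) u (\<alpha> y))" using u by simp
    also have "\<dots> = f u m (f (\<iota> x) u (\<alpha> x)) \<otimes>\<^bsub>Gs m\<^esub> f u m (f (\<iota> y) u (\<alpha> y))"
      using u by (intro f_mult[OF um] f_in rep c) auto
    also have "\<dots> = \<phi> x \<otimes>\<^bsub>Gs m\<^esub> \<phi> y"
      unfolding \<phi>_def using u f_comp[OF _ um rep(2)[OF c(1)]] f_comp[OF _ um rep(2)[OF c(2)]] by simp
    finally show ?thesis .
  qed
  show "\<exists>(K :: 'a monoid) \<phi>. det_bound K \<and> \<phi> ` F \<subseteq> carrier K \<and> inj_on \<phi> F \<and>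
      (\<forall>x\<in>F. \<forall>y\<in>F. x \<otimes>\<^bsub>G\<^esub> y \<in> F \<longrightarrow> \<phi> (x \<otimes>\<^bsub>G\<^esub> y) = \<phi> x \<otimes>\<^bsub>K\<^esub> \<phi> y)"
    using Gs[OF m(1)] \<phi>_in \<phi>_inj \<phi>_mult by (intro exI[of _ "Gs m"] exI[of _ \<phi>]) auto
qed

section \<open>Generalized amenable extensions\<close>

lemma right_actionD:
  assumes ra: "right_action H X \<rho>" and H: "group H"
  shows "h \<in> carrier H \<Longrightarrow> x \<in> X \<Longrightarrow> \<rho> h x \<in> X"
    and "x \<in> X \<Longrightarrow> \<rho> \<one>\<^bsub>H\<^esub> x = x"
    and "h \<in> carrier H \<Longrightarrow> k \<in> carrier H \<Longrightarrow> x \<in> X \<Longrightarrow> \<rho> h (\<rho> k x) = \<rho> (k \<otimes>\<^bsub>H\<^esub> h) x"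
proof -
  interpret A: group_action "opposite_group H" X \<rho> using ra by (simp add: right_action_def)
  have c: "carrier (opposite_group H) = carrier H" "\<one>\<^bsub>opposite_group H\<^esub> = \<one>\<^bsub>H\<^esub>"
    "g \<otimes>\<^bsub>opposite_group H\<^esub> h = h \<otimes>\<^bsub>H\<^esub> g" for g h by (simp_all add: opposite_group_def)
  show "\<rho> h x \<in> X" if "h \<in> carrier H" "x \<in> X" using A.element_image[of h x] that by (simp add: c)
  show "\<rho> \<one>\<^bsub>H\<^esub> x = x" if "x \<in> X" using fun_cong[OF A.id_eq_one, of x] that by (simp add: c)
  show "\<rho> h (\<rho> k x) = \<rho> (k \<otimes>\<^bsub>H\<^esub> h) x" if "h \<in> carrier H" "k \<in> carrier H" "x \<in> X"
    using A.composition_rule[of x h k] that by (simp add: c)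
qed

lemma left_actionD:
  assumes "group_action G X \<phi>"
  shows "g \<in> carrier G \<Longrightarrow> x \<in> X \<Longrightarrow> \<phi> g x \<in> X"
    and "x \<in> X \<Longrightarrow> \<phi> \<one>\<^bsub>G\<^esub> x = x"
    and "g \<in> carrier G \<Longrightarrow> k \<in> carrier G \<Longrightarrow> x \<in> X \<Longrightarrow> \<phi> g (\<phi> k x) = \<phi> (g \<otimes>\<^bsub>G\<^esub> k) x"
proof -
  interpret A: group_action G X \<phi> by fact
  show "\<phi> g x \<in> X" if "g \<in> carrier G" "x \<in> X" using A.element_image[of g x] that by simp
  show "\<phi> \<one>\<^bsub>G\<^esub> x = x" if "x \<in> X" using fun_cong[OF A.id_eq_one, of x] that by simp
  show "\<phi> g (\<phi> k x) = \<phi> (g \<otimes>\<^bsub>G\<^esub> k) x" if "g \<in> carrier G" "k \<in> carrier G" "x \<in> X"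
    using A.composition_rule[of x g k] that by simp
qed

locale commuting_actions =
  fixes G :: "'g monoid" and H :: "'h monoid" and X :: "'x set" and \<phi> :: "'g \<Rightarrow> 'x \<Rightarrow> 'x" and \<rho> :: "'h \<Rightarrow> 'x \<Rightarrow> 'x"
  assumes grpG: "group G" and grpH: "group H"
    and actG: "group_action G X \<phi>" and freeG: "free_on G X \<phi>"
    and actH: "right_action H X \<rho>" and freeH: "free_on H X \<rho>"
    and comm: "\<And>g h x. g \<in> carrier G \<Longrightarrow> h \<in> carrier H \<Longrightarrow> x \<in> X \<Longrightarrow> \<phi> g (\<rho> h x) = \<rho> h (\<phi> g x)"
begin

sublocale G: group G by (rule grpG)
sublocale H: group H by (rule grpH)

lemmas \<phi> = left_actionD[OF actG]
lemmas \<rho> = right_actionD[OF actH grpH]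

lemma \<phi>_cancel: "g \<in> carrier G \<Longrightarrow> x \<in> X \<Longrightarrow> \<phi> (inv\<^bsub>G\<^esub> g) (\<phi> g x) = x" "g \<in> carrier G \<Longrightarrow> x \<in> X \<Longrightarrow> \<phi> g (\<phi> (inv\<^bsub>G\<^esub> g) x) = x"
  by (simp_all add: \<phi>)

lemma \<rho>_cancel: "h \<in> carrier H \<Longrightarrow> x \<in> X \<Longrightarrow> \<rho> (inv\<^bsub>H\<^esub> h) (\<rho> h x) = x" "h \<in> carrier H \<Longrightarrow> x \<in> X \<Longrightarrow> \<rho> h (\<rho> (inv\<^bsub>H\<^esub> h) x) = x"
  by (simp_all add: \<rho>)

lemma \<phi>_inj: assumes "g \<in> carrier G" "k \<in> carrier G" "x \<in> X" "\<phi> g x = \<phi> k x" shows "g = k"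
proof -
  have "\<phi> (inv\<^bsub>G\<^esub> k \<otimes>\<^bsub>G\<^esub> g) x = \<phi> (inv\<^bsub>G\<^esub> k) (\<phi> g x)" using assms(1-3) by (simp add: \<phi>)
  also have "\<dots> = x" using \<phi>_cancel(1)[OF assms(2,3)] by (simp only: assms(4))
  finally have "inv\<^bsub>G\<^esub> k \<otimes>\<^bsub>G\<^esub> g = \<one>\<^bsub>G\<^esub>" using freeG assms(1-3) unfolding free_on_def by simp
  then show ?thesis using assms(1,2) by (simp add: G.inv_solve_left')
qed

lemma \<rho>_inj: assumes "h \<in> carrier H" "k \<in> carrier H" "x \<in> X" "\<rho> h x = \<rho> k x" shows "h = k"
proof -
  have "\<rho> (h \<otimes>\<^bsub>H\<^esub> inv\<^bsub>H\<^esub> k) x = \<rho> (inv\<^bsub>H\<^esub> k) (\<rho> h x)" using assms(1-3) by (simp add: \<rho>)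
  also have "\<dots> = x" using \<rho>_cancel(1)[OF assms(2,3)] by (simp only: assms(4))
  finally have "h \<otimes>\<^bsub>H\<^esub> inv\<^bsub>H\<^esub> k = \<one>\<^bsub>H\<^esub>" using freeH assms(1-3) unfolding free_on_def by simp
  then show ?thesis using assms(1,2) by (simp add: H.inv_solve_right')
qed

definition orb :: "'x \<Rightarrow> 'x set" where "orb x = {\<rho> h x | h. h \<in> carrier H}"

lemma orbits_eq: "orbits H X \<rho> = orb ` X"
  by (auto simp: orbits_def orbit_def orb_def)

lemma orb_refl: "x \<in> X \<Longrightarrow> x \<in> orb x"
  unfolding orb_def using \<rho>(2)[of x] H.one_closed by force

lemma orb_\<rho>: assumes "h \<in> carrier H" "x \<in> X" shows "orb (\<rho> h x) = orb x"
proof -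
  have "\<rho> k x \<in> orb (\<rho> h x)" if "k \<in> carrier H" for k
  proof -
    have "\<rho> k x = \<rho> (inv\<^bsub>H\<^esub> h \<otimes>\<^bsub>H\<^esub> k) (\<rho> h x)" using assms that by (simp add: \<rho> H.m_assoc[symmetric])
    then show ?thesis unfolding orb_def using assms that by blast
  qed
  moreover have "\<rho> k (\<rho> h x) \<in> orb x" if "k \<in> carrier H" for k
    unfolding orb_def using \<rho>(3)[OF that assms] assms(1) that by blast
  ultimately show ?thesis unfolding orb_def[of "\<rho> h x"] orb_def[of x] by (auto simp: orb_def)
qed

lemma \<phi>_orb: "g \<in> carrier G \<Longrightarrow> x \<in> X \<Longrightarrow> \<phi> g ` orb x = orb (\<phi> g x)"
  unfolding orb_def using comm by (auto simp: image_iff) (metis comm)+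

text \<open>
  A choice of base points identifies \<open>X\<close> with \<open>X/H \<times> H\<close>; \<open>coord x\<close> is the second coordinate of \<open>x\<close>.
\<close>

definition rep :: "'x set \<Rightarrow> 'x" where "rep Q = (SOME x. x \<in> X \<and> orb x = Q)"

lemma rep: assumes "Q \<in> orbits H X \<rho>" shows "rep Q \<in> X" "orb (rep Q) = Q"
proof -
  have "\<exists>x. x \<in> X \<and> orb x = Q" using assms unfolding orbits_eq by blast
  from someI_ex[OF this] show "rep Q \<in> X" "orb (rep Q) = Q" by (simp_all add: rep_def)
qed

lemma rep_shift: assumes "x \<in> X" shows "\<exists>h\<in>carrier H. \<rho> h (rep (orb x)) = x"
proof -
  have "orb x \<in> orbits H X \<rho>" using assms by (auto simp: orbits_eq)
  from rep[OF this] have "x \<in> orb (rep (orb x))" using orb_refl[OF assms] by simp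
  then obtain h where "h \<in> carrier H" "x = \<rho> h (rep (orb x))" unfolding orb_def[of "rep (orb x)"] by blast
  then show ?thesis by (intro bexI[of _ h]) (rule sym)
qed

definition coord :: "'x \<Rightarrow> 'h" where "coord x = (SOME h. h \<in> carrier H \<and> \<rho> h (rep (orb x)) = x)"

lemma coord: assumes "x \<in> X" shows "coord x \<in> carrier H" "\<rho> (coord x) (rep (orb x)) = x"
  using someI_ex[of "\<lambda>h. h \<in> carrier H \<and> \<rho> h (rep (orb x)) = x"] rep_shift[OF assms] by (auto simp: coord_def)

text \<open>
  The element that carries \<open>y\<close> to \<open>x\<close>. It is unique since the action is free, and the value is only used if
  it exists.
\<close>

definition quot :: "'x \<Rightarrow> 'x \<Rightarrow> 'g" where "quot x y = (THE g. g \<in> carrier G \<and> \<phi> g y = x)"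

lemma quot_eq: assumes "g \<in> carrier G" "y \<in> X" "\<phi> g y = x" shows "quot x y = g"
  unfolding quot_def using assms \<phi>_inj by (intro the_equality) auto

text \<open>
  The operator that \<open>a\<close> induces on \<open>l\<^sup>2(X)\<close> through the action of \<open>G\<close>. On a single \<open>G\<close>-orbit it is a
  copy of the convolution operator, and it commutes with \<open>H\<close>.
\<close>

definition action_kernel :: "(nat \<Rightarrow> nat \<Rightarrow> 'g \<Rightarrow> complex) \<Rightarrow> nat \<Rightarrow> 'x \<Rightarrow> nat \<Rightarrow> 'x \<Rightarrow> complex" where
  "action_kernel a i x j y = (if \<exists>g\<in>carrier G. \<phi> g y = x then a i j (quot x y) else 0)"

lemma action_kernel_eq: "g \<in> carrier G \<Longrightarrow> y \<in> X \<Longrightarrow> action_kernel a i (\<phi> g y) j y = a i j g"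
  unfolding action_kernel_def using quot_eq[of g y] by auto

lemma action_kernel_nonzero:
  assumes "action_kernel a i x j y \<noteq> 0" "y \<in> X"
  obtains g where "g \<in> carrier G" "\<phi> g y = x" "a i j g \<noteq> 0"
proof -
  from assms(1) obtain g where g: "g \<in> carrier G" "\<phi> g y = x" unfolding action_kernel_def by (auto split: if_splits)
  with action_kernel_eq[OF g(1) assms(2), of a i j] assms(1) that show thesis by simp
qed

lemma action_kernel_\<rho>:
  assumes h: "h \<in> carrier H" and xy: "x \<in> X" "y \<in> X"
  shows "action_kernel a i (\<rho> h x) j (\<rho> h y) = action_kernel a i x j y"
proof (cases "\<exists>g\<in>carrier G. \<phi> g y = x")
  case True
  then obtain g where g: "g \<in> carrier G" "\<phi> g y = x" by blast
  have "\<phi> g (\<rho> h y) = \<rho> h x" using comm[OF g(1) h xy(2)] g(2) by simp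
  then show ?thesis using action_kernel_eq[OF g(1), of "\<rho> h y" a i j] action_kernel_eq[OF g(1) xy(2), of a i j] \<rho>(1)[OF h xy(2)] g(2) by simp
next
  case False
  have "\<not> (\<exists>g\<in>carrier G. \<phi> g (\<rho> h y) = \<rho> h x)"
  proof
    assume "\<exists>g\<in>carrier G. \<phi> g (\<rho> h y) = \<rho> h x"
    then obtain g where g: "g \<in> carrier G" "\<phi> g (\<rho> h y) = \<rho> h x" by blast
    have "\<rho> h (\<phi> g y) = \<rho> h x" using comm[OF g(1) h xy(2)] g(2) by simp
    then have "\<rho> (inv\<^bsub>H\<^esub> h) (\<rho> h (\<phi> g y)) = \<rho> (inv\<^bsub>H\<^esub> h) (\<rho> h x)" by simp
    then have "\<phi> g y = x" using \<rho>_cancel(1)[OF h] \<phi>(1)[OF g(1) xy(2)] xy(1) by simp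
    then show False using False g(1) by blast
  qed
  then show ?thesis using False by (simp add: action_kernel_def)
qed

lemma action_kernel_hermitian:
  assumes herm: "\<And>i j g. g \<in> carrier G \<Longrightarrow> a j i (inv\<^bsub>G\<^esub> g) = cnj (a i j g)" and xy: "x \<in> X" "y \<in> X"
  shows "action_kernel a j y i x = cnj (action_kernel a i x j y)"
proof (cases "\<exists>g\<in>carrier G. \<phi> g y = x")
  case True
  then obtain g where g: "g \<in> carrier G" "\<phi> g y = x" by blast
  have "\<phi> (inv\<^bsub>G\<^esub> g) x = y" using \<phi>_cancel(1)[OF g(1) xy(2)] g(2) by simp
  then show ?thesis using action_kernel_eq[OF g(1) xy(2), of a i j] action_kernel_eq[of "inv\<^bsub>G\<^esub> g" x a j i] g xy(1) herm[OF g(1), of j i] by simp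
next
  case False
  have "\<not> (\<exists>g\<in>carrier G. \<phi> g x = y)"
  proof
    assume "\<exists>g\<in>carrier G. \<phi> g x = y"
    then obtain g where g: "g \<in> carrier G" "\<phi> g x = y" by blast
    then have "\<phi> (inv\<^bsub>G\<^esub> g) y = x" using \<phi>_cancel(1)[OF g(1) xy(1)] by simp
    then show False using False G.inv_closed[OF g(1)] by blast
  qed
  then show ?thesis using False by (simp add: action_kernel_def)
qed

text \<open>
  The action kernel is invariant under \<open>H\<close>, hence its restriction to a finite union of \<open>H\<close>-orbits is a finite
  matrix over the group ring of \<open>H\<close>. The enumeration \<open>\<beta>\<close> lists the pairs of an orbit and a coordinate below \<open>n\<close>.
\<close>

definition compression :: "nat \<Rightarrow> (nat \<Rightarrow> 'x set \<times> nat) \<Rightarrow> (nat \<Rightarrow> nat \<Rightarrow> 'g \<Rightarrow> complex) \<Rightarrow> nat \<Rightarrow> nat \<Rightarrow> 'h \<Rightarrow> complex" where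
  "compression M \<beta> a u v h = (if u < M \<and> v < M \<and> h \<in> carrier H
     then action_kernel a (snd (\<beta> u)) (\<rho> h (rep (fst (\<beta> u)))) (snd (\<beta> v)) (rep (fst (\<beta> v))) else 0)"

context
  fixes n D c N M :: nat and \<omega> :: "nat \<Rightarrow> complex" and a :: "nat \<Rightarrow> nat \<Rightarrow> 'g \<Rightarrow> complex"
    and Y :: "'x set set" and \<beta> :: "nat \<Rightarrow> 'x set \<times> nat"
  assumes a: "hermitian_coeffs G n D \<omega> c N a" and Y: "Y \<subseteq> orbits H X \<rho>" and \<beta>: "bij_betw \<beta> {..<M} (Y \<times> {..<n})"
begin

lemma \<beta>_in: "u < M \<Longrightarrow> fst (\<beta> u) \<in> Y \<and> snd (\<beta> u) < n \<and> rep (fst (\<beta> u)) \<in> X \<and> orb (rep (fst (\<beta> u))) = fst (\<beta> u)"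
proof -
  assume "u < M"
  then have "\<beta> u \<in> Y \<times> {..<n}" using \<beta> by (auto simp: bij_betw_def)
  then show ?thesis using rep Y by (auto simp: mem_Times_iff)
qed

text \<open>
  The entries of a row of the compression correspond to elements of \<open>G\<close> in the support of \<open>a\<close>, and this
  correspondence is injective because both actions are free.
\<close>

lemma compression_row:
  shows "finite {(v, h). compression M \<beta> a u v h \<noteq> 0}" "card {(v, h). compression M \<beta> a u v h \<noteq> 0} \<le> N"
proof -
  let ?S = "{(v, h). compression M \<beta> a u v h \<noteq> 0}" and ?T = "{(j, g). a (snd (\<beta> u)) j g \<noteq> 0}"
  define \<psi> where "\<psi> = (\<lambda>(v, h). (snd (\<beta> v), quot (\<rho> h (rep (fst (\<beta> u)))) (rep (fst (\<beta> v)))))"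
  have elem: "\<exists>g. u < M \<and> v < M \<and> h \<in> carrier H \<and> g \<in> carrier G \<and> \<phi> g (rep (fst (\<beta> v))) = \<rho> h (rep (fst (\<beta> u))) \<and>
      a (snd (\<beta> u)) (snd (\<beta> v)) g \<noteq> 0 \<and> \<psi> (v, h) = (snd (\<beta> v), g)" if "(v, h) \<in> ?S" for v h
  proof -
    from that have nz: "compression M \<beta> a u v h \<noteq> 0" by simp
    then have uv: "u < M" "v < M" "h \<in> carrier H" by (auto simp: compression_def split: if_splits)
    with nz have "action_kernel a (snd (\<beta> u)) (\<rho> h (rep (fst (\<beta> u)))) (snd (\<beta> v)) (rep (fst (\<beta> v))) \<noteq> 0" by (simp add: compression_def)
    then obtain g where g: "g \<in> carrier G" "\<phi> g (rep (fst (\<beta> v))) = \<rho> h (rep (fst (\<beta> u)))" "a (snd (\<beta> u)) (snd (\<beta> v)) g \<noteq> 0"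
      using \<beta>_in[OF uv(2)] by (elim action_kernel_nonzero) auto
    have "quot (\<rho> h (rep (fst (\<beta> u)))) (rep (fst (\<beta> v))) = g" using quot_eq[OF g(1) _ g(2)] \<beta>_in[OF uv(2)] by blast
    then show ?thesis using uv g by (auto simp: \<psi>_def)
  qed
  have sub: "\<psi> ` ?S \<subseteq> ?T"
  proof
    fix w assume "w \<in> \<psi> ` ?S"
    then obtain v h where vh: "(v, h) \<in> ?S" "w = \<psi> (v, h)" by auto
    from elem[OF vh(1)] vh(2) show "w \<in> ?T" by auto
  qed
  have inj: "inj_on \<psi> ?S"
  proof (rule inj_onI)
    fix w w' assume w: "w \<in> ?S" "w' \<in> ?S" "\<psi> w = \<psi> w'"
    obtain v h v' h' where vh: "w = (v, h)" "w' = (v', h')" by (cases w, cases w')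
    from elem[OF w(1)[unfolded vh]] obtain g where g: "u < M" "v < M" "h \<in> carrier H" "g \<in> carrier G"
      "\<phi> g (rep (fst (\<beta> v))) = \<rho> h (rep (fst (\<beta> u)))" "\<psi> (v, h) = (snd (\<beta> v), g)" by blast
    from elem[OF w(2)[unfolded vh]] obtain g' where g': "v' < M" "h' \<in> carrier H" "g' \<in> carrier G"
      "\<phi> g' (rep (fst (\<beta> v'))) = \<rho> h' (rep (fst (\<beta> u)))" "\<psi> (v', h') = (snd (\<beta> v'), g')" by blast
    from w(3) have eq: "snd (\<beta> v) = snd (\<beta> v')" "g' = g" unfolding vh g(6) g'(5) by auto
    define y where "y = \<phi> (inv\<^bsub>G\<^esub> g) (rep (fst (\<beta> u)))"
    have uX: "rep (fst (\<beta> u)) \<in> X" using \<beta>_in[OF g(1)] by blast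
    then have yX: "y \<in> X" unfolding y_def using \<phi>(1) g(4) by simp
    have rv: "rep (fst (\<beta> v)) = \<rho> h y"
    proof -
      have "rep (fst (\<beta> v)) = \<phi> (inv\<^bsub>G\<^esub> g) (\<rho> h (rep (fst (\<beta> u))))"
        using \<phi>_cancel(1)[OF g(4)] \<beta>_in[OF g(2)] by (simp flip: g(5))
      then show ?thesis unfolding y_def using comm[of "inv\<^bsub>G\<^esub> g" h, OF _ g(3) uX] g(4) by simp
    qed
    have rv': "rep (fst (\<beta> v')) = \<rho> h' y"
    proof -
      have "rep (fst (\<beta> v')) = \<phi> (inv\<^bsub>G\<^esub> g) (\<rho> h' (rep (fst (\<beta> u))))"
        using \<phi>_cancel(1)[OF g(4)] \<beta>_in[OF g'(1)] by (simp flip: g'(4) add: eq(2))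
      then show ?thesis unfolding y_def using comm[of "inv\<^bsub>G\<^esub> g" h', OF _ g'(2) uX] g(4) by simp
    qed
    have "fst (\<beta> v) = orb y" using \<beta>_in[OF g(2)] orb_\<rho>[OF g(3) yX] unfolding rv by simp
    moreover have "fst (\<beta> v') = orb y" using \<beta>_in[OF g'(1)] orb_\<rho>[OF g'(2) yX] unfolding rv' by simp
    ultimately have \<beta>v: "\<beta> v = \<beta> v'" using eq(1) by (simp add: prod_eq_iff)
    then have "v = v'" using \<beta> g(2) g'(1) by (auto simp: bij_betw_def inj_on_def)
    moreover have "h = h'" using \<rho>_inj[OF g(3) g'(2) yX] rv rv' \<beta>v by simp
    ultimately show "w = w'" by (simp add: vh)
  qed
  have fin: "finite ?T" by (rule hermitian_coeffsD(4)[OF a])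
  show "finite ?S" by (rule inj_on_finite[OF inj sub fin])
  have "card ?S \<le> card ?T" by (rule card_inj_on_le[OF inj sub fin])
  also have "\<dots> \<le> N" by (rule hermitian_coeffsD(5)[OF a])
  finally show "card ?S \<le> N" .
qed

lemma compression_hermitian_coeffs: "hermitian_coeffs H M D \<omega> c N (compression M \<beta> a)"
  unfolding hermitian_coeffs_def
proof (intro conjI allI impI ballI)
  fix u v h
  show "u < M" "v < M" "h \<in> carrier H" if "compression M \<beta> a u v h \<noteq> 0"
    using that by (auto simp: compression_def split: if_splits)
  show "compression M \<beta> a u v h \<in> int_rep D \<omega> c"
    using hermitian_coeffsD(7)[OF a] zero_in_int_rep by (simp add: compression_def action_kernel_def)
next
  fix u show "finite {(v, h). compression M \<beta> a u v h \<noteq> 0}" "card {(v, h). compression M \<beta> a u v h \<noteq> 0} \<le> N"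
    by (rule compression_row)+
next
  fix u v h assume h: "h \<in> carrier H"
  show "compression M \<beta> a v u (inv\<^bsub>H\<^esub> h) = cnj (compression M \<beta> a u v h)"
  proof (cases "u < M \<and> v < M")
    case True
    then have uX: "rep (fst (\<beta> u)) \<in> X" and vX: "rep (fst (\<beta> v)) \<in> X" using \<beta>_in by auto
    have "action_kernel a (snd (\<beta> v)) (\<rho> (inv\<^bsub>H\<^esub> h) (rep (fst (\<beta> v)))) (snd (\<beta> u)) (rep (fst (\<beta> u)))
        = action_kernel a (snd (\<beta> v)) (rep (fst (\<beta> v))) (snd (\<beta> u)) (\<rho> h (rep (fst (\<beta> u))))"
      using action_kernel_\<rho>[of h "\<rho> (inv\<^bsub>H\<^esub> h) (rep (fst (\<beta> v)))" "rep (fst (\<beta> u))" a "snd (\<beta> v)" "snd (\<beta> u)"]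
        h uX vX \<rho>_cancel(2)[OF h vX] \<rho>(1) by simp
    also have "\<dots> = cnj (action_kernel a (snd (\<beta> u)) (\<rho> h (rep (fst (\<beta> u)))) (snd (\<beta> v)) (rep (fst (\<beta> v))))"
      by (rule action_kernel_hermitian) (use hermitian_coeffsD(6)[OF a] \<rho>(1) h uX vX in auto)
    finally show ?thesis using True h by (simp add: compression_def)
  qed (auto simp: compression_def)
qed

lemma conv_kernel_compression:
  assumes "v < M" "w < M" "h \<in> carrier H" "k \<in> carrier H"
  shows "conv_kernel H (compression M \<beta> a) (v, h) (w, k)
    = action_kernel a (snd (\<beta> v)) (\<rho> h (rep (fst (\<beta> v)))) (snd (\<beta> w)) (\<rho> k (rep (fst (\<beta> w))))"
proof -
  have vX: "rep (fst (\<beta> v)) \<in> X" and wX: "rep (fst (\<beta> w)) \<in> X" using \<beta>_in assms by auto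
  have "\<rho> k (\<rho> (h \<otimes>\<^bsub>H\<^esub> inv\<^bsub>H\<^esub> k) (rep (fst (\<beta> v)))) = \<rho> h (rep (fst (\<beta> v)))"
    using assms vX by (simp add: \<rho> H.m_assoc)
  then show ?thesis
    using action_kernel_\<rho>[OF assms(4) \<rho>(1) wX, of "h \<otimes>\<^bsub>H\<^esub> inv\<^bsub>H\<^esub> k" "rep (fst (\<beta> v))" a "snd (\<beta> v)" "snd (\<beta> w)"] assms vX
    by (simp add: conv_kernel_def compression_def)
qed

text \<open>
  If the \<open>L\<close>-ball moves the orbit of the base point \<open>p\<close> only within the chosen orbits, then \<open>x \<mapsto> \<phi> x p\<close>, followed
  by the coordinates of \<open>X\<close>, is an isomorphism from this ball onto its image, which respects the kernels.
\<close>

lemma kpow_compression: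
  assumes B: "\<And>m. B m \<subseteq> carrier G" "\<And>m. \<one>\<^bsub>G\<^esub> \<in> B m" "\<And>m. B m \<subseteq> B (Suc m)"
    "\<And>i j g x m. a i j g \<noteq> 0 \<Longrightarrow> x \<in> B m \<Longrightarrow> inv\<^bsub>G\<^esub> g \<otimes>\<^bsub>G\<^esub> x \<in> B (Suc m)"
    and u: "u < M" and good: "\<And>g. g \<in> B L \<Longrightarrow> \<phi> g ` fst (\<beta> u) \<in> Y" and k: "k \<le> L"
  shows "kpow (conv_kernel H (compression M \<beta> a)) k (u, \<one>\<^bsub>H\<^esub>) (u, \<one>\<^bsub>H\<^esub>)
    = kpow (conv_kernel G a) k (snd (\<beta> u), \<one>\<^bsub>G\<^esub>) (snd (\<beta> u), \<one>\<^bsub>G\<^esub>)"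
proof -
  define p where "p = rep (fst (\<beta> u))"
  have p: "p \<in> X" "orb p = fst (\<beta> u)" using \<beta>_in[OF u] by (auto simp: p_def)
  define idx where "idx y j = inv_into {..<M} \<beta> (orb y, j)" for y j
  define \<theta> where "\<theta> = (\<lambda>(j, x). (idx (\<phi> x p) j, coord (\<phi> x p)))"
  define U where "U m = (if m \<le> L then {..<n} \<times> B (L - m) else {})" for m
  have BL: "B m \<subseteq> B L" if "m \<le> L" for m using lift_Suc_mono_le[of B, OF B(3) that] .
  have in_Y: "orb (\<phi> x p) \<in> Y" if "x \<in> B L" for x
    using good[OF that] \<phi>_orb[OF subsetD[OF B(1) that] p(1)] p(2) by simp
  have idx: "idx y j < M \<and> \<beta> (idx y j) = (orb y, j)" if "orb y \<in> Y" "j < n" for y j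
  proof -
    have "(orb y, j) \<in> \<beta> ` {..<M}" using \<beta> that by (auto simp: bij_betw_def)
    then show ?thesis unfolding idx_def using inv_into_into[of "(orb y, j)" \<beta> "{..<M}"] f_inv_into_f[of "(orb y, j)" \<beta> "{..<M}"] by simp
  qed
  have idx_eq: "idx y j = v" if "v < M" "\<beta> v = (orb y, j)" for y j v
    unfolding idx_def that(2)[symmetric] using \<beta> that(1) by (simp add: bij_betw_def inv_into_f_f)
  have \<theta>_fst: "fst (\<theta> (j, x)) < M" "\<beta> (fst (\<theta> (j, x))) = (orb (\<phi> x p), j)" "snd (\<theta> (j, x)) \<in> carrier H"
    "\<rho> (snd (\<theta> (j, x))) (rep (orb (\<phi> x p))) = \<phi> x p" if "x \<in> B L" "j < n" for j x
  proof -
    have "\<phi> x p \<in> X" using \<phi>(1)[OF _ p(1)] B(1) that by blast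
    from coord[OF this] idx[OF in_Y[OF that(1)] that(2)]
    show "fst (\<theta> (j, x)) < M" "\<beta> (fst (\<theta> (j, x))) = (orb (\<phi> x p), j)" "snd (\<theta> (j, x)) \<in> carrier H"
      "\<rho> (snd (\<theta> (j, x))) (rep (orb (\<phi> x p))) = \<phi> x p" by (simp_all add: \<theta>_def)
  qed
  have K\<theta>: "conv_kernel H (compression M \<beta> a) (\<theta> (j, x)) (w, h) = action_kernel a j (\<phi> x p) (snd (\<beta> w)) (\<rho> h (rep (fst (\<beta> w))))"
    if "x \<in> B L" "j < n" "w < M" "h \<in> carrier H" for j x w h
    using conv_kernel_compression[OF \<theta>_fst(1)[OF that(1,2)] that(3) \<theta>_fst(3)[OF that(1,2)] that(4)] \<theta>_fst(2,4)[OF that(1,2)] by simp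
  have K\<theta>\<theta>: "conv_kernel H (compression M \<beta> a) (\<theta> (j, x)) (\<theta> (j', x')) = action_kernel a j (\<phi> x p) j' (\<phi> x' p)"
    if "x \<in> B L" "j < n" "x' \<in> B L" "j' < n" for j x j' x'
    using K\<theta>[OF that(1,2) \<theta>_fst(1)[OF that(3,4)] \<theta>_fst(3)[OF that(3,4)]] \<theta>_fst(2,4)[OF that(3,4)] by simp
  have \<theta>_one: "\<theta> (snd (\<beta> u), \<one>\<^bsub>G\<^esub>) = (u, \<one>\<^bsub>H\<^esub>)"
  proof -
    have "\<beta> u = (orb (\<phi> \<one>\<^bsub>G\<^esub> p), snd (\<beta> u))" using p \<phi>(2)[OF p(1)] by (simp add: prod_eq_iff)
    then have 1: "idx (\<phi> \<one>\<^bsub>G\<^esub> p) (snd (\<beta> u)) = u" by (rule idx_eq[OF u])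
    have "\<rho> (coord p) p = p" using coord(2)[OF p(1)] p(2) by (simp add: p_def)
    then have "coord p = \<one>\<^bsub>H\<^esub>" using \<rho>_inj[OF coord(1)[OF p(1)] H.one_closed p(1)] \<rho>(2)[OF p(1)] by simp
    then show ?thesis using 1 \<phi>(2)[OF p(1)] by (simp add: \<theta>_def)
  qed
  have "kpow (conv_kernel H (compression M \<beta> a)) k (\<theta> (snd (\<beta> u), \<one>\<^bsub>G\<^esub>)) (\<theta> (snd (\<beta> u), \<one>\<^bsub>G\<^esub>))
      = kpow (conv_kernel G a) k (snd (\<beta> u), \<one>\<^bsub>G\<^esub>) (snd (\<beta> u), \<one>\<^bsub>G\<^esub>)"
  proof (rule kpow_local_iso[where U = U])
    show "inj_on \<theta> (U 0)"
    proof (rule inj_onI)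
      fix z w assume zw: "z \<in> U 0" "w \<in> U 0" "\<theta> z = \<theta> w"
      obtain j x j' x' where e: "z = (j, x)" "w = (j', x')" by (cases z, cases w)
      have in': "x \<in> B L" "j < n" "x' \<in> B L" "j' < n" using zw(1,2) by (auto simp: U_def e)
      have te: "\<theta> (j, x) = \<theta> (j', x')" using zw(3) by (simp only: e)
      have "(orb (\<phi> x p), j) = \<beta> (fst (\<theta> (j, x)))" by (rule \<theta>_fst(2)[OF in'(1,2), symmetric])
      also have "\<dots> = (orb (\<phi> x' p), j')" unfolding te by (rule \<theta>_fst(2)[OF in'(3,4)])
      finally have 1: "orb (\<phi> x p) = orb (\<phi> x' p)" "j = j'" by auto
      have "\<phi> x p = \<rho> (snd (\<theta> (j, x))) (rep (orb (\<phi> x p)))" by (rule \<theta>_fst(4)[OF in'(1,2), symmetric])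
      also have "\<dots> = \<phi> x' p" unfolding te 1(1) by (rule \<theta>_fst(4)[OF in'(3,4)])
      finally have "\<phi> x p = \<phi> x' p" .
      then have "x = x'" using \<phi>_inj[OF _ _ p(1)] B(1) in' by blast
      then show "z = w" using 1 by (simp add: e)
    qed
    show "(snd (\<beta> u), \<one>\<^bsub>G\<^esub>) \<in> U 0" "(snd (\<beta> u), \<one>\<^bsub>G\<^esub>) \<in> U k" using B(2) k \<beta>_in[OF u] by (auto simp: U_def)
    fix m
    have "B (L - Suc m) \<subseteq> B (L - m)" by (rule lift_Suc_mono_le[of B, OF B(3)]) simp
    then show "U (Suc m) \<subseteq> U m" by (auto simp: U_def)
    fix z assume z: "z \<in> U (Suc m)"
    obtain j x where zx: "z = (j, x)" by (cases z)
    have m: "Suc m \<le> L" "j < n" "x \<in> B (L - Suc m)" using z by (auto simp: U_def zx split: if_splits)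
    have xL: "x \<in> B L" using BL[of "L - Suc m"] m(3) by auto
    have xG: "x \<in> carrier G" using xL B(1) by blast
    have step: "inv\<^bsub>G\<^esub> g \<otimes>\<^bsub>G\<^esub> x \<in> B (L - m)" "inv\<^bsub>G\<^esub> g \<otimes>\<^bsub>G\<^esub> x \<in> B L" "g \<in> carrier G" "j' < n"
      "\<phi> g (\<phi> (inv\<^bsub>G\<^esub> g \<otimes>\<^bsub>G\<^esub> x) p) = \<phi> x p" if "a j j' g \<noteq> 0" for g j'
    proof -
      have "Suc (L - Suc m) = L - m" using m(1) by simp
      then show 1: "inv\<^bsub>G\<^esub> g \<otimes>\<^bsub>G\<^esub> x \<in> B (L - m)" using B(4)[OF that m(3)] by simp
      then show "inv\<^bsub>G\<^esub> g \<otimes>\<^bsub>G\<^esub> x \<in> B L" using BL[of "L - m"] by auto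
      show gG: "g \<in> carrier G" and "j' < n" using hermitian_coeffsD(2,3)[OF a that] by auto
      have "\<phi> (inv\<^bsub>G\<^esub> g \<otimes>\<^bsub>G\<^esub> x) p = \<phi> (inv\<^bsub>G\<^esub> g) (\<phi> x p)" using \<phi>(3)[of "inv\<^bsub>G\<^esub> g" x p] gG xG p(1) by simp
      then show "\<phi> g (\<phi> (inv\<^bsub>G\<^esub> g \<otimes>\<^bsub>G\<^esub> x) p) = \<phi> x p" using \<phi>_cancel(2)[OF gG \<phi>(1)[OF xG p(1)]] by simp
    qed
    have inX: "\<phi> (inv\<^bsub>G\<^esub> g \<otimes>\<^bsub>G\<^esub> x) p \<in> X" if "g \<in> carrier G" for g using \<phi>(1)[OF _ p(1)] that xG by simp
    note row = conv_kernel_row[where a = a and i = j, OF grpG xG hermitian_coeffs_support[OF a]]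
    have val: "conv_kernel H (compression M \<beta> a) (\<theta> z) (\<theta> (j', inv\<^bsub>G\<^esub> g \<otimes>\<^bsub>G\<^esub> x)) = a j j' g" if "a j j' g \<noteq> 0" for g j'
      using K\<theta>\<theta>[OF xL m(2) step(2,4)[OF that]] action_kernel_eq[OF step(3)[OF that] inX[OF step(3)[OF that]], of a j j'] step(5)[OF that]
      by (simp add: zx)
    show "{y'. conv_kernel H (compression M \<beta> a) (\<theta> z) y' \<noteq> 0} = \<theta> ` {y. conv_kernel G a z y \<noteq> 0}"
      unfolding zx row(1)
    proof (intro equalityI subsetI)
      fix y' assume "y' \<in> {y'. conv_kernel H (compression M \<beta> a) (\<theta> (j, x)) y' \<noteq> 0}"
      then have nz: "conv_kernel H (compression M \<beta> a) (\<theta> (j, x)) y' \<noteq> 0" by simp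
      obtain w h where wh: "y' = (w, h)" by (cases y')
      have w: "w < M" "h \<in> carrier H" using nz unfolding wh by (auto simp: conv_kernel_def compression_def split: if_splits prod.splits)
      have wX: "rep (fst (\<beta> w)) \<in> X" "orb (rep (fst (\<beta> w))) = fst (\<beta> w)" using \<beta>_in[OF w(1)] by auto
      define y where "y = \<rho> h (rep (fst (\<beta> w)))"
      have yX: "y \<in> X" unfolding y_def by (rule \<rho>(1)[OF w(2) wX(1)])
      have "action_kernel a j (\<phi> x p) (snd (\<beta> w)) y \<noteq> 0" using nz K\<theta>[OF xL m(2) w] by (simp add: wh y_def)
      then obtain g where g: "g \<in> carrier G" "\<phi> g y = \<phi> x p" "a j (snd (\<beta> w)) g \<noteq> 0" using yX by (rule action_kernel_nonzero)
      have y_eq: "\<phi> (inv\<^bsub>G\<^esub> g \<otimes>\<^bsub>G\<^esub> x) p = y"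
        using \<phi>(3)[of "inv\<^bsub>G\<^esub> g" x p] g(1) xG p(1) \<phi>_cancel(1)[OF g(1) yX] g(2) by simp
      have orby: "orb y = fst (\<beta> w)" unfolding y_def using orb_\<rho>[OF w(2) wX(1)] wX(2) by simp
      then have "\<beta> w = (orb y, snd (\<beta> w))" by (simp add: prod_eq_iff)
      then have "idx y (snd (\<beta> w)) = w" by (rule idx_eq[OF w(1)])
      moreover have "coord y = h"
        using \<rho>_inj[OF coord(1)[OF yX] w(2) wX(1)] coord(2)[OF yX] orby by (simp add: y_def)
      ultimately have "y' = \<theta> (snd (\<beta> w), inv\<^bsub>G\<^esub> g \<otimes>\<^bsub>G\<^esub> x)" by (simp add: \<theta>_def wh y_eq)
      then show "y' \<in> \<theta> ` (\<lambda>(j', g). (j', inv\<^bsub>G\<^esub> g \<otimes>\<^bsub>G\<^esub> x)) ` {(j', g). a j j' g \<noteq> 0}"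
        using g(3) by (auto simp: image_image intro!: image_eqI[of _ _ "(snd (\<beta> w), g)"])
    next
      fix y' assume "y' \<in> \<theta> ` (\<lambda>(j', g). (j', inv\<^bsub>G\<^esub> g \<otimes>\<^bsub>G\<^esub> x)) ` {(j', g). a j j' g \<noteq> 0}"
      then obtain j' g where "y' = \<theta> (j', inv\<^bsub>G\<^esub> g \<otimes>\<^bsub>G\<^esub> x)" "a j j' g \<noteq> 0" by auto
      then show "y' \<in> {y'. conv_kernel H (compression M \<beta> a) (\<theta> (j, x)) y' \<noteq> 0}" using val by (simp add: zx)
    qed
    fix y assume "conv_kernel G a z y \<noteq> 0"
    then have "y \<in> {y. conv_kernel G a (j, x) y \<noteq> 0}" by (simp add: zx)
    then obtain j' g where y: "y = (j', inv\<^bsub>G\<^esub> g \<otimes>\<^bsub>G\<^esub> x)" "a j j' g \<noteq> 0" unfolding row(1) by auto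
    show "y \<in> U m \<and> conv_kernel H (compression M \<beta> a) (\<theta> z) (\<theta> y) = conv_kernel G a z y"
      using val[OF y(2)] row(2)[OF step(3)[OF y(2)], of j'] step[OF y(2)] m(1) by (simp add: y(1) zx U_def)
  qed
  then show ?thesis by (simp only: \<theta>_one)
qed

end

text \<open>
  For generators this is the Foelner condition: translation is injective, so the orbits moved out of \<open>Xs k\<close> are
  no more numerous than the boundary. An orbit that is moved out by a product is either moved out by
  the second factor, or its translate by the second factor is moved out by the first one.
\<close>

lemma moved_orbits_negligible:
  assumes S: "symmetric_generating_set G S" "finite S"
    and Xs: "\<And>k. finite (Xs k)" "\<And>k. Xs k \<subseteq> orbits H X \<rho>"
    and lim: "(\<lambda>k. real (card ({\<phi> s ` Q | s Q. s \<in> S \<and> Q \<in> Xs k} - Xs k)) / real (card (Xs k))) \<longlonglongrightarrow> 0"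
    and g: "g \<in> carrier G"
  shows "(\<lambda>k. real (card {Q \<in> Xs k. \<phi> g ` Q \<notin> Xs k}) / real (card (Xs k))) \<longlonglongrightarrow> 0"
proof -
  have QX: "Q \<subseteq> X" if "Q \<in> Xs k" for Q k
    using Xs(2)[of k] that \<rho>(1) unfolding orbits_eq by (auto simp: orb_def)
  have inj: "inj_on (\<lambda>Q. \<phi> g ` Q) (Xs k)" if "g \<in> carrier G" for g k
  proof (rule inj_onI)
    fix Q Q' assume Q: "Q \<in> Xs k" "Q' \<in> Xs k" "\<phi> g ` Q = \<phi> g ` Q'"
    then show "Q = Q'" using group_action.inj_prop[OF actG that] QX by (metis inj_on_image_eq_iff)
  qed
  let ?N = "\<lambda>g k. card {Q \<in> Xs k. \<phi> g ` Q \<notin> Xs k}"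
  have gen: "(\<lambda>k. real (?N s k) / real (card (Xs k))) \<longlonglongrightarrow> 0" if s: "s \<in> S" for s
  proof (rule Lim_null_comparison[OF _ lim], intro always_eventually allI)
    fix k
    let ?bd = "{\<phi> s ` Q | s Q. s \<in> S \<and> Q \<in> Xs k} - Xs k"
    have sG: "s \<in> carrier G" using S(1) s by (auto simp: symmetric_generating_set_def)
    have "{\<phi> s ` Q | s Q. s \<in> S \<and> Q \<in> Xs k} = (\<lambda>(s, Q). \<phi> s ` Q) ` (S \<times> Xs k)" by auto
    then have fin: "finite ?bd" using S(2) Xs(1)[of k] by simp
    have "?N s k \<le> card ?bd"
    proof (rule card_inj_on_le[OF _ _ fin])
      show "inj_on (\<lambda>Q. \<phi> s ` Q) {Q \<in> Xs k. \<phi> s ` Q \<notin> Xs k}" by (rule inj_on_subset[OF inj[OF sG]]) auto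
      show "(\<lambda>Q. \<phi> s ` Q) ` {Q \<in> Xs k. \<phi> s ` Q \<notin> Xs k} \<subseteq> ?bd" using s by auto
    qed
    then show "norm (real (?N s k) / real (card (Xs k))) \<le> real (card ?bd) / real (card (Xs k))"
      by (simp add: divide_right_mono)
  qed
  have "g \<in> generate G S" using S(1) g by (simp add: symmetric_generating_set_def)
  then have "g \<in> carrier G \<and> (\<lambda>k. real (?N g k) / real (card (Xs k))) \<longlonglongrightarrow> 0"
  proof (induction rule: generate.induct)
    case one
    have "\<phi> \<one>\<^bsub>G\<^esub> ` Q = Q" if "Q \<in> Xs k" for Q k using \<phi>(2) QX[OF that] by (force simp: image_iff)
    then have empty: "{Q \<in> Xs k. \<phi> \<one>\<^bsub>G\<^esub> ` Q \<notin> Xs k} = {}" for k by auto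
    show ?case unfolding empty by simp
  next
    case (incl s)
    then show ?case using gen S(1) by (auto simp: symmetric_generating_set_def)
  next
    case (inv s)
    then have "inv\<^bsub>G\<^esub> s \<in> S" using S(1) by (auto simp: symmetric_generating_set_def)
    then show ?case using gen S(1) by (auto simp: symmetric_generating_set_def)
  next
    case (eng g1 g2)
    then have g: "g1 \<in> carrier G" "g2 \<in> carrier G" by auto
    have lim0: "(\<lambda>k. real (?N g1 k) / real (card (Xs k)) + real (?N g2 k) / real (card (Xs k))) \<longlonglongrightarrow> 0"
      using tendsto_add[of "\<lambda>k. real (?N g1 k) / real (card (Xs k))" 0 sequentially "\<lambda>k. real (?N g2 k) / real (card (Xs k))" 0] eng by simp
    have "(\<lambda>k. real (?N (g1 \<otimes>\<^bsub>G\<^esub> g2) k) / real (card (Xs k))) \<longlonglongrightarrow> 0"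
    proof (rule Lim_null_comparison[OF _ lim0], intro always_eventually allI)
      fix k
      let ?A = "{Q \<in> Xs k. \<phi> g2 ` Q \<notin> Xs k}" and ?B = "{Q \<in> Xs k. \<phi> g2 ` Q \<in> Xs k \<and> \<phi> g1 ` \<phi> g2 ` Q \<notin> Xs k}"
      have comp: "\<phi> (g1 \<otimes>\<^bsub>G\<^esub> g2) ` Q = \<phi> g1 ` \<phi> g2 ` Q" if "Q \<in> Xs k" for Q
        unfolding image_image using \<phi>(3)[OF g] QX[OF that] by (intro image_cong) auto
      have "{Q \<in> Xs k. \<phi> (g1 \<otimes>\<^bsub>G\<^esub> g2) ` Q \<notin> Xs k} \<subseteq> ?A \<union> ?B" using comp by auto
      then have "?N (g1 \<otimes>\<^bsub>G\<^esub> g2) k \<le> card (?A \<union> ?B)" using Xs(1)[of k] by (intro card_mono) auto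
      also have "\<dots> \<le> card ?A + card ?B" by (rule card_Un_le)
      also have "card ?B \<le> ?N g1 k"
      proof (rule card_inj_on_le)
        show "inj_on (\<lambda>Q. \<phi> g2 ` Q) ?B" by (rule inj_on_subset[OF inj[OF g(2)]]) auto
      qed (use Xs(1)[of k] in auto)
      finally have "real (?N (g1 \<otimes>\<^bsub>G\<^esub> g2) k) \<le> real (?N g1 k) + real (?N g2 k)" by simp
      then have "real (?N (g1 \<otimes>\<^bsub>G\<^esub> g2) k) / real (card (Xs k)) \<le> (real (?N g1 k) + real (?N g2 k)) / real (card (Xs k))"
        by (rule divide_right_mono) simp
      then show "norm (real (?N (g1 \<otimes>\<^bsub>G\<^esub> g2) k) / real (card (Xs k))) \<le> real (?N g1 k) / real (card (Xs k)) + real (?N g2 k) / real (card (Xs k))"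
        by (simp add: add_divide_distrib)
    qed
    then show ?case using g by simp
  qed
  then show ?thesis by blast
qed

end

lemma abs_spectral_le:
  assumes "row_bound \<kappa> a"
  shows "\<bar>spectral a w P\<bar> \<le> (\<Sum>m\<le>degree P. \<bar>coeff P m\<bar> * \<kappa> ^ m)"
proof -
  have "\<bar>spectral a w P\<bar> \<le> norm (moment_functional (\<lambda>k. kpow a k w w) P)"
    unfolding spectral_def by (rule abs_Re_le_cmod)
  also have "\<dots> \<le> (\<Sum>m\<le>degree P. norm (of_real (coeff P m) * kpow a m w w))"
    unfolding moment_functional_def by (rule norm_sum)
  also have "\<dots> \<le> (\<Sum>m\<le>degree P. \<bar>coeff P m\<bar> * \<kappa> ^ m)"
    by (intro sum_mono) (simp add: norm_mult mult_left_mono norm_kpow_le[OF assms])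
  finally show ?thesis .
qed

text \<open>
  An orbit that the \<open>L\<close>-ball does not move out of \<open>Xs k\<close> contributes the trace of \<open>P(a)\<close> to the trace for the
  compression to \<open>Xs k\<close>, and each of the other orbits contributes the same up to an error of at most
  \<open>2 C\<close> per coordinate. For the compression the bound over \<open>H\<close> is available. Divide by \<open>card (Xs k)\<close> and let \<open>k\<close> tend to infinity.
\<close>

lemma det_bound_generalized_amenable_extension:
  fixes G :: "'g monoid" and H :: "'h monoid"
  assumes ext: "generalized_amenable_extension G H" and detH: "det_bound H"
  shows "det_bound G"
  unfolding det_bound_def
proof (intro conjI allI impI)
  show G: "group G" using ext by (simp add: generalized_amenable_extension_def)
  have grpH: "group H" using detH by (simp add: det_bound_def)
  from ext obtain S and X :: "(nat \<times> 'h) set" and \<phi> \<rho> and Xs :: "nat \<Rightarrow> (nat \<times> 'h) set set" where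
    S: "finite S" "symmetric_generating_set G S" and
    act: "group_action G X \<phi>" "free_on G X \<phi>" "right_action H X \<rho>" "free_on H X \<rho>"
      "\<forall>g\<in>carrier G. \<forall>h\<in>carrier H. \<forall>x\<in>X. \<phi> g (\<rho> h x) = \<rho> h (\<phi> g x)" and
    Xs: "\<forall>k. finite (Xs k) \<and> Xs k \<noteq> {}" "(\<Union>k. Xs k) = orbits H X \<rho>"
      "(\<lambda>k. real (card ({\<phi> s ` Q | s Q. s \<in> S \<and> Q \<in> Xs k} - Xs k)) / real (card (Xs k))) \<longlonglongrightarrow> 0"
    unfolding generalized_amenable_extension_def by auto
  interpret commuting_actions G H X \<phi> \<rho>
    by (rule commuting_actions.intro) (use G grpH act in blast)+
  fix n a D \<omega> c N P
  assume D: "0 < D" "\<omega> 0 = 1" and pos: "0 < c" "0 < N" and a: "hermitian_coeffs G n D \<omega> c N a" and maj: "log_majorant (real (N * D * c)) P"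
  note aD = hermitian_coeffsD[OF a]
  define \<kappa> where "\<kappa> = real (N * D * c)"
  \<comment> \<open>A nonzero entry of the kernel leads from \<open>x\<close> to \<open>inv g \<otimes> x\<close>, with \<open>g\<close> in the support of \<open>a\<close>.\<close>
  define T where "T = (\<lambda>g. inv\<^bsub>G\<^esub> g) ` {g. \<exists>i j. a i j g \<noteq> 0}"
  have T: "finite T" "T \<subseteq> carrier G" unfolding T_def using hermitian_coeffs_finite_support[OF a] aD(3) by auto
  obtain B where B: "\<And>m. finite (B m)" "\<And>m. B m \<subseteq> carrier G" "\<And>m. \<one>\<^bsub>G\<^esub> \<in> B m" "\<And>m. B m \<subseteq> B (Suc m)"
    "\<And>t x m. t \<in> T \<Longrightarrow> x \<in> B m \<Longrightarrow> t \<otimes>\<^bsub>G\<^esub> x \<in> B (Suc m)" using word_balls[OF G T] by blast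
  have B5: "inv\<^bsub>G\<^esub> g \<otimes>\<^bsub>G\<^esub> x \<in> B (Suc m)" if "a i j g \<noteq> 0" "x \<in> B m" for i j g x m
    by (rule B(5)[OF _ that(2)]) (use that(1) in \<open>auto simp: T_def\<close>)
  define L where "L = degree P"
  define C where "C = (\<Sum>m\<le>degree P. \<bar>coeff P m\<bar> * \<kappa> ^ m)"
  define bad where "bad k = {Q \<in> Xs k. \<exists>g\<in>B L. \<phi> g ` Q \<notin> Xs k}" for k
  have sub: "Xs k \<subseteq> orbits H X \<rho>" for k using Xs(2) by blast
  have ineq: "- (real n * D * ln \<kappa>) - 2 * C * n * (real (card (bad k)) / real (card (Xs k))) \<le> poly_trace G n a P" for k
  proof -
    have fin: "finite (Xs k)" "Xs k \<noteq> {}" using Xs(1) by auto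
    define M where "M = card (Xs k \<times> {..<n})"
    obtain \<beta> where "bij_betw \<beta> {0..<card (Xs k \<times> {..<n})} (Xs k \<times> {..<n})"
      using ex_bij_betw_nat_finite[of "Xs k \<times> {..<n}"] fin by auto
    then have \<beta>: "bij_betw \<beta> {..<M} (Xs k \<times> {..<n})" by (simp add: M_def atLeast0LessThan)
    define a' where "a' = compression M \<beta> a"
    have a': "hermitian_coeffs H M D \<omega> c N a'" unfolding a'_def by (rule compression_hermitian_coeffs[OF a sub \<beta>])
    define F where "F u = spectral (conv_kernel H a') (u, \<one>\<^bsub>H\<^esub>) P" for u
    define E where "E i = spectral (conv_kernel G a) (i, \<one>\<^bsub>G\<^esub>) P" for i
    have "\<bar>F u\<bar> \<le> C" "\<bar>E i\<bar> \<le> C" for u i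
      unfolding F_def E_def C_def \<kappa>_def
      by (rule abs_spectral_le, rule conv_kernel_row_bound[where \<omega> = \<omega>, OF grpH a' D])
         (rule abs_spectral_le, rule conv_kernel_row_bound[where \<omega> = \<omega>, OF G a D])
    note FE = this
    have step: "F u \<le> E (snd (\<beta> u)) + (if fst (\<beta> u) \<in> bad k then 2 * C else 0)" if u: "u < M" for u
    proof (cases "fst (\<beta> u) \<in> bad k")
      case True
      then show ?thesis using FE(1)[of u] FE(2)[of "snd (\<beta> u)"] by simp
    next
      case False
      have "\<beta> u \<in> Xs k \<times> {..<n}" using \<beta> u by (auto simp: bij_betw_def)
      then have "fst (\<beta> u) \<in> Xs k" by (simp add: mem_Times_iff)
      then have good: "\<phi> g ` fst (\<beta> u) \<in> Xs k" if "g \<in> B L" for g using False that unfolding bad_def by blast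
      have "F u = E (snd (\<beta> u))"
        unfolding F_def E_def a'_def
      proof (rule spectral_local_cong)
        fix m assume "m \<le> degree P"
        then show "kpow (conv_kernel H (compression M \<beta> a)) m (u, \<one>\<^bsub>H\<^esub>) (u, \<one>\<^bsub>H\<^esub>)
            = kpow (conv_kernel G a) m (snd (\<beta> u), \<one>\<^bsub>G\<^esub>) (snd (\<beta> u), \<one>\<^bsub>G\<^esub>)"
          by (intro kpow_compression[OF a sub \<beta>, where B = B and L = L] B B5 u good) (auto simp: L_def)
      qed
      then show ?thesis using False by simp
    qed
    have "- (real M * D * ln \<kappa>) \<le> poly_trace H M a' P"
      unfolding \<kappa>_def by (rule det_boundD[where \<omega> = \<omega>, OF detH D pos a' maj])
    also have "\<dots> = (\<Sum>u<M. F u)" by (simp add: poly_trace_def F_def)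
    also have "\<dots> \<le> (\<Sum>u<M. E (snd (\<beta> u)) + (if fst (\<beta> u) \<in> bad k then 2 * C else 0))"
      by (intro sum_mono step) auto
    also have "\<dots> = (\<Sum>w\<in>Xs k \<times> {..<n}. E (snd w) + (if fst w \<in> bad k then 2 * C else 0))"
      by (rule sum.reindex_bij_betw[OF \<beta>])
    also have "\<dots> = (\<Sum>Q\<in>Xs k. \<Sum>i<n. E i + (if Q \<in> bad k then 2 * C else 0))"
      by (subst sum.cartesian_product) (rule sum.cong, auto)
    also have "\<dots> = (\<Sum>Q\<in>Xs k. poly_trace G n a P + (if Q \<in> bad k then n * (2 * C) else 0))"
      by (rule sum.cong[OF refl]) (simp add: sum.distrib poly_trace_def E_def)
    also have "\<dots> = card (Xs k) * poly_trace G n a P + card (bad k) * (n * (2 * C))"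
    proof -
      have "(\<Sum>Q\<in>Xs k. if Q \<in> bad k then real n * (2 * C) else 0) = (\<Sum>Q\<in>Xs k \<inter> bad k. real n * (2 * C))"
        by (rule sum.inter_restrict[OF fin(1), symmetric])
      also have "Xs k \<inter> bad k = bad k" by (auto simp: bad_def)
      finally show ?thesis by (simp add: sum.distrib)
    qed
    finally have main: "- (real M * D * ln \<kappa>) \<le> card (Xs k) * poly_trace G n a P + card (bad k) * (n * (2 * C))" .
    have M: "real M = real (card (Xs k)) * real n" by (simp add: M_def card_cartesian_product)
    have c0: "0 < real (card (Xs k))" using fin by (simp add: card_gt_0_iff)
    have "real (card (Xs k)) * (- (real n * D * ln \<kappa>) - 2 * C * n * (real (card (bad k)) / real (card (Xs k))))
      = - (real M * D * ln \<kappa>) - card (bad k) * (n * (2 * C))" using c0 by (simp add: M field_simps)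
    also have "\<dots> \<le> real (card (Xs k)) * poly_trace G n a P" using main by simp
    finally show ?thesis using c0 by (simp only: mult_le_cancel_left_pos)
  qed
  have moved: "(\<lambda>k. real (card {Q \<in> Xs k. \<phi> g ` Q \<notin> Xs k}) / real (card (Xs k))) \<longlonglongrightarrow> 0" if "g \<in> carrier G" for g
    by (rule moved_orbits_negligible[OF S(2,1) _ sub Xs(3) that]) (use Xs(1) in auto)
  have "(\<lambda>k. \<Sum>g\<in>B L. real (card {Q \<in> Xs k. \<phi> g ` Q \<notin> Xs k}) / real (card (Xs k))) \<longlonglongrightarrow> (\<Sum>g\<in>B L. 0)"
    by (intro tendsto_sum moved) (use B(2) in auto)
  then have lim0: "(\<lambda>k. \<Sum>g\<in>B L. real (card {Q \<in> Xs k. \<phi> g ` Q \<notin> Xs k}) / real (card (Xs k))) \<longlonglongrightarrow> 0" by simp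
  have "(\<lambda>k. real (card (bad k)) / real (card (Xs k))) \<longlonglongrightarrow> 0"
  proof (rule Lim_null_comparison[OF _ lim0], intro always_eventually allI)
    fix k
    have "bad k = (\<Union>g\<in>B L. {Q \<in> Xs k. \<phi> g ` Q \<notin> Xs k})" by (auto simp: bad_def)
    then have "card (bad k) \<le> (\<Sum>g\<in>B L. card {Q \<in> Xs k. \<phi> g ` Q \<notin> Xs k})" using card_UN_le[OF B(1)] by simp
    then have "real (card (bad k)) \<le> (\<Sum>g\<in>B L. real (card {Q \<in> Xs k. \<phi> g ` Q \<notin> Xs k}))" by (simp flip: of_nat_sum)
    then have "real (card (bad k)) / real (card (Xs k)) \<le> (\<Sum>g\<in>B L. real (card {Q \<in> Xs k. \<phi> g ` Q \<notin> Xs k})) / real (card (Xs k))"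
      by (rule divide_right_mono) simp
    then show "norm (real (card (bad k)) / real (card (Xs k))) \<le> (\<Sum>g\<in>B L. real (card {Q \<in> Xs k. \<phi> g ` Q \<notin> Xs k}) / real (card (Xs k)))"
      by (simp add: sum_divide_distrib)
  qed
  then have "(\<lambda>k. - (real n * D * ln \<kappa>) - 2 * C * n * (real (card (bad k)) / real (card (Xs k)))) \<longlonglongrightarrow> - (real n * D * ln \<kappa>) - 2 * C * n * 0"
    by (intro tendsto_intros)
  then have "- (real n * D * ln \<kappa>) - 2 * C * n * 0 \<le> poly_trace G n a P"
    by (rule LIMSEQ_le_const2) (use ineq in auto)
  then show "- (real n * D * ln (real (N * D * c))) \<le> poly_trace G n a P" by (simp only: \<kappa>_def mult_zero_right diff_zero)
qed

section \<open>Algebraic numbers as integer matrices\<close>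

lemma int_repI:
  fixes m :: "nat \<Rightarrow> nat \<Rightarrow> int"
  assumes "\<And>s t. s < D \<Longrightarrow> t < D \<Longrightarrow> \<bar>m s t\<bar> \<le> int c"
    and "\<And>s. s < D \<Longrightarrow> (\<Sum>t<D. of_int (m s t) * \<omega> t) = z * \<omega> s"
  shows "z \<in> int_rep D \<omega> c"
  using assms unfolding int_rep_def by (intro CollectI exI[of _ m]) blast

lemma int_repE:
  assumes "z \<in> int_rep D \<omega> c"
  obtains m :: "nat \<Rightarrow> nat \<Rightarrow> int" where "\<And>s t. s < D \<Longrightarrow> t < D \<Longrightarrow> \<bar>m s t\<bar> \<le> int c"
    "\<And>s. s < D \<Longrightarrow> (\<Sum>t<D. of_int (m s t) * \<omega> t) = z * \<omega> s"
  using assms unfolding int_rep_def by blast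

lemma int_rep_mono:
  assumes z: "z \<in> int_rep D \<omega> c" and "c \<le> c'"
  shows "z \<in> int_rep D \<omega> c'"
proof -
  obtain m :: "nat \<Rightarrow> nat \<Rightarrow> int" where m: "\<And>s t. s < D \<Longrightarrow> t < D \<Longrightarrow> \<bar>m s t\<bar> \<le> int c"
    "\<And>s. s < D \<Longrightarrow> (\<Sum>t<D. of_int (m s t) * \<omega> t) = z * \<omega> s"
    using int_repE[OF z] by blast
  have "\<bar>m s t\<bar> \<le> int c'" if "s < D" "t < D" for s t using m(1)[OF that] assms(2) by linarith
  then show ?thesis using m(2) by (rule int_repI)
qed

lemma int_rep_uniform:
  assumes "finite Z" "\<And>z. z \<in> Z \<Longrightarrow> \<exists>c. z \<in> int_rep D \<omega> c"
  obtains c where "0 < c" "\<And>z. z \<in> Z \<Longrightarrow> z \<in> int_rep D \<omega> c"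
proof -
  obtain C where C: "\<And>z. z \<in> Z \<Longrightarrow> z \<in> int_rep D \<omega> (C z)" using assms(2) by metis
  show thesis
  proof (rule that[of "Suc (\<Sum>z\<in>Z. C z)"])
    fix z assume z: "z \<in> Z"
    have "C z \<le> (\<Sum>z\<in>Z. C z)" using z assms(1) by (intro member_le_sum) auto
    then show "z \<in> int_rep D \<omega> (Suc (\<Sum>z\<in>Z. C z))" by (intro int_rep_mono[OF C[OF z]]) simp
  qed simp
qed

lemma int_rep_affine:
  assumes "z \<in> int_rep D \<omega> c" "\<bar>q\<bar> * int c + \<bar>p\<bar> \<le> int c'"
  shows "of_int q * z - of_int p \<in> int_rep D \<omega> c'"
proof -
  obtain m :: "nat \<Rightarrow> nat \<Rightarrow> int" where m: "\<And>s t. s < D \<Longrightarrow> t < D \<Longrightarrow> \<bar>m s t\<bar> \<le> int c"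
    "\<And>s. s < D \<Longrightarrow> (\<Sum>t<D. of_int (m s t) * \<omega> t) = z * \<omega> s"
    using assms(1) unfolding int_rep_def by blast
  let ?m = "\<lambda>s t. q * m s t - (if s = t then p else 0)"
  have "\<bar>?m s t\<bar> \<le> int c'" if "s < D" "t < D" for s t
  proof -
    have "\<bar>?m s t\<bar> \<le> \<bar>q\<bar> * \<bar>m s t\<bar> + \<bar>p\<bar>" by (simp flip: abs_mult) linarith
    also have "\<dots> \<le> \<bar>q\<bar> * int c + \<bar>p\<bar>" using m(1)[OF that] by (intro add_mono mult_left_mono) auto
    finally show ?thesis using assms(2) by linarith
  qed
  moreover have "(\<Sum>t<D. of_int (?m s t) * \<omega> t) = (of_int q * z - of_int p) * \<omega> s" if s: "s < D" for s
  proof -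
    have "(\<Sum>t<D. of_int (?m s t) * \<omega> t) = (\<Sum>t<D. of_int q * (of_int (m s t) * \<omega> t) - (if s = t then of_int p * \<omega> t else 0))"
      by (intro sum.cong) (auto simp: algebra_simps)
    also have "\<dots> = of_int q * (\<Sum>t<D. of_int (m s t) * \<omega> t) - of_int p * \<omega> s"
      using s by (simp add: sum_subtractf sum_distrib_left)
    finally show ?thesis using m(2)[OF s] by (simp add: algebra_simps)
  qed
  ultimately show ?thesis by (rule int_repI)
qed

lemma int_rep_mult:
  assumes "z \<in> int_rep D \<omega> c" "z' \<in> int_rep D \<omega> c'"
  shows "z * z' \<in> int_rep D \<omega> (D * (c * c'))"
proof -
  obtain m :: "nat \<Rightarrow> nat \<Rightarrow> int" where m: "\<And>s t. s < D \<Longrightarrow> t < D \<Longrightarrow> \<bar>m s t\<bar> \<le> int c"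
    "\<And>s. s < D \<Longrightarrow> (\<Sum>t<D. of_int (m s t) * \<omega> t) = z * \<omega> s"
    using int_repE[OF assms(1)] by blast
  obtain m' :: "nat \<Rightarrow> nat \<Rightarrow> int" where m': "\<And>s t. s < D \<Longrightarrow> t < D \<Longrightarrow> \<bar>m' s t\<bar> \<le> int c'"
    "\<And>s. s < D \<Longrightarrow> (\<Sum>t<D. of_int (m' s t) * \<omega> t) = z' * \<omega> s"
    using int_repE[OF assms(2)] by blast
  let ?m = "\<lambda>s t. \<Sum>u<D. m s u * m' u t"
  have "\<bar>?m s t\<bar> \<le> int (D * (c * c'))" if "s < D" "t < D" for s t
  proof -
    have "\<bar>?m s t\<bar> \<le> (\<Sum>u<D. \<bar>m s u * m' u t\<bar>)" by (rule sum_abs)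
    also have "\<dots> \<le> (\<Sum>u<D. int c * int c')" unfolding abs_mult using m m' that by (intro sum_mono mult_mono) auto
    finally show ?thesis by simp
  qed
  moreover have "(\<Sum>t<D. of_int (?m s t) * \<omega> t) = z * z' * \<omega> s" if s: "s < D" for s
  proof -
    have "(\<Sum>t<D. of_int (?m s t) * \<omega> t) = (\<Sum>t<D. \<Sum>u<D. of_int (m s u) * (of_int (m' u t) * \<omega> t))"
      by (simp add: sum_distrib_right mult.assoc)
    also have "\<dots> = (\<Sum>u<D. \<Sum>t<D. of_int (m s u) * (of_int (m' u t) * \<omega> t))" by (rule sum.swap)
    also have "\<dots> = (\<Sum>u<D. of_int (m s u) * (z' * \<omega> u))" by (simp add: m'(2) flip: sum_distrib_left)
    also have "\<dots> = z' * (\<Sum>u<D. of_int (m s u) * \<omega> u)" by (simp add: sum_distrib_left mult_ac)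
    finally show ?thesis using m(2)[OF s] by (simp add: mult_ac)
  qed
  ultimately show ?thesis by (rule int_repI)
qed

text \<open>
  For a zero of a polynomial with leading coefficient \<open>a\<^sub>d\<close>, multiplication by \<open>a\<^sub>d z\<close> maps each of \<open>1, z, \<dots>, z ^ (d - 1)\<close>
  to an integral combination of these powers, through \<open>a\<^sub>d\<close> times the companion matrix.
\<close>

lemma algebraic_multiple_int_rep:
  fixes z :: complex
  assumes "algebraic z"
  obtains s D c :: nat and \<omega> where "0 < s" "0 < D" "\<omega> 0 = 1" "of_nat s * z \<in> int_rep D \<omega> c"
proof -
  obtain p where p: "\<And>i. coeff p i \<in> \<int>" "p \<noteq> 0" "poly p z = 0" using assms unfolding algebraic_def by blast
  have "\<exists>a :: int. coeff p i = of_int a" for i using p(1)[of i] by (auto elim: Ints_cases)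
  then obtain a :: "nat \<Rightarrow> int" where a: "\<And>i. coeff p i = of_int (a i)" by metis
  define d where "d = degree p"
  have d: "0 < d"
  proof (rule ccontr)
    assume "\<not> 0 < d"
    then obtain k where "p = [:k:]" unfolding d_def by (metis degree_eq_zeroE gr0I)
    then show False using p(2,3) by simp
  qed
  have ad: "a d \<noteq> 0" using p(2) a[of d] by (auto simp: d_def)
  have root: "of_int (a d) * z ^ d = - (\<Sum>t<d. of_int (a t) * z ^ t)"
  proof -
    have "0 = (\<Sum>t\<le>d. of_int (a t) * z ^ t)" using p(3) by (simp add: poly_altdef a d_def)
    also have "\<dots> = (\<Sum>t<d. of_int (a t) * z ^ t) + of_int (a d) * z ^ d" by (simp flip: lessThan_Suc_atMost)
    finally show ?thesis by (simp add: eq_neg_iff_add_eq_0 add.commute)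
  qed
  define m where "m s t = (if Suc s < d then (if t = Suc s then a d else 0) else - a t)" for s t
  define c where "c = nat (\<Sum>t\<le>d. \<bar>a t\<bar>)"
  have c: "\<bar>a t\<bar> \<le> int c" if "t \<le> d" for t
  proof -
    have "\<bar>a t\<bar> \<le> (\<Sum>t\<le>d. \<bar>a t\<bar>)" using that by (intro member_le_sum) auto
    then show ?thesis by (simp add: c_def)
  qed
  have "of_int (a d) * z \<in> int_rep d (\<lambda>t. z ^ t) c"
    unfolding int_rep_def
  proof (intro CollectI exI[of _ m] conjI allI impI)
    fix s t assume "s < d" "t < d"
    then show "\<bar>m s t\<bar> \<le> int c" using c[of d] c[of t] by (simp add: m_def)
  next
    fix s assume s: "s < d"
    show "(\<Sum>t<d. of_int (m s t) * z ^ t) = of_int (a d) * z * z ^ s"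
    proof (cases "Suc s < d")
      case True
      then have "(\<Sum>t<d. of_int (m s t) * z ^ t) = (\<Sum>t<d. if t = Suc s then of_int (a d) * z ^ t else 0)"
        by (intro sum.cong) (auto simp: m_def)
      then show ?thesis using True by simp
    next
      case False
      then have sd: "d = Suc s" using s by simp
      have "(\<Sum>t<d. of_int (m s t) * z ^ t) = - (\<Sum>t<d. of_int (a t) * z ^ t)" using False by (simp add: m_def sum_negf)
      also have "\<dots> = of_int (a d) * z ^ d" by (simp only: root)
      finally show ?thesis by (simp add: sd mult.assoc)
    qed
  qed
  from int_rep_affine[OF this, of "sgn (a d)" 0 "c"]
  have "of_int (sgn (a d)) * (of_int (a d) * z) \<in> int_rep d (\<lambda>t. z ^ t) c" using ad by (simp add: abs_sgn_eq)
  moreover have "of_int (sgn (a d)) * (of_int (a d) * z) = of_nat (nat \<bar>a d\<bar>) * z"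
    by (cases "a d \<ge> 0") (auto simp: sgn_if)
  ultimately show thesis using that[of "nat \<bar>a d\<bar>" d "\<lambda>t. z ^ t" c] ad d by simp
qed

lemma div_mod_less_mult:
  fixes s D1 D2 :: nat
  assumes "s < D1 * D2"
  shows "s div D2 < D1" "s mod D2 < D2"
  using assms by (simp add: less_mult_imp_div_less, cases D2) auto

text \<open>
  The Kronecker product with an identity matrix acts on \<open>\<omega>1 \<otimes> \<omega>2\<close>, so that two numbers with different
  representing vectors can be represented on the same one.
\<close>

lemma int_rep_tensor_left:
  assumes "z \<in> int_rep D1 \<omega>1 c"
  shows "z \<in> int_rep (D1 * D2) (\<lambda>t. \<omega>1 (t div D2) * \<omega>2 (t mod D2)) c"
proof -
  obtain m :: "nat \<Rightarrow> nat \<Rightarrow> int" where m: "\<And>s t. s < D1 \<Longrightarrow> t < D1 \<Longrightarrow> \<bar>m s t\<bar> \<le> int c"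
    "\<And>s. s < D1 \<Longrightarrow> (\<Sum>t<D1. of_int (m s t) * \<omega>1 t) = z * \<omega>1 s"
    using assms unfolding int_rep_def by blast
  let ?m = "\<lambda>s t. if s mod D2 = t mod D2 then m (s div D2) (t div D2) else 0"
  have "(\<Sum>t<D1 * D2. of_int (?m s t) * (\<omega>1 (t div D2) * \<omega>2 (t mod D2))) = z * (\<omega>1 (s div D2) * \<omega>2 (s mod D2))"
    if s: "s < D1 * D2" for s
  proof -
    note sd = div_mod_less_mult[OF s]
    have "(\<Sum>t<D1 * D2. of_int (?m s t) * (\<omega>1 (t div D2) * \<omega>2 (t mod D2)))
       = (\<Sum>t<D1. \<Sum>j<D2. if j = s mod D2 then of_int (m (s div D2) t) * \<omega>1 t * \<omega>2 j else 0)"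
      unfolding sum_lessThan_mult by (intro sum.cong refl) auto
    also have "\<dots> = (\<Sum>t<D1. of_int (m (s div D2) t) * \<omega>1 t) * \<omega>2 (s mod D2)"
      using sd by (simp add: sum_distrib_right)
    finally show ?thesis using m(2)[OF sd(1)] by (simp add: mult.assoc)
  qed
  then show ?thesis
  proof (rule int_repI[rotated])
    fix s t assume that: "s < D1 * D2" "t < D1 * D2"
    show "\<bar>?m s t\<bar> \<le> int c"
      using m(1)[OF div_mod_less_mult(1)[OF that(1)] div_mod_less_mult(1)[OF that(2)]] by simp
  qed
qed

lemma int_rep_tensor_right:
  assumes "z \<in> int_rep D2 \<omega>2 c"
  shows "z \<in> int_rep (D1 * D2) (\<lambda>t. \<omega>1 (t div D2) * \<omega>2 (t mod D2)) c"
proof -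
  obtain m :: "nat \<Rightarrow> nat \<Rightarrow> int" where m: "\<And>s t. s < D2 \<Longrightarrow> t < D2 \<Longrightarrow> \<bar>m s t\<bar> \<le> int c"
    "\<And>s. s < D2 \<Longrightarrow> (\<Sum>t<D2. of_int (m s t) * \<omega>2 t) = z * \<omega>2 s"
    using assms unfolding int_rep_def by blast
  let ?m = "\<lambda>s t. if s div D2 = t div D2 then m (s mod D2) (t mod D2) else 0"
  have "(\<Sum>t<D1 * D2. of_int (?m s t) * (\<omega>1 (t div D2) * \<omega>2 (t mod D2))) = z * (\<omega>1 (s div D2) * \<omega>2 (s mod D2))"
    if s: "s < D1 * D2" for s
  proof -
    note sd = div_mod_less_mult[OF s]
    have "(\<Sum>t<D1 * D2. of_int (?m s t) * (\<omega>1 (t div D2) * \<omega>2 (t mod D2)))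
       = (\<Sum>t<D1. \<Sum>j<D2. if t = s div D2 then of_int (m (s mod D2) j) * \<omega>2 j * \<omega>1 t else 0)"
      unfolding sum_lessThan_mult by (intro sum.cong refl) (auto simp: mult_ac)
    also have "\<dots> = (\<Sum>t<D1. if t = s div D2 then (\<Sum>j<D2. of_int (m (s mod D2) j) * \<omega>2 j) * \<omega>1 t else 0)"
      by (rule sum.cong[OF refl]) (simp add: sum_distrib_right)
    also have "\<dots> = (\<Sum>j<D2. of_int (m (s mod D2) j) * \<omega>2 j) * \<omega>1 (s div D2)"
      using sd by simp
    finally show ?thesis using m(2)[OF sd(2)] by (simp add: mult_ac)
  qed
  then show ?thesis
  proof (rule int_repI[rotated])
    fix s t assume that: "s < D1 * D2" "t < D1 * D2"
    show "\<bar>?m s t\<bar> \<le> int c"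
      using m(1)[OF div_mod_less_mult(2)[OF that(1)] div_mod_less_mult(2)[OF that(2)]] by simp
  qed
qed

lemma int_rep_of_nat_mult: "z \<in> int_rep D \<omega> c \<Longrightarrow> of_nat k * z \<in> int_rep D \<omega> (k * c)"
  using int_rep_affine[of z D \<omega> c "int k" 0 "k * c"] by simp

lemma finite_algebraic_int_rep:
  fixes Z :: "complex set"
  assumes "finite Z" "\<And>z. z \<in> Z \<Longrightarrow> algebraic z"
  shows "\<exists>(s :: nat) D \<omega>. 0 < s \<and> 0 < D \<and> \<omega> 0 = 1 \<and> (\<forall>z\<in>Z. \<exists>c. of_nat s * z \<in> int_rep D \<omega> c)"
  using assms
proof (induction Z)
  case empty
  show ?case by (intro exI[of _ 1] exI[of _ "\<lambda>_. 1"]) simp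
next
  case (insert x Z)
  then obtain s1 D1 :: nat and \<omega>1 where 1: "0 < s1" "0 < D1" "\<omega>1 0 = 1" "\<And>z. z \<in> Z \<Longrightarrow> \<exists>c. of_nat s1 * z \<in> int_rep D1 \<omega>1 c" by blast
  have "algebraic x" using insert.prems by simp
  then obtain s2 D2 c2 :: nat and \<omega>2 where 2: "0 < s2" "0 < D2" "\<omega>2 0 = 1" "of_nat s2 * x \<in> int_rep D2 \<omega>2 c2"
    by (rule algebraic_multiple_int_rep)
  let ?\<omega> = "\<lambda>t. \<omega>1 (t div D2) * \<omega>2 (t mod D2)"
  have "\<exists>c. of_nat (s1 * s2) * z \<in> int_rep (D1 * D2) ?\<omega> c" if "z \<in> insert x Z" for z
  proof (cases "z = x")
    case True
    have "of_nat s1 * (of_nat s2 * x) \<in> int_rep (D1 * D2) ?\<omega> (s1 * c2)"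
      by (rule int_rep_of_nat_mult, rule int_rep_tensor_right[OF 2(4)])
    then show ?thesis using True by (auto simp: mult.assoc)
  next
    case False
    then have "z \<in> Z" using that by simp
    then obtain c where "of_nat s1 * z \<in> int_rep D1 \<omega>1 c" using 1(4)[of z] by blast
    then have "of_nat s2 * (of_nat s1 * z) \<in> int_rep (D1 * D2) ?\<omega> (s2 * c)"
      by (intro int_rep_of_nat_mult int_rep_tensor_left)
    then show ?thesis by (auto simp: mult_ac)
  qed
  then show ?case using 1(1-3) 2(1-3) by (intro exI[of _ "s1 * s2"] exI[of _ "D1 * D2"] exI[of _ ?\<omega>]) simp
qed

section \<open>Liouville eigenvalues over an untwisted group ring\<close>

text \<open>
  The kernel \<open>a'\<close> coincides with \<open>q a - p\<close> on the invariant set \<open>V\<close> only. This restriction is needed because kernels of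
  convolution operators vanish outside the group and beyond the size of the matrix, where \<open>q a - p\<close> does not.
\<close>

lemma kpow_affine:
  fixes p q :: real
  assumes rf: "row_finite a" "row_finite a'"
    and V: "\<And>z y. z \<in> V \<Longrightarrow> a z y \<noteq> 0 \<Longrightarrow> y \<in> V"
    and a': "\<And>z y. z \<in> V \<Longrightarrow> a' z y = of_real q * a z y - (if z = y then of_real p else 0)"
    and z: "z \<in> V"
  shows "moment_functional (\<lambda>k. kpow a' k z w) P = moment_functional (\<lambda>k. kpow a k z w) (pcompose P [:-p, q:])"
  using z
proof (induction P arbitrary: z)
  case (pCons b P)
  let ?R = "pcompose P [:-p, q:]"
  define M where "M y = moment_functional (\<lambda>k. kpow a k y w) ?R" for y
  define Y where "Y = insert z ({y. a z y \<noteq> 0} \<union> {y. a' z y \<noteq> 0})"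
  have Y: "finite Y" using rf by (auto simp: Y_def row_finite_def)
  have YV: "y \<in> V" if "a' z y \<noteq> 0" for y
    using V[OF pCons.prems, of y] a'[OF pCons.prems, of y] pCons.prems that by (cases "z = y"; cases "a z y = 0") auto
  have "moment_functional (\<lambda>k. kpow a' k z w) (pCons b P)
      = of_real b * kpow a 0 z w + (\<Sum>y | a' z y \<noteq> 0. a' z y * moment_functional (\<lambda>k. kpow a' k y w) P)"
    by (simp add: moment_functional_pCons moment_functional_sum moment_functional_cmult)
  also have "(\<Sum>y | a' z y \<noteq> 0. a' z y * moment_functional (\<lambda>k. kpow a' k y w) P) = (\<Sum>y | a' z y \<noteq> 0. a' z y * M y)"
    unfolding M_def using pCons.IH YV by (intro sum.cong) auto
  also have "\<dots> = (\<Sum>y\<in>Y. a' z y * M y)" using Y by (intro sum.mono_neutral_left) (auto simp: Y_def)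
  also have "\<dots> = (\<Sum>y\<in>Y. of_real q * (a z y * M y) - (if z = y then of_real p * M y else 0))"
    by (intro sum.cong refl) (simp add: a'[OF pCons.prems] left_diff_distrib mult.assoc)
  also have "\<dots> = of_real q * (\<Sum>y\<in>Y. a z y * M y) - of_real p * M z"
    using Y by (simp add: sum_subtractf sum_distrib_left Y_def)
  also have "(\<Sum>y\<in>Y. a z y * M y) = (\<Sum>y | a z y \<noteq> 0. a z y * M y)"
    using Y by (intro sum.mono_neutral_right) (auto simp: Y_def)
  also have "\<dots> = moment_functional (\<lambda>k. kpow a k z w) (pCons 0 ?R)"
    by (simp add: M_def moment_functional_pCons moment_functional_sum moment_functional_cmult)
  finally have "moment_functional (\<lambda>k. kpow a' k z w) (pCons b P)
      = of_real b * kpow a 0 z w + (of_real q * moment_functional (\<lambda>k. kpow a k z w) (pCons 0 ?R) - of_real p * M z)" .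
  also have "\<dots> = moment_functional (\<lambda>k. kpow a k z w) ([:b:] + (Polynomial.smult q (pCons 0 ?R) + Polynomial.smult (-p) ?R))"
    unfolding moment_functional_add moment_functional_smult M_def moment_functional_pCons[of _ b 0] by simp
  also have "[:b:] + (Polynomial.smult q (pCons 0 ?R) + Polynomial.smult (-p) ?R) = pcompose (pCons b P) [:-p, q:]"
    by (simp add: pcompose_pCons)
  finally show ?case .
qed simp

text \<open>
  Right translations commute with convolution from the left.
\<close>

lemma spectral_translate:
  assumes G: "group G" and a: "hermitian_coeffs G n D \<omega> c N a" and x: "x \<in> carrier G"
  shows "spectral (conv_kernel G a) (i, x) P = spectral (conv_kernel G a) (i, \<one>\<^bsub>G\<^esub>) P"
proof (rule spectral_local_cong)
  interpret group G by fact
  fix k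
  let ?\<theta> = "\<lambda>(j :: nat, y). (j, y \<otimes>\<^bsub>G\<^esub> x)"
  have "kpow (conv_kernel G a) k (?\<theta> (i, \<one>\<^bsub>G\<^esub>)) (?\<theta> (i, \<one>\<^bsub>G\<^esub>)) = kpow (conv_kernel G a) k (i, \<one>\<^bsub>G\<^esub>) (i, \<one>\<^bsub>G\<^esub>)"
  proof (rule kpow_local_iso[where U = "\<lambda>_. UNIV \<times> carrier G"])
    fix m and z assume "z \<in> (UNIV :: nat set) \<times> carrier G"
    then obtain j y where z: "z = (j, y)" "y \<in> carrier G" by auto
    have yx: "y \<otimes>\<^bsub>G\<^esub> x \<in> carrier G" using z x by simp
    note row = conv_kernel_row[where a = a and i = j, OF G z(2) hermitian_coeffs_support[OF a]]
    note row' = conv_kernel_row[where a = a and i = j, OF G yx hermitian_coeffs_support[OF a]]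
    have assoc: "inv\<^bsub>G\<^esub> g \<otimes>\<^bsub>G\<^esub> (y \<otimes>\<^bsub>G\<^esub> x) = inv\<^bsub>G\<^esub> g \<otimes>\<^bsub>G\<^esub> y \<otimes>\<^bsub>G\<^esub> x" if "g \<in> carrier G" for g
      using that z(2) x by (simp add: m_assoc)
    show "{y'. conv_kernel G a (?\<theta> z) y' \<noteq> 0} = ?\<theta> ` {y. conv_kernel G a z y \<noteq> 0}"
      unfolding z(1) prod.case row(1) row'(1) image_image
      using assoc hermitian_coeffsD(3)[OF a] by (intro image_cong) auto
    fix w assume "conv_kernel G a z w \<noteq> 0"
    then have "w \<in> {w. conv_kernel G a (j, y) w \<noteq> 0}" by (simp add: z(1))
    then obtain j' g where w: "w = (j', inv\<^bsub>G\<^esub> g \<otimes>\<^bsub>G\<^esub> y)" "a j j' g \<noteq> 0" unfolding row(1) by auto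
    have g: "g \<in> carrier G" by (rule hermitian_coeffsD(3)[OF a w(2)])
    show "w \<in> UNIV \<times> carrier G \<and> conv_kernel G a (?\<theta> z) (?\<theta> w) = conv_kernel G a z w"
      using row(2)[OF g, of j'] row'(2)[OF g, of j'] g z(2) by (simp add: w(1) z(1) assoc)
  next
    show "inj_on ?\<theta> (UNIV \<times> carrier G)" using x by (auto simp: inj_on_def)
  qed auto
  then show "kpow (conv_kernel G a) k (i, x) (i, x) = kpow (conv_kernel G a) k (i, \<one>\<^bsub>G\<^esub>) (i, \<one>\<^bsub>G\<^esub>)" using x by simp
qed

text \<open>
  Apply the bound to \<open>q a - p\<close>: its coefficients have height at most \<open>q * (c + r)\<close> with \<open>\<bar>l\<bar> + 1 \<le> r\<close>, and a row
  has at most one more nonzero entry than in \<open>a\<close>. The trace of \<open>a\<close> therefore satisfies the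
  hypothesis of \<open>liouville_no_atom\<close> on logarithms, and the eigenvector provides the atom.
\<close>

lemma det_bound_no_liouville_eigenvalue:
  assumes det: "det_bound G" and D: "0 < D" "\<omega> 0 = 1" and c: "0 < c" and N: "0 < N" and a: "hermitian_coeffs G n D \<omega> c N a"
    and eig: "\<And>z. (\<Sum>y | conv_kernel G a z y \<noteq> 0. conv_kernel G a z y * f y) = of_real l * f z"
    and bounded: "\<And>Z. finite Z \<Longrightarrow> (\<Sum>z\<in>Z. (norm (f z))\<^sup>2) \<le> S"
    and nz: "f (i0, x0) \<noteq> 0" "i0 < n" "x0 \<in> carrier G"
  shows "\<not> liouville_number l"
proof
  assume L: "liouville_number l"
  have G: "group G" using det by (simp add: det_bound_def)
  interpret group G by fact
  let ?K = "conv_kernel G a"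
  have herm: "hermitian_kernel ?K" by (rule conv_kernel_hermitian[OF G a])
  have rb: "row_bound (real (N * D * c)) ?K" by (rule conv_kernel_row_bound[where \<omega> = \<omega>, OF G a D])
  then have rf: "row_finite ?K" by (simp add: row_bound_def)
  define \<Lambda> where "\<Lambda> P = (\<Sum>i<n. spectral ?K (i, \<one>\<^bsub>G\<^esub>) P)" for P
  define r where "r = nat \<lceil>\<bar>l\<bar>\<rceil> + 1"
  have r: "\<bar>l\<bar> + 1 \<le> real r" unfolding r_def by linarith
  define c1 where "c1 = c + r"
  define k0 where "k0 = (N + 1) * D * c1"
  define K where "K = real k0 + \<bar>l\<bar> + 1"
  have Nk: "N * D * c \<le> k0" unfolding k0_def c1_def by (intro mult_le_mono) auto
  have k0: "0 < k0" using D c by (simp add: k0_def c1_def)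
  have K: "real (N * D * c) \<le> K" "0 < K" "\<bar>l\<bar> + 1 \<le> K" using Nk k0 by (auto simp: K_def simp del: of_nat_mult)
  have S: "0 < S"
  proof -
    have "0 < (norm (f (i0, x0)))\<^sup>2" using nz by simp
    also have "\<dots> \<le> S" using bounded[of "{(i0, x0)}"] by simp
    finally show ?thesis .
  qed
  show False
  proof (rule liouville_no_atom[where \<Lambda> = \<Lambda> and K = K and l = l and c = "(norm (f (i0, x0)))\<^sup>2 / S" and E = "real n * D" and F = "ln k0"])
    show "\<Lambda> (P + Q) = \<Lambda> P + \<Lambda> Q" for P Q by (simp add: \<Lambda>_def spectral_linear sum.distrib)
    show "\<Lambda> (Polynomial.smult t P) = t * \<Lambda> P" for t P by (simp add: \<Lambda>_def spectral_linear sum_distrib_left)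
    show "0 \<le> \<Lambda> P" if "\<And>x. \<bar>x\<bar> \<le> K \<Longrightarrow> 0 \<le> poly P x" for P
      unfolding \<Lambda>_def by (intro sum_nonneg spectral_nonneg[OF rb herm K(1,2) that])
    show "\<bar>l\<bar> + 1 \<le> K" by (rule K(3))
    show "(norm (f (i0, x0)))\<^sup>2 / S > 0" using nz S by simp
    show "(norm (f (i0, x0)))\<^sup>2 / S * (poly Q l)\<^sup>2 \<le> \<Lambda> (Q * Q)" for Q
    proof -
      have "(norm (f (i0, x0)))\<^sup>2 * (poly Q l)\<^sup>2 \<le> S * spectral ?K (i0, x0) (Q * Q)"
        by (rule spectral_atom[OF rf herm eig bounded])
      also have "spectral ?K (i0, x0) (Q * Q) = spectral ?K (i0, \<one>\<^bsub>G\<^esub>) (Q * Q)"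
        by (rule spectral_translate[OF G a nz(3)])
      also have "S * \<dots> \<le> S * \<Lambda> (Q * Q)"
        unfolding \<Lambda>_def
      proof (intro mult_left_mono member_le_sum)
        show "0 \<le> spectral ?K (i, \<one>\<^bsub>G\<^esub>) (Q * Q)" for i
          by (rule spectral_nonneg[OF rb herm K(1,2)]) simp
      qed (use nz S in auto)
      finally show ?thesis using S by (simp add: field_simps)
    qed
    show "real n * D \<ge> 0" by simp
    show "0 \<le> ln (real k0)" using k0 by simp
    show "\<exists>p q :: int. q > 1 \<and> 0 < \<bar>of_int q * l - of_int p\<bar> \<and> \<bar>of_int q * l - of_int p\<bar> < 1 / of_int q ^ m" for m
    proof -
      obtain p q :: int where pq: "q > 1" "0 < \<bar>l - of_int p / of_int q\<bar>" "\<bar>l - of_int p / of_int q\<bar> < 1 / of_int q ^ Suc m"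
        using L[unfolded liouville_number_def, rule_format, of "Suc m"] by auto
      have "of_int q * \<bar>l - of_int p / of_int q\<bar> < of_int q * (1 / of_int q ^ Suc m)"
        using pq by (intro mult_strict_left_mono) auto
      also have "\<dots> = 1 / of_int q ^ m" using pq(1) by simp
      finally show ?thesis using pq(1,2) by (intro exI[of _ p] exI[of _ q]) (simp add: abs_of_int_mult_minus)
    qed
    fix p q :: int and P :: "real poly"
    assume q: "q > 1" and pq: "\<bar>of_int q * l - of_int p\<bar> \<le> 1" and P0: "0 \<le> poly P (of_int p / of_int q)"
      and Pl: "\<And>x. \<bar>x\<bar> \<le> K \<Longrightarrow> of_int q * x - of_int p \<noteq> 0 \<Longrightarrow> ln \<bar>of_int q * x - of_int p\<bar> \<le> poly P x"
    have p_le: "\<bar>of_int p\<bar> \<le> of_int q * (\<bar>l\<bar> + 1)"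
    proof -
      have "\<bar>of_int p\<bar> \<le> \<bar>of_int q * l\<bar> + 1" using pq by linarith
      also have "\<dots> \<le> of_int q * \<bar>l\<bar> + of_int q" using q by (simp add: abs_mult)
      finally show ?thesis by (simp add: algebra_simps)
    qed
    \<comment> \<open>In the variable \<open>y = q x - p\<close> the polynomial \<open>P\<close> becomes a majorant of \<open>ln \<bar>y\<bar>\<close>.\<close>
    define Q where "Q = pcompose P [:of_int p / of_int q, 1 / of_int q:]"
    have QP: "pcompose Q [:- of_int p, of_int q:] = P"
    proof -
      have "poly (pcompose Q [:- of_int p, of_int q:]) x = poly P x" for x
        using q by (simp add: Q_def poly_pcompose field_simps)
      then show ?thesis by (simp add: poly_eq_poly_eq_iff[symmetric] fun_eq_iff)
    qed
    define b where "b i j g = of_int q * a i j g - (if i = j \<and> i < n \<and> g = \<one>\<^bsub>G\<^esub> then of_int p else 0)" for i j g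
    define c' where "c' = nat q * c1"
    have c': "\<bar>q\<bar> * int c + \<bar>p\<bar> \<le> int c'"
    proof -
      have "real_of_int (\<bar>q\<bar> * int c + \<bar>p\<bar>) \<le> of_int q * real c + of_int q * real r"
      proof -
        have "real_of_int q * (\<bar>l\<bar> + 1) \<le> real_of_int q * real r" using r q by (intro mult_left_mono) auto
        then have "\<bar>of_int p\<bar> \<le> real_of_int q * real r" using p_le by linarith
        then show ?thesis using q by simp
      qed
      also have "\<dots> = real_of_int (int c')" using q by (simp add: c'_def c1_def algebra_simps)
      finally show ?thesis by (simp only: of_int_le_iff)
    qed
    have b: "hermitian_coeffs G n D \<omega> c' (N + 1) b"
      unfolding hermitian_coeffs_def
    proof (intro conjI allI impI ballI)
      fix i j g assume "b i j g \<noteq> 0"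
      then have "a i j g \<noteq> 0 \<or> (i = j \<and> i < n \<and> g = \<one>\<^bsub>G\<^esub>)" by (auto simp: b_def split: if_splits)
      then show "i < n" "j < n" "g \<in> carrier G" using hermitian_coeffsD(1-3)[OF a, of i j g] by auto
    next
      fix i
      have sub: "{(j, g). b i j g \<noteq> 0} \<subseteq> insert (i, \<one>\<^bsub>G\<^esub>) {(j, g). a i j g \<noteq> 0}" by (auto simp: b_def)
      have fin: "finite (insert (i, \<one>\<^bsub>G\<^esub>) {(j, g). a i j g \<noteq> 0})" using hermitian_coeffsD(4)[OF a] by simp
      show "finite {(j, g). b i j g \<noteq> 0}" by (rule finite_subset[OF sub fin])
      have "card {(j, g). b i j g \<noteq> 0} \<le> card (insert (i, \<one>\<^bsub>G\<^esub>) {(j, g). a i j g \<noteq> 0})" by (rule card_mono[OF fin sub])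
      also have "\<dots> \<le> Suc (card {(j, g). a i j g \<noteq> 0})" by (rule card_insert_le_m1[OF zero_less_Suc]) simp
      also have "\<dots> \<le> N + 1" using hermitian_coeffsD(5)[OF a, of i] by simp
      finally show "card {(j, g). b i j g \<noteq> 0} \<le> N + 1" .
    next
      fix i j g assume g: "g \<in> carrier G"
      have "inv\<^bsub>G\<^esub> g = \<one>\<^bsub>G\<^esub> \<longleftrightarrow> g = \<one>\<^bsub>G\<^esub>" using g by (metis inv_one inv_inv)
      then show "b j i (inv\<^bsub>G\<^esub> g) = cnj (b i j g)" using hermitian_coeffsD(6)[OF a g, of j i] by (auto simp: b_def)
    next
      fix i j g
      have "of_int q * a i j g - of_int (if i = j \<and> i < n \<and> g = \<one>\<^bsub>G\<^esub> then p else 0) \<in> int_rep D \<omega> c'"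
        by (rule int_rep_affine[OF hermitian_coeffsD(7)[OF a]]) (use c' in auto)
      then show "b i j g \<in> int_rep D \<omega> c'" by (simp add: b_def if_distrib cong: if_cong)
    qed
    have c'0: "0 < c'" using q c by (simp add: c'_def c1_def)
    have k': "real ((N + 1) * D * c') = real_of_int q * real k0" using q by (simp add: c'_def k0_def)
    have maj: "log_majorant (real ((N + 1) * D * c')) Q"
      unfolding log_majorant_def k'
    proof (intro conjI allI impI)
      show "0 \<le> poly Q 0" using P0 by (simp add: Q_def poly_pcompose)
      fix y :: real assume y: "y \<noteq> 0 \<and> \<bar>y\<bar> \<le> real_of_int q * real k0"
      define x where "x = (y + of_int p) / of_int q"
      have qx: "of_int q * x - of_int p = y" using q by (simp add: x_def)
      have "\<bar>y + of_int p\<bar> \<le> real_of_int q * real k0 + real_of_int q * (\<bar>l\<bar> + 1)" using y p_le by linarith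
      then have "\<bar>x\<bar> \<le> K" using q by (simp add: x_def K_def field_simps)
      then have "ln \<bar>y\<bar> \<le> poly P x" using Pl[of x] y by (simp add: qx)
      then show "ln \<bar>y\<bar> \<le> poly Q y" by (simp add: Q_def poly_pcompose x_def add_divide_distrib add.commute)
    qed
    have "- (real n * D * ln (real ((N + 1) * D * c'))) \<le> poly_trace G n b Q"
      by (rule det_boundD[where \<omega> = \<omega>, OF det D c'0 _ b maj]) simp
    also have "poly_trace G n b Q = \<Lambda> P"
      unfolding poly_trace_def \<Lambda>_def spectral_def
    proof (rule sum.cong[OF refl], rule arg_cong[of _ _ Re])
      fix i assume i: "i \<in> {..<n}"
      have "moment_functional (\<lambda>k. kpow (conv_kernel G b) k (i, \<one>\<^bsub>G\<^esub>) (i, \<one>\<^bsub>G\<^esub>)) Q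
          = moment_functional (\<lambda>k. kpow ?K k (i, \<one>\<^bsub>G\<^esub>) (i, \<one>\<^bsub>G\<^esub>)) (pcompose Q [:- of_int p, of_int q:])"
      proof (rule kpow_affine[OF rf, where V = "{..<n} \<times> carrier G"])
        show "row_finite (conv_kernel G b)"
          using conv_kernel_row_bound[where \<omega> = \<omega>, OF G b D] by (simp add: row_bound_def)
        show "(i, \<one>\<^bsub>G\<^esub>) \<in> {..<n} \<times> carrier G" using i by simp
        fix z y assume z: "z \<in> {..<n} \<times> carrier G"
        show "y \<in> {..<n} \<times> carrier G" if "?K z y \<noteq> 0"
          using that hermitian_coeffsD(2)[OF a] by (cases z; cases y) (auto simp: conv_kernel_def split: if_splits)
        obtain i x j u where zy: "z = (i, x)" "y = (j, u)" by (cases z, cases y)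
        have x: "i < n" "x \<in> carrier G" using z by (auto simp: zy)
        show "conv_kernel G b z y = of_real (of_int q) * ?K z y - (if z = y then of_real (of_int p) else 0)"
        proof (cases "u \<in> carrier G")
          case True
          have "x \<otimes>\<^bsub>G\<^esub> inv\<^bsub>G\<^esub> u = \<one>\<^bsub>G\<^esub> \<longleftrightarrow> x = u"
            using x True by (metis inv_equality inv_inv r_inv inv_closed)
          then show ?thesis using x True by (auto simp: zy conv_kernel_def b_def)
        next
          case False
          then show ?thesis using x by (auto simp: zy conv_kernel_def)
        qed
      qed
      then show "moment_functional (\<lambda>k. kpow (conv_kernel G b) k (i, \<one>\<^bsub>G\<^esub>) (i, \<one>\<^bsub>G\<^esub>)) Q
          = moment_functional (\<lambda>k. kpow ?K k (i, \<one>\<^bsub>G\<^esub>) (i, \<one>\<^bsub>G\<^esub>)) P" by (simp only: QP)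
    qed
    finally have "- (real n * D * ln (real_of_int q * real k0)) \<le> \<Lambda> P" by (simp only: k')
    moreover have "ln (real_of_int q * real k0) = ln (real_of_int q) + ln (real k0)" using q k0 by (simp add: ln_mult_pos)
    ultimately show "- (real n * D * (ln (real_of_int q) + ln (real k0))) \<le> \<Lambda> P" by simp
  qed
qed

section \<open>The central extension of a rational multiplier\<close>

text \<open>
  The elements \<open>(g, z)\<close> represent \<open>\<zeta> ^ z g\<close> in the twisted group algebra, where the multiplier is \<open>\<zeta> ^ s g h\<close>.
\<close>

definition central_extension :: "'g monoid \<Rightarrow> nat \<Rightarrow> ('g \<Rightarrow> 'g \<Rightarrow> nat) \<Rightarrow> ('g \<times> nat) monoid" where
  "central_extension G r s = \<lparr>carrier = carrier G \<times> {..<r},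
     monoid.mult = (\<lambda>(g, z) (h, w). (g \<otimes>\<^bsub>G\<^esub> h, (z + w + s g h) mod r)), one = (\<one>\<^bsub>G\<^esub>, 0)\<rparr>"

text \<open>
  The cocycle identity is only required modulo \<open>r\<close>, because exponents of a root of unity of order \<open>r\<close> are
  determined modulo \<open>r\<close>. The exponents at the unit are normalized to \<open>0\<close> itself.
\<close>

locale rational_cocycle = group G for G :: "'g monoid" (structure) +
  fixes r :: nat and s :: "'g \<Rightarrow> 'g \<Rightarrow> nat"
  assumes r: "0 < r"
    and cocycle: "\<And>a b c. a \<in> carrier G \<Longrightarrow> b \<in> carrier G \<Longrightarrow> c \<in> carrier G \<Longrightarrow>
       (s b c + s a (b \<otimes> c)) mod r = (s (a \<otimes> b) c + s a b) mod r"
    and unit: "\<And>g. g \<in> carrier G \<Longrightarrow> s \<one> g = 0" "\<And>g. g \<in> carrier G \<Longrightarrow> s g \<one> = 0"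
begin

abbreviation E where "E \<equiv> central_extension G r s"

lemma E_simps: "carrier E = carrier G \<times> {..<r}" "(g, z) \<otimes>\<^bsub>E\<^esub> (h, w) = (g \<otimes> h, (z + w + s g h) mod r)" "\<one>\<^bsub>E\<^esub> = (\<one>, 0)"
  by (simp_all add: central_extension_def)

lemma complement_mod: "((r - k mod r) mod r + k) mod r = 0"
proof -
  have "((r - k mod r) mod r + k) mod r = (r - k mod r + k mod r) mod r" by (metis mod_add_left_eq mod_add_right_eq)
  also have "r - k mod r + k mod r = r" using r mod_less_divisor[of r k] by linarith
  finally show ?thesis by simp
qed

lemma group_E: "group E"
proof (rule groupI)
  fix x y assume "x \<in> carrier E" "y \<in> carrier E"
  then show "x \<otimes>\<^bsub>E\<^esub> y \<in> carrier E" using r by (cases x; cases y) (simp add: E_simps)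
next
  show "\<one>\<^bsub>E\<^esub> \<in> carrier E" using r by (simp add: E_simps)
next
  fix x y z assume "x \<in> carrier E" "y \<in> carrier E" "z \<in> carrier E"
  then obtain a u b v c w where e: "x = (a, u)" "y = (b, v)" "z = (c, w)" and
    c: "a \<in> carrier G" "b \<in> carrier G" "c \<in> carrier G" by (auto simp: E_simps)
  have "((u + v + s a b) mod r + w + s (a \<otimes> b) c) mod r = (u + v + w + (s (a \<otimes> b) c + s a b)) mod r"
    using mod_add_left_eq[of "u + v + s a b" r "w + s (a \<otimes> b) c"] by (simp only: add.assoc add.commute add.left_commute)
  also have "\<dots> = (u + v + w + (s (a \<otimes> b) c + s a b) mod r) mod r" by (rule mod_add_right_eq[symmetric])
  also have "\<dots> = (u + v + w + (s b c + s a (b \<otimes> c)) mod r) mod r" by (simp only: cocycle[OF c])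
  also have "\<dots> = (u + v + w + (s b c + s a (b \<otimes> c))) mod r" by (rule mod_add_right_eq)
  also have "\<dots> = (u + (v + w + s b c) mod r + s a (b \<otimes> c)) mod r"
    using mod_add_left_eq[of "v + w + s b c" r "u + s a (b \<otimes> c)"] by (simp only: add.assoc add.commute add.left_commute)
  finally show "x \<otimes>\<^bsub>E\<^esub> y \<otimes>\<^bsub>E\<^esub> z = x \<otimes>\<^bsub>E\<^esub> (y \<otimes>\<^bsub>E\<^esub> z)" using c by (simp add: e E_simps m_assoc)
next
  fix x assume "x \<in> carrier E"
  then obtain g z where x: "x = (g, z)" "g \<in> carrier G" "z < r" by (auto simp: E_simps)
  then show "\<one>\<^bsub>E\<^esub> \<otimes>\<^bsub>E\<^esub> x = x" by (simp add: E_simps unit)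
  have "(inv g, (r - (z + s (inv g) g) mod r) mod r) \<otimes>\<^bsub>E\<^esub> x = \<one>\<^bsub>E\<^esub>"
    using x complement_mod[of "z + s (inv g) g"] by (simp add: E_simps add.assoc)
  moreover have "(inv g, (r - (z + s (inv g) g) mod r) mod r) \<in> carrier E" using x r by (simp add: E_simps)
  ultimately show "\<exists>y\<in>carrier E. y \<otimes>\<^bsub>E\<^esub> x = \<one>\<^bsub>E\<^esub>" by blast
qed

lemma E_cyclic_extension: "cyclic_extension r E G"
  unfolding cyclic_extension_def
proof (intro conjI exI)
  show "group E" by (rule group_E)
  show "group G" by (rule group_axioms)
  have Z: "carrier (integer_mod_group r) = {0..<int r}" "x \<otimes>\<^bsub>integer_mod_group r\<^esub> y = (x + y) mod int r" for x y
    using r by (simp_all add: integer_mod_group_def)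
  let ?\<iota> = "\<lambda>k :: int. (\<one>, nat k)"
  show "?\<iota> \<in> hom (integer_mod_group r) E"
  proof (rule homI)
    fix x assume "x \<in> carrier (integer_mod_group r)"
    then show "?\<iota> x \<in> carrier E" by (auto simp: Z E_simps nat_less_iff)
    fix y assume "x \<in> carrier (integer_mod_group r)" "y \<in> carrier (integer_mod_group r)"
    then have "0 \<le> x" "0 \<le> y" by (auto simp: Z)
    then have "nat ((x + y) mod int r) = (nat x + nat y) mod r"
      by (simp add: nat_mod_distrib nat_add_distrib)
    then show "?\<iota> (x \<otimes>\<^bsub>integer_mod_group r\<^esub> y) = ?\<iota> x \<otimes>\<^bsub>E\<^esub> ?\<iota> y" by (simp add: Z E_simps unit)
  qed
  show "inj_on ?\<iota> (carrier (integer_mod_group r))" by (auto simp: inj_on_def Z eq_nat_nat_iff)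
  show "fst \<in> hom E G" by (rule homI) (auto simp: E_simps)
  show "fst ` carrier E = carrier G" using r by (force simp: E_simps image_iff)
  show "?\<iota> ` carrier (integer_mod_group r) = kernel E G fst"
  proof (intro equalityI subsetI)
    fix x assume "x \<in> kernel E G fst"
    then obtain z where "x = (\<one>, z)" "z < r" by (auto simp: kernel_def E_simps)
    then show "x \<in> ?\<iota> ` carrier (integer_mod_group r)" by (intro image_eqI[of _ _ "int z"]) (auto simp: Z)
  qed (auto simp: kernel_def E_simps Z nat_less_iff)
qed

text \<open>
  The second component of a quotient is given implicitly, by the equation it satisfies in \<open>\<int>\<^sub>r\<close>; this is the form in
  which it enters exponents of \<open>\<zeta>\<close>.
\<close>

lemma E_quotient:
  assumes "x \<in> carrier G" "z < r" "h \<in> carrier G" "w < r"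
  obtains u where "u < r" "(x, z) \<otimes>\<^bsub>E\<^esub> inv\<^bsub>E\<^esub> (h, w) = (x \<otimes> inv h, u)" "(u + w + s (x \<otimes> inv h) h) mod r = z"
proof -
  interpret E: group E by (rule group_E)
  have c: "(x, z) \<in> carrier E" "(h, w) \<in> carrier E" using assms by (simp_all add: E_simps)
  obtain g u where gu: "(x, z) \<otimes>\<^bsub>E\<^esub> inv\<^bsub>E\<^esub> (h, w) = (g, u)" by (cases "(x, z) \<otimes>\<^bsub>E\<^esub> inv\<^bsub>E\<^esub> (h, w)")
  have "(g, u) \<in> carrier E" using c by (simp flip: gu)
  then have g: "g \<in> carrier G" "u < r" by (simp_all add: E_simps)
  have "(g, u) \<otimes>\<^bsub>E\<^esub> (h, w) = (x, z)" using c by (simp add: E.m_assoc flip: gu)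
  then have 1: "g \<otimes> h = x" "(u + w + s g h) mod r = z" by (simp_all add: E_simps)
  then have "g = x \<otimes> inv h" using g(1) assms(3) by (simp add: inv_solve_right flip: 1(1))
  then show thesis using that[of u] gu g 1 by simp
qed

lemma E_inverse:
  assumes "g \<in> carrier G" "z < r"
  obtains w where "w < r" "inv\<^bsub>E\<^esub> (g, z) = (inv g, w)" "(w + z + s (inv g) g) mod r = 0"
proof -
  interpret E: group E by (rule group_E)
  have c: "(g, z) \<in> carrier E" using assms by (simp_all add: E_simps)
  obtain h w where hw: "inv\<^bsub>E\<^esub> (g, z) = (h, w)" by (cases "inv\<^bsub>E\<^esub> (g, z)")
  have "(h, w) \<in> carrier E" using c by (simp flip: hw)
  then have h: "h \<in> carrier G" "w < r" by (simp_all add: E_simps)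
  have "(h, w) \<otimes>\<^bsub>E\<^esub> (g, z) = \<one>\<^bsub>E\<^esub>" using c by (simp flip: hw)
  then have 1: "h \<otimes> g = \<one>" "(w + z + s h g) mod r = 0" by (simp_all add: E_simps)
  then have "h = inv g" using h(1) assms(1) by (simp add: inv_equality)
  then show thesis using that[of w] hw h 1 by simp
qed

end

text \<open>
  With \<open>\<zeta>\<close> a primitive root of unity of order \<open>r\<close>, every value of the multiplier is a power of \<open>\<zeta>\<close> with a unique
  exponent below \<open>r\<close>, and uniqueness turns the multiplicative cocycle identity into an additive one.
\<close>

lemma rational_multiplier_exponents:
  fixes G :: "'g monoid"
  assumes G: "group G" and \<sigma>: "rational_multiplier G \<sigma>"
  obtains r :: nat and \<zeta> :: complex and s where "0 < r" "\<zeta> ^ r = 1" "norm \<zeta> = 1"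
    "\<And>g h. g \<in> carrier G \<Longrightarrow> h \<in> carrier G \<Longrightarrow> \<sigma> g h = \<zeta> ^ s g h" "rational_cocycle G r s"
proof -
  interpret group G by fact
  obtain r where r: "0 < r" "\<And>a b. a \<in> carrier G \<Longrightarrow> b \<in> carrier G \<Longrightarrow> \<sigma> a b ^ r = 1"
    and mult: "multiplier G \<sigma>" using \<sigma> unfolding rational_multiplier_def by blast
  define \<zeta> where "\<zeta> = cis (2 * pi / r)"
  have pow: "\<zeta> ^ k = cis (2 * pi * k / r)" for k
  proof -
    have "\<zeta> ^ k = cis (real k * (2 * pi / r))" unfolding \<zeta>_def by (rule Complex.DeMoivre)
    then show ?thesis by (simp add: mult_ac)
  qed
  have \<zeta>r: "\<zeta> ^ r = 1" using r(1) by (simp add: pow)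
  have bij: "bij_betw (\<lambda>k. \<zeta> ^ k) {..<r} {z. z ^ r = 1}" unfolding pow by (rule Complex.bij_betw_roots_unity[OF r(1)])
  have pmod: "\<zeta> ^ (k mod r) = \<zeta> ^ k" for k
  proof -
    have "\<zeta> ^ k = \<zeta> ^ (r * (k div r) + k mod r)" by simp
    also have "\<dots> = \<zeta> ^ (k mod r)" by (simp only: power_add power_mult \<zeta>r power_one mult_1_left)
    finally show ?thesis by simp
  qed
  have "\<exists>k<r. \<sigma> g h = \<zeta> ^ k" if "g \<in> carrier G" "h \<in> carrier G" for g h
  proof -
    have "\<sigma> g h \<in> (\<lambda>k. \<zeta> ^ k) ` {..<r}" using r(2)[OF that] bij by (simp add: bij_betw_def)
    then show ?thesis by auto
  qed
  then obtain s where s: "\<And>g h. g \<in> carrier G \<Longrightarrow> h \<in> carrier G \<Longrightarrow> s g h < r \<and> \<sigma> g h = \<zeta> ^ s g h" by metis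
  have inj: "j mod r = k mod r" if "\<zeta> ^ j = \<zeta> ^ k" for j k
  proof -
    have "\<zeta> ^ (j mod r) = \<zeta> ^ (k mod r)" using that by (simp only: pmod)
    moreover have "j mod r \<in> {..<r}" "k mod r \<in> {..<r}" using r(1) by auto
    ultimately show ?thesis using bij unfolding bij_betw_def inj_on_def by blast
  qed
  have "rational_cocycle G r s"
  proof (intro rational_cocycle.intro rational_cocycle_axioms.intro G r(1))
    fix a b c assume c: "a \<in> carrier G" "b \<in> carrier G" "c \<in> carrier G"
    have "\<zeta> ^ (s b c + s a (b \<otimes>\<^bsub>G\<^esub> c)) = \<sigma> b c * \<sigma> a (b \<otimes>\<^bsub>G\<^esub> c)" using s c by (simp add: power_add)
    also have "\<dots> = \<sigma> (a \<otimes>\<^bsub>G\<^esub> b) c * \<sigma> a b" using mult c unfolding multiplier_def by blast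
    also have "\<dots> = \<zeta> ^ (s (a \<otimes>\<^bsub>G\<^esub> b) c + s a b)" using s c by (simp add: power_add)
    finally show "(s b c + s a (b \<otimes>\<^bsub>G\<^esub> c)) mod r = (s (a \<otimes>\<^bsub>G\<^esub> b) c + s a b) mod r" by (rule inj)
  next
    fix g assume g: "g \<in> carrier G"
    have "\<sigma> \<one>\<^bsub>G\<^esub> g = 1" "\<sigma> g \<one>\<^bsub>G\<^esub> = 1" using mult g unfolding multiplier_def by blast+
    then have "\<zeta> ^ s \<one>\<^bsub>G\<^esub> g = \<zeta> ^ 0" "\<zeta> ^ s g \<one>\<^bsub>G\<^esub> = \<zeta> ^ 0" using s[OF one_closed g] s[OF g one_closed] by auto
    from inj[OF this(1)] inj[OF this(2)] show "s \<one>\<^bsub>G\<^esub> g = 0" "s g \<one>\<^bsub>G\<^esub> = 0"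
      using s[OF one_closed g] s[OF g one_closed] by auto
  qed
  moreover have "norm \<zeta> = 1" by (simp add: \<zeta>_def)
  ultimately show thesis using that[OF r(1) \<zeta>r] s by blast
qed

section \<open>The class of groups and the twisted case\<close>

theorem det_bound_class_G_univ: "class_G_univ K \<Longrightarrow> det_bound K"
proof (induction rule: class_G_univ.induct)
  case (trivial G)
  then show ?case by (rule det_bound_trivial)
next
  case (amenable_ext H G)
  show ?case by (rule det_bound_generalized_amenable_extension[OF amenable_ext(2) amenable_ext.IH])
next
  case (subgrp H U)
  show ?case by (rule det_bound_subgroup[OF subgrp.IH subgrp(2)])
next
  case (direct_lim I r Gs f G)
  show ?case by (rule det_bound_direct_limit[OF direct_lim(1) direct_lim.IH direct_lim(3,4)])
next
  case (inverse_lim I r Gs f G)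
  show ?case by (rule det_bound_inverse_limit[OF inverse_lim(1) inverse_lim.IH inverse_lim(3,4)])
qed

lemma det_bound_class_G: "class_G TYPE('u) G \<Longrightarrow> det_bound G"
  unfolding class_G_def using det_bound_class_G_univ det_bound_iso by blast

text \<open>
  The factor \<open>s \<le> 2 ^ s \<le> q ^ s\<close> is absorbed by an approximation whose order is higher by \<open>s\<close>.
\<close>

lemma liouville_number_of_nat_mult:
  assumes "liouville_number l" "0 < (s :: nat)"
  shows "liouville_number (of_nat s * l)"
  unfolding liouville_number_def
proof (intro allI impI)
  fix n :: nat assume n: "1 \<le> n"
  obtain p q :: int where pq: "q > 1" "0 < \<bar>l - of_int p / of_int q\<bar>" "\<bar>l - of_int p / of_int q\<bar> < 1 / of_int q ^ (n + s)"
    using assms(1)[unfolded liouville_number_def, rule_format, of "n + s"] n by auto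
  have eq: "\<bar>of_nat s * l - of_int (int s * p) / of_int q\<bar> = of_nat s * \<bar>l - of_int p / of_int q\<bar>"
  proof -
    have "of_nat s * l - of_int (int s * p) / of_int q = of_nat s * (l - of_int p / of_int q)" by (simp add: algebra_simps)
    then show ?thesis by (simp add: abs_mult)
  qed
  have "real s \<le> 2 ^ s" by (metis less_exp of_nat_le_iff of_nat_numeral of_nat_power order_less_imp_le)
  also have "\<dots> \<le> of_int q ^ s" using pq(1) by (intro power_mono) auto
  finally have "real s * \<bar>l - of_int p / of_int q\<bar> \<le> of_int q ^ s * \<bar>l - of_int p / of_int q\<bar>" by (intro mult_right_mono) auto
  also have "\<dots> < of_int q ^ s * (1 / of_int q ^ (n + s))" using pq by (intro mult_strict_left_mono) auto
  also have "\<dots> = 1 / of_int q ^ n" using pq(1) by (simp add: power_add)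
  finally show "\<exists>p q :: int. q > 1 \<and> 0 < \<bar>of_nat s * l - of_int p / of_int q\<bar> \<and> \<bar>of_nat s * l - of_int p / of_int q\<bar> < 1 / of_int q ^ n"
    using pq assms(2) eq by (intro exI[of _ "int s * p"] exI[of _ q]) simp
qed

lemma infsum_finite_support:
  fixes F :: "'a \<Rightarrow> 'b :: {topological_comm_monoid_add, t2_space}"
  assumes "finite T" "T \<subseteq> S" "\<And>x. x \<in> S - T \<Longrightarrow> F x = 0"
  shows "infsum F S = sum F T"
proof -
  have "infsum F S = infsum F T" by (rule infsum_cong_neutral) (use assms in auto)
  then show ?thesis using assms(1) by simp
qed

definition unit_vector :: "'g \<Rightarrow> 'd \<Rightarrow> 'g \<Rightarrow> complex ^ 'd" where
  "unit_vector x0 k = (\<lambda>x. if x = x0 then axis k 1 else 0)"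

lemma unit_vector_l2: "x0 \<in> carrier G \<Longrightarrow> unit_vector x0 k \<in> l2 G"
proof -
  assume x0: "x0 \<in> carrier G"
  have "(\<lambda>x. (norm (unit_vector x0 k x))\<^sup>2) summable_on {x0}" by simp
  then have "(\<lambda>x. (norm (unit_vector x0 k x))\<^sup>2) summable_on carrier G"
    by (rule summable_on_cong_neutral[THEN iffD1, rotated -1]) (use x0 in \<open>auto simp: unit_vector_def\<close>)
  then show ?thesis using x0 by (auto simp: l2_def unit_vector_def)
qed

lemma matrix_vector_mult_axis: "vec_nth (M *v axis k 1) i = vec_nth (vec_nth M i) k" for M :: "complex ^ 'd ^ 'd"
proof -
  have "vec_nth (M *v axis k 1) i = (\<Sum>j\<in>UNIV. vec_nth (vec_nth M i) j * vec_nth (axis k 1) j)"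
    by (simp add: matrix_vector_mult_def)
  also have "\<dots> = (\<Sum>j\<in>UNIV. if j = k then vec_nth (vec_nth M i) j else 0)"
    by (rule sum.cong[OF refl]) (simp add: axis_def)
  finally show ?thesis by simp
qed

lemma twisted_op_unit_vector:
  assumes G: "group G" and x: "x \<in> carrier G" and x0: "x0 \<in> carrier G"
  shows "vec_nth (twisted_op G \<sigma> A (unit_vector x0 k) x) i
    = \<sigma> (x \<otimes>\<^bsub>G\<^esub> inv\<^bsub>G\<^esub> x0) x0 * (vec_nth (vec_nth A i) k) (x \<otimes>\<^bsub>G\<^esub> inv\<^bsub>G\<^esub> x0)"
proof -
  have "twisted_op G \<sigma> A (unit_vector x0 k) x
      = (\<Sum>h\<in>{x0}. \<sigma> (x \<otimes>\<^bsub>G\<^esub> inv\<^bsub>G\<^esub> h) h *s (coeff_matrix A (x \<otimes>\<^bsub>G\<^esub> inv\<^bsub>G\<^esub> h) *v unit_vector x0 k h))"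
    unfolding twisted_op_def if_P[OF x] by (rule infsum_finite_support) (use x0 in \<open>auto simp: unit_vector_def\<close>)
  then show ?thesis
    by (simp add: unit_vector_def matrix_vector_mult_axis coeff_matrix_def)
qed

text \<open>
  Self-adjointness, tested on the unit vectors at \<open>\<one>\<close> and at \<open>g\<close>.
\<close>

lemma self_adjoint_coefficients:
  assumes G: "group G" and sa: "self_adjoint_on_l2 G (twisted_op G \<sigma> A)" and \<sigma>: "multiplier G \<sigma>" and g: "g \<in> carrier G"
  shows "(vec_nth (vec_nth A i) j) g = cnj ((vec_nth (vec_nth A j) i) (inv\<^bsub>G\<^esub> g) * \<sigma> (inv\<^bsub>G\<^esub> g) g)"
proof -
  interpret group G by fact
  let ?T = "twisted_op G \<sigma> A" and ?u = "unit_vector \<one>\<^bsub>G\<^esub> j" and ?v = "unit_vector g i"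
  have right: "l2_inner G F (unit_vector y k) = vec_nth (F y) k" if "y \<in> carrier G" for F y k
  proof -
    have "l2_inner G F (unit_vector y k) = (\<Sum>x\<in>{y}. \<Sum>i\<in>UNIV. vec_nth (F x) i * cnj (vec_nth (unit_vector y k x) i))"
      unfolding l2_inner_def by (rule infsum_finite_support) (use that in \<open>auto simp: unit_vector_def\<close>)
    also have "\<dots> = (\<Sum>i\<in>UNIV. vec_nth (F y) i * cnj (vec_nth (axis k 1) i))" by (simp add: unit_vector_def)
    also have "\<dots> = (\<Sum>i\<in>UNIV. if i = k then vec_nth (F y) i else 0)"
      by (rule sum.cong[OF refl]) (simp add: axis_def)
    finally show ?thesis by simp
  qed
  have left: "l2_inner G (unit_vector y k) F = cnj (vec_nth (F y) k)" if "y \<in> carrier G" for F y k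
  proof -
    have "l2_inner G (unit_vector y k) F = (\<Sum>x\<in>{y}. \<Sum>i\<in>UNIV. vec_nth (unit_vector y k x) i * cnj (vec_nth (F x) i))"
      unfolding l2_inner_def by (rule infsum_finite_support) (use that in \<open>auto simp: unit_vector_def\<close>)
    also have "\<dots> = (\<Sum>i\<in>UNIV. vec_nth (axis k 1) i * cnj (vec_nth (F y) i))" by (simp add: unit_vector_def)
    also have "\<dots> = (\<Sum>i\<in>UNIV. if i = k then cnj (vec_nth (F y) i) else 0)"
      by (rule sum.cong[OF refl]) (simp add: axis_def)
    finally show ?thesis by simp
  qed
  have "vec_nth (?T ?u g) i = l2_inner G (?T ?u) ?v" by (rule right[OF g, symmetric])
  also have "\<dots> = l2_inner G ?u (?T ?v)"
    using sa unit_vector_l2[OF one_closed] unit_vector_l2[OF g] unfolding self_adjoint_on_l2_def by blast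
  also have "\<dots> = cnj (vec_nth (?T ?v \<one>\<^bsub>G\<^esub>) j)" by (rule left[OF one_closed])
  finally have "vec_nth (?T ?u g) i = cnj (vec_nth (?T ?v \<one>\<^bsub>G\<^esub>) j)" .
  moreover have "\<sigma> g \<one>\<^bsub>G\<^esub> = 1" using \<sigma> g unfolding multiplier_def by blast
  ultimately show ?thesis
    using g by (simp add: twisted_op_unit_vector[OF G g one_closed] twisted_op_unit_vector[OF G one_closed g] mult.commute)
qed

text \<open>
  The coefficients \<open>A(g)\<close> and the eigenvector \<open>f\<close> are lifted to the central extension by
  \<open>(g, u) \<mapsto> A(g) * cnj \<zeta> ^ u\<close> and \<open>(h, w) \<mapsto> f(h) * cnj \<zeta> ^ w\<close>. The product formula of the extension makes the
  phases in the convolution combine to \<open>\<sigma> g h\<close> times the phase at the target, independently of \<open>w\<close>. So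
  each of the \<open>r\<close> elements above \<open>h\<close> contributes the same, and the eigenvalue is multiplied by \<open>r\<close>.
\<close>

theorem corollary4p7:
  fixes G :: "'g monoid"
    and \<sigma> :: "'g \<Rightarrow> 'g \<Rightarrow> complex"
    and A :: "('g \<Rightarrow> complex) ^ 'd ^ 'd"
  assumes "class_G_hat TYPE('u) G"
    and "rational_multiplier G \<sigma>"
    and "A \<in> matrices_over (twisted_group_algebra G \<sigma>)"
    and "self_adjoint_on_l2 G (twisted_op G \<sigma> A)"
  shows "\<not> (\<exists>l::real. liouville_number l \<and> eigenvalue_on_l2 G (twisted_op G \<sigma> A) (complex_of_real l))"
proof
  assume "\<exists>l::real. liouville_number l \<and> eigenvalue_on_l2 G (twisted_op G \<sigma> A) (complex_of_real l)"
  then obtain l :: real and f where l: "liouville_number l" and f: "f \<in> l2 G" "f \<noteq> (\<lambda>_. 0)"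
    "twisted_op G \<sigma> A f = (\<lambda>x. complex_of_real l *s f x)" unfolding eigenvalue_on_l2_def by blast
  have G: "group G" using assms(1) by (simp add: class_G_hat_def class_G_def)
  interpret group G by fact
  have mult: "multiplier G \<sigma>" using assms(2) by (simp add: rational_multiplier_def)
  obtain r :: nat and \<zeta> :: complex and s where r: "0 < r" "\<zeta> ^ r = 1" "norm \<zeta> = 1"
    and \<sigma>: "\<And>g h. g \<in> carrier G \<Longrightarrow> h \<in> carrier G \<Longrightarrow> \<sigma> g h = \<zeta> ^ s g h" and coc: "rational_cocycle G r s"
    using rational_multiplier_exponents[OF G assms(2)] by blast
  interpret C: rational_cocycle G r s by (rule coc)
  let ?E = "central_extension G r s"
  have det: "det_bound ?E"
  proof (rule det_bound_class_G)
    show "class_G TYPE('u) ?E" using assms(1) r(1) C.E_cyclic_extension unfolding class_G_hat_def by blast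
  qed
  have grpE: "group ?E" by (rule C.group_E)
  define B where "B i j = vec_nth (vec_nth A i) j" for i j
  have B: "finite {g. B i j g \<noteq> 0}" "{g. B i j g \<noteq> 0} \<subseteq> carrier G" "algebraic (B i j g)" for i j g
    using assms(3) unfolding matrices_over_def twisted_group_algebra_def B_def by auto
  have pmod: "\<zeta> ^ (k mod r) = \<zeta> ^ k" for k
  proof -
    have "\<zeta> ^ k = \<zeta> ^ (r * (k div r) + k mod r)" by simp
    also have "\<dots> = \<zeta> ^ (k mod r)" by (simp only: power_add power_mult r(2) power_one mult_1_left)
    finally show ?thesis by simp
  qed
  have unit: "cnj (\<zeta> ^ k) * \<zeta> ^ k = 1" for k
    using complex_norm_square[of "\<zeta> ^ k"] r(3) by (simp add: norm_power mult.commute)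
  define n where "n = CARD('d)"
  obtain e where e: "bij_betw e {..<n} (UNIV :: 'd set)"
    using ex_bij_betw_nat_finite[of "UNIV :: 'd set"] by (auto simp: n_def atLeast0LessThan)
  \<comment> \<open>\<open>V\<close> contains all algebraic numbers from which the coefficients of the lift are products; \<open>s0\<close> will be a
    common denominator.\<close>
  define V where "V = insert (cnj \<zeta>) (insert 0 (\<Union>i. \<Union>j. B i j ` {g. B i j g \<noteq> 0}))"
  have V: "finite V" unfolding V_def using B(1) by auto
  have vals: "B i j g \<in> V" for i j g by (cases "B i j g = 0") (auto simp: V_def)
  have alg_\<zeta>: "algebraic (cnj \<zeta>)"
  proof (rule algebraicI[of "monom 1 r - 1"])
    show "coeff (monom 1 r - 1) i \<in> \<int>" for i by (simp add: one_pCons coeff_pCons split: nat.splits)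
    have lead: "coeff (monom 1 r - 1 :: complex poly) r = 1" using r(1) by (simp add: one_pCons coeff_pCons split: nat.splits)
    show "monom 1 r - 1 \<noteq> (0 :: complex poly)"
    proof
      assume z: "monom 1 r - 1 = (0 :: complex poly)"
      show False using lead unfolding z by simp
    qed
    show "poly (monom 1 r - 1) (cnj \<zeta>) = 0" using r(2) by (simp add: poly_monom flip: complex_cnj_power)
  qed
  obtain s0 D :: nat and \<omega> where s0: "0 < s0" "0 < D" "\<omega> 0 = 1"
    and rep: "\<And>z. z \<in> V \<Longrightarrow> \<exists>c. of_nat s0 * z \<in> int_rep D \<omega> c"
  proof -
    have "algebraic (0 :: complex)" by (rule algebraic_int_imp_algebraic[OF algebraic_int_0])
    then have "algebraic z" if "z \<in> V" for z using that alg_\<zeta> B(3) unfolding V_def by blast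
    from finite_algebraic_int_rep[OF V this] show thesis using that by blast
  qed
  have rep_pow: "\<exists>c. (of_nat s0 * cnj \<zeta>) ^ u * z \<in> int_rep D \<omega> c" if z: "\<exists>c. z \<in> int_rep D \<omega> c" for u z
  proof (induction u)
    case (Suc u)
    obtain c where "of_nat s0 * cnj \<zeta> \<in> int_rep D \<omega> c" using rep[of "cnj \<zeta>"] by (auto simp: V_def)
    moreover obtain c' where "(of_nat s0 * cnj \<zeta>) ^ u * z \<in> int_rep D \<omega> c'" using Suc by blast
    ultimately have "of_nat s0 * cnj \<zeta> * ((of_nat s0 * cnj \<zeta>) ^ u * z) \<in> int_rep D \<omega> (D * (c * c'))" by (rule int_rep_mult)
    then show ?case by (auto simp: mult.assoc)
  qed (use z in simp)
  \<comment> \<open>A coefficient of the lift is the product of one number of \<open>V\<close> and at most \<open>r\<close> factors \<open>cnj \<zeta>\<close>, each of which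
    uses up one factor \<open>s0\<close>.\<close>
  define s1 where "s1 = s0 ^ Suc r"
  have s1: "0 < s1" using s0(1) by (simp add: s1_def)
  define b where "b i j x = (if i < n \<and> j < n \<and> x \<in> carrier ?E then of_nat s1 * (B (e i) (e j) (fst x) * cnj (\<zeta> ^ snd x)) else 0)" for i j x
  have b_rep: "\<exists>c. b i j x \<in> int_rep D \<omega> c" for i j x
  proof (cases "i < n \<and> j < n \<and> x \<in> carrier ?E")
    case True
    then have u: "snd x < r" by (auto simp: C.E_simps)
    have "\<exists>c. of_nat s0 * B (e i) (e j) (fst x) \<in> int_rep D \<omega> c" using rep vals by blast
    from rep_pow[OF this, of "snd x"]
    obtain c where "(of_nat s0 * cnj \<zeta>) ^ snd x * (of_nat s0 * B (e i) (e j) (fst x)) \<in> int_rep D \<omega> c" by blast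
    from int_rep_of_nat_mult[OF this, of "s0 ^ (r - snd x)"]
    have "of_nat (s0 ^ (r - snd x)) * ((of_nat s0 * cnj \<zeta>) ^ snd x * (of_nat s0 * B (e i) (e j) (fst x))) \<in> int_rep D \<omega> (s0 ^ (r - snd x) * c)" .
    also have "of_nat (s0 ^ (r - snd x)) * ((of_nat s0 * cnj \<zeta>) ^ snd x * (of_nat s0 * B (e i) (e j) (fst x)))
        = of_nat (s0 ^ (r - snd x) * s0 ^ snd x * s0) * (B (e i) (e j) (fst x) * cnj (\<zeta> ^ snd x))"
      by (simp add: power_mult_distrib mult_ac)
    also have "s0 ^ (r - snd x) * s0 ^ snd x * s0 = s1" using u by (simp add: s1_def flip: power_add)
    also have "of_nat s1 * (B (e i) (e j) (fst x) * cnj (\<zeta> ^ snd x)) = b i j x" using True by (simp add: b_def)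
    finally show ?thesis by blast
  next
    case False
    then show ?thesis using zero_in_int_rep by (auto simp: b_def)
  qed
  have b_support: "{(i, j, x). b i j x \<noteq> 0} \<subseteq> (\<Union>i\<in>{..<n}. \<Union>j\<in>{..<n}. (\<lambda>(g, u). (i, j, g, u)) ` ({g. B (e i) (e j) g \<noteq> 0} \<times> {..<r}))"
    by (auto simp: b_def C.E_simps image_iff split: if_splits)
  have "finite (\<Union>i\<in>{..<n}. \<Union>j\<in>{..<n}. (\<lambda>(g, u). (i, j, g, u)) ` ({g. B (e i) (e j) g \<noteq> 0} \<times> {..<r}))"
    using B(1) by auto
  from finite_subset[OF b_support this] have b_fin: "finite {(i, j, x). b i j x \<noteq> 0}" .
  obtain c where c: "0 < c" "\<And>i j x. b i j x \<in> int_rep D \<omega> c"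
  proof -
    have "finite (insert 0 ((\<lambda>(i, j, x). b i j x) ` {(i, j, x). b i j x \<noteq> 0}))" using b_fin by simp
    then obtain c where c: "0 < c" "\<And>z. z \<in> insert 0 ((\<lambda>(i, j, x). b i j x) ` {(i, j, x). b i j x \<noteq> 0}) \<Longrightarrow> z \<in> int_rep D \<omega> c"
      by (rule int_rep_uniform) (use b_rep zero_in_int_rep in auto)
    have "b i j x \<in> insert 0 ((\<lambda>(i, j, x). b i j x) ` {(i, j, x). b i j x \<noteq> 0})" for i j x
      by (cases "b i j x = 0") (auto intro!: image_eqI[of _ _ "(i, j, x)"])
    then show thesis using that c by blast
  qed
  \<comment> \<open>N must be positive, also for the zero operator.\<close>
  define N where "N = Suc (card {(i, j, x). b i j x \<noteq> 0})"
  have coeffs: "hermitian_coeffs ?E n D \<omega> c N b"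
    unfolding hermitian_coeffs_def
  proof (intro conjI allI impI ballI)
    fix i j x show "i < n" "j < n" "x \<in> carrier ?E" if "b i j x \<noteq> 0" using that by (auto simp: b_def split: if_splits)
    show "b i j x \<in> int_rep D \<omega> c" by (rule c(2))
  next
    fix i
    have inj: "inj_on (\<lambda>(j, x). (i, j, x)) {(j, x). b i j x \<noteq> 0}" by (auto simp: inj_on_def)
    have sub: "(\<lambda>(j, x). (i, j, x)) ` {(j, x). b i j x \<noteq> 0} \<subseteq> {(i, j, x). b i j x \<noteq> 0}" by auto
    show "finite {(j, x). b i j x \<noteq> 0}" by (rule inj_on_finite[OF inj sub b_fin])
    have "card {(j, x). b i j x \<noteq> 0} \<le> card {(i, j, x). b i j x \<noteq> 0}" by (rule card_inj_on_le[OF inj sub b_fin])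
    then show "card {(j, x). b i j x \<noteq> 0} \<le> N" by (simp add: N_def)
  next
    fix i j x assume x: "x \<in> carrier ?E"
    obtain g z where gz: "x = (g, z)" "g \<in> carrier G" "z < r" using x by (auto simp: C.E_simps)
    obtain w where w: "w < r" "inv\<^bsub>?E\<^esub> (g, z) = (inv\<^bsub>G\<^esub> g, w)" "(w + z + s (inv\<^bsub>G\<^esub> g) g) mod r = 0"
      using C.E_inverse[OF gz(2,3)] by blast
    have wx: "(inv\<^bsub>G\<^esub> g, w) \<in> carrier ?E" using gz(2) w(1) by (simp add: C.E_simps)
    have "\<zeta> ^ (w + z + s (inv\<^bsub>G\<^esub> g) g) = 1" using pmod[of "w + z + s (inv\<^bsub>G\<^esub> g) g"] w(3) by simp
    then have one: "\<zeta> ^ w * (\<zeta> ^ z * \<sigma> (inv\<^bsub>G\<^esub> g) g) = 1" using \<sigma>[of "inv\<^bsub>G\<^esub> g" g] gz(2) by (simp add: power_add mult.assoc)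
    have "cnj (\<zeta> ^ w) = cnj (\<zeta> ^ w) * (\<zeta> ^ w * (\<zeta> ^ z * \<sigma> (inv\<^bsub>G\<^esub> g) g))" by (simp only: one mult_1_right)
    also have "\<dots> = cnj (\<zeta> ^ w) * \<zeta> ^ w * (\<zeta> ^ z * \<sigma> (inv\<^bsub>G\<^esub> g) g)" by (simp only: mult.assoc)
    also have "\<dots> = \<zeta> ^ z * \<sigma> (inv\<^bsub>G\<^esub> g) g" by (simp only: unit mult_1_left)
    finally have cw: "cnj (\<zeta> ^ w) = \<zeta> ^ z * \<sigma> (inv\<^bsub>G\<^esub> g) g" .
    have "B i' j' g = cnj (B j' i' (inv\<^bsub>G\<^esub> g) * \<sigma> (inv\<^bsub>G\<^esub> g) g)" for i' j'
      unfolding B_def by (rule self_adjoint_coefficients[OF G assms(4) mult gz(2)])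
    then have Bg: "cnj (B i' j' g) = B j' i' (inv\<^bsub>G\<^esub> g) * \<sigma> (inv\<^bsub>G\<^esub> g) g" for i' j' by simp
    show "b j i (inv\<^bsub>?E\<^esub> x) = cnj (b i j x)"
    proof (cases "i < n \<and> j < n")
      case True
      then have "b j i (inv\<^bsub>?E\<^esub> x) = of_nat s1 * (B (e j) (e i) (inv\<^bsub>G\<^esub> g) * cnj (\<zeta> ^ w))"
        using wx by (simp add: gz(1) w(2) b_def)
      also have "\<dots> = of_nat s1 * (cnj (B (e i) (e j) g) * \<zeta> ^ z)" unfolding cw Bg by (simp only: mult_ac)
      also have "\<dots> = cnj (b i j x)" using True x by (simp add: gz(1) b_def)
      finally show ?thesis .
    qed (auto simp: b_def)
  qed
  define F where "F = (\<lambda>(i, y). if i < n \<and> y \<in> carrier ?E then vec_nth (f (fst y)) (e i) * cnj (\<zeta> ^ snd y) else 0)"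
  let ?K = "conv_kernel ?E b"
  have eig: "(\<Sum>y | ?K z y \<noteq> 0. ?K z y * F y) = of_real (of_nat (s1 * r) * l) * F z" for z
  proof -
    obtain i x0 where z0: "z = (i, x0)" by (cases z)
    show ?thesis
    proof (cases "i < n \<and> x0 \<in> carrier ?E")
      case False
      then have "?K z y = 0" for y unfolding z0 by (cases y) (auto simp: conv_kernel_def b_def)
      moreover have "F z = 0" using False unfolding z0 F_def by auto
      ultimately show ?thesis by simp
    next
      case True
      then obtain x zz where x: "x0 = (x, zz)" "x \<in> carrier G" "zz < r" and i: "i < n" by (auto simp: C.E_simps)
      have BG: "g \<in> carrier G" if "B i j g \<noteq> 0" for i j g using B(2) that by blast
      define T where "T = (\<Union>i. \<Union>j. (\<lambda>g. inv\<^bsub>G\<^esub> g \<otimes>\<^bsub>G\<^esub> x) ` {g. B i j g \<noteq> 0})"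
      have T: "finite T" "T \<subseteq> carrier G" unfolding T_def using B(1) BG x(2) by (auto intro!: m_closed inv_closed)
      have T_zero: "B i' j' (x \<otimes>\<^bsub>G\<^esub> inv\<^bsub>G\<^esub> h) = 0" if "h \<in> carrier G" "h \<notin> T" for i' j' h
      proof (rule ccontr)
        assume "B i' j' (x \<otimes>\<^bsub>G\<^esub> inv\<^bsub>G\<^esub> h) \<noteq> 0"
        moreover have "h = inv\<^bsub>G\<^esub> (x \<otimes>\<^bsub>G\<^esub> inv\<^bsub>G\<^esub> h) \<otimes>\<^bsub>G\<^esub> x" using that(1) x(2) by (simp add: inv_mult_group m_assoc)
        ultimately have "h \<in> T" unfolding T_def by blast
        then show False using that(2) by simp
      qed
      have K_val: "?K z (j, (h, w)) * F (j, (h, w)) = of_nat s1 * cnj (\<zeta> ^ zz) *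
          (\<sigma> (x \<otimes>\<^bsub>G\<^esub> inv\<^bsub>G\<^esub> h) h * (B (e i) (e j) (x \<otimes>\<^bsub>G\<^esub> inv\<^bsub>G\<^esub> h) * vec_nth (f h) (e j)))"
        if jn: "j < n" and hG: "h \<in> carrier G" and wr: "w < r" for j h w
      proof -
        obtain u where u: "u < r" "(x, zz) \<otimes>\<^bsub>?E\<^esub> inv\<^bsub>?E\<^esub> (h, w) = (x \<otimes>\<^bsub>G\<^esub> inv\<^bsub>G\<^esub> h, u)" "(u + w + s (x \<otimes>\<^bsub>G\<^esub> inv\<^bsub>G\<^esub> h) h) mod r = zz"
          using C.E_quotient[OF x(2,3) hG wr] by blast
        have xh: "x \<otimes>\<^bsub>G\<^esub> inv\<^bsub>G\<^esub> h \<in> carrier G" using x(2) hG by simp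
        have "\<zeta> ^ zz = \<zeta> ^ u * \<zeta> ^ w * \<sigma> (x \<otimes>\<^bsub>G\<^esub> inv\<^bsub>G\<^esub> h) h"
          using pmod[of "u + w + s (x \<otimes>\<^bsub>G\<^esub> inv\<^bsub>G\<^esub> h) h"] u(3) \<sigma>[OF xh hG] by (simp add: power_add)
        then have "cnj (\<zeta> ^ zz) = cnj (\<zeta> ^ u) * cnj (\<zeta> ^ w) * cnj (\<sigma> (x \<otimes>\<^bsub>G\<^esub> inv\<^bsub>G\<^esub> h) h)" by (simp only: complex_cnj_mult)
        then have "cnj (\<zeta> ^ zz) * \<sigma> (x \<otimes>\<^bsub>G\<^esub> inv\<^bsub>G\<^esub> h) h = cnj (\<zeta> ^ u) * cnj (\<zeta> ^ w) * (cnj (\<sigma> (x \<otimes>\<^bsub>G\<^esub> inv\<^bsub>G\<^esub> h) h) * \<sigma> (x \<otimes>\<^bsub>G\<^esub> inv\<^bsub>G\<^esub> h) h)"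
          by (simp only: mult.assoc)
        moreover have "cnj (\<sigma> (x \<otimes>\<^bsub>G\<^esub> inv\<^bsub>G\<^esub> h) h) * \<sigma> (x \<otimes>\<^bsub>G\<^esub> inv\<^bsub>G\<^esub> h) h = 1" unfolding \<sigma>[OF xh hG] by (rule unit)
        ultimately have ph: "cnj (\<zeta> ^ zz) * \<sigma> (x \<otimes>\<^bsub>G\<^esub> inv\<^bsub>G\<^esub> h) h = cnj (\<zeta> ^ u) * cnj (\<zeta> ^ w)"
          by (simp only: mult_1_right)
        have carr: "(h, w) \<in> carrier ?E" "(x, zz) \<in> carrier ?E" "(x \<otimes>\<^bsub>G\<^esub> inv\<^bsub>G\<^esub> h, u) \<in> carrier ?E"
          using hG wr x xh u(1) by (simp_all add: C.E_simps)
        have "?K z (j, (h, w)) * F (j, (h, w)) = of_nat s1 * (B (e i) (e j) (x \<otimes>\<^bsub>G\<^esub> inv\<^bsub>G\<^esub> h) * cnj (\<zeta> ^ u)) * (vec_nth (f h) (e j) * cnj (\<zeta> ^ w))"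
          using carr i jn by (simp add: z0 x(1) conv_kernel_def u(2) b_def F_def)
        also have "\<dots> = of_nat s1 * (cnj (\<zeta> ^ u) * cnj (\<zeta> ^ w)) * (B (e i) (e j) (x \<otimes>\<^bsub>G\<^esub> inv\<^bsub>G\<^esub> h) * vec_nth (f h) (e j))"
          by (simp only: mult_ac)
        finally show ?thesis by (simp only: ph[symmetric] mult_ac)
      qed
      define Y where "Y = {..<n} \<times> (T \<times> {..<r})"
      have sub: "{y. ?K z y \<noteq> 0} \<subseteq> Y"
      proof
        fix y assume "y \<in> {y. ?K z y \<noteq> 0}"
        then have nz: "?K z y \<noteq> 0" by simp
        obtain j h w where y: "y = (j, (h, w))" by (cases y) auto
        have j: "j < n" and hw: "h \<in> carrier G" "w < r"
          using nz unfolding y z0 by (auto simp: conv_kernel_def b_def C.E_simps(1) split: if_splits)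
        obtain u where u: "(x, zz) \<otimes>\<^bsub>?E\<^esub> inv\<^bsub>?E\<^esub> (h, w) = (x \<otimes>\<^bsub>G\<^esub> inv\<^bsub>G\<^esub> h, u)"
          using C.E_quotient[OF x(2,3) hw] by blast
        have "B (e i) (e j) (x \<otimes>\<^bsub>G\<^esub> inv\<^bsub>G\<^esub> h) \<noteq> 0"
          using nz unfolding y z0 x(1) by (auto simp: conv_kernel_def b_def u split: if_splits)
        then have "h \<in> T" using T_zero[OF hw(1)] by blast
        then show "y \<in> Y" using j hw by (simp add: y Y_def)
      qed
      have "(\<Sum>y | ?K z y \<noteq> 0. ?K z y * F y) = (\<Sum>y\<in>Y. ?K z y * F y)"
        using sub T(1) by (intro sum.mono_neutral_left) (auto simp: Y_def)
      also have "\<dots> = (\<Sum>j<n. \<Sum>h\<in>T. \<Sum>w<r. ?K z (j, (h, w)) * F (j, (h, w)))"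
        by (simp add: Y_def sum.cartesian_product split_beta)
      also have "\<dots> = (\<Sum>j<n. \<Sum>h\<in>T. \<Sum>w<r. of_nat s1 * cnj (\<zeta> ^ zz) *
          (\<sigma> (x \<otimes>\<^bsub>G\<^esub> inv\<^bsub>G\<^esub> h) h * (B (e i) (e j) (x \<otimes>\<^bsub>G\<^esub> inv\<^bsub>G\<^esub> h) * vec_nth (f h) (e j))))"
        by (intro sum.cong refl K_val) (use T(2) in auto)
      also have "\<dots> = of_nat (s1 * r) * cnj (\<zeta> ^ zz) * (\<Sum>j<n. \<Sum>h\<in>T. \<sigma> (x \<otimes>\<^bsub>G\<^esub> inv\<^bsub>G\<^esub> h) h * (B (e i) (e j) (x \<otimes>\<^bsub>G\<^esub> inv\<^bsub>G\<^esub> h) * vec_nth (f h) (e j)))"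
        by (simp add: sum_distrib_left mult_ac)
      also have "(\<Sum>j<n. \<Sum>h\<in>T. \<sigma> (x \<otimes>\<^bsub>G\<^esub> inv\<^bsub>G\<^esub> h) h * (B (e i) (e j) (x \<otimes>\<^bsub>G\<^esub> inv\<^bsub>G\<^esub> h) * vec_nth (f h) (e j)))
          = (\<Sum>j\<in>UNIV. \<Sum>h\<in>T. \<sigma> (x \<otimes>\<^bsub>G\<^esub> inv\<^bsub>G\<^esub> h) h * (B (e i) j (x \<otimes>\<^bsub>G\<^esub> inv\<^bsub>G\<^esub> h) * vec_nth (f h) j))"
        by (rule sum.reindex_bij_betw[OF e])
      also have "\<dots> = (\<Sum>h\<in>T. \<Sum>j\<in>UNIV. \<sigma> (x \<otimes>\<^bsub>G\<^esub> inv\<^bsub>G\<^esub> h) h * (B (e i) j (x \<otimes>\<^bsub>G\<^esub> inv\<^bsub>G\<^esub> h) * vec_nth (f h) j))"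
        by (rule sum.swap)
      also have "\<dots> = vec_nth (\<Sum>h\<in>T. \<sigma> (x \<otimes>\<^bsub>G\<^esub> inv\<^bsub>G\<^esub> h) h *s (coeff_matrix A (x \<otimes>\<^bsub>G\<^esub> inv\<^bsub>G\<^esub> h) *v f h)) (e i)"
        by (simp add: coeff_matrix_def matrix_vector_mult_def B_def sum_distrib_left)
      also have "(\<Sum>h\<in>T. \<sigma> (x \<otimes>\<^bsub>G\<^esub> inv\<^bsub>G\<^esub> h) h *s (coeff_matrix A (x \<otimes>\<^bsub>G\<^esub> inv\<^bsub>G\<^esub> h) *v f h)) = twisted_op G \<sigma> A f x"
        unfolding twisted_op_def if_P[OF x(2)]
      proof (rule infsum_finite_support[OF T, symmetric])
        fix h assume h: "h \<in> carrier G - T"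
        have "coeff_matrix A (x \<otimes>\<^bsub>G\<^esub> inv\<^bsub>G\<^esub> h) *v f h = 0"
          using T_zero[of h] h by (simp add: coeff_matrix_def matrix_vector_mult_def B_def Finite_Cartesian_Product.vec_eq_iff)
        then show "\<sigma> (x \<otimes>\<^bsub>G\<^esub> inv\<^bsub>G\<^esub> h) h *s (coeff_matrix A (x \<otimes>\<^bsub>G\<^esub> inv\<^bsub>G\<^esub> h) *v f h) = 0" by simp
      qed
      also have "vec_nth (twisted_op G \<sigma> A f x) (e i) = of_real l * vec_nth (f x) (e i)" by (simp add: f(3))
      also have "of_nat (s1 * r) * cnj (\<zeta> ^ zz) * (of_real l * vec_nth (f x) (e i)) = of_real (of_nat (s1 * r) * l) * F z"
        using True by (simp add: F_def z0 x(1) mult_ac)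
      finally show ?thesis .
    qed
  qed
  define S where "S = real n * real r * infsum (\<lambda>x. (norm (f x))\<^sup>2) (carrier G)"
  have bounded: "(\<Sum>z\<in>Z. (norm (F z))\<^sup>2) \<le> S" if Z: "finite Z" for Z
  proof -
    define T where "T = (\<lambda>z. fst (snd z)) ` Z \<inter> carrier G"
    have T: "finite T" "T \<subseteq> carrier G" using Z by (auto simp: T_def)
    let ?Y = "{..<n} \<times> (T \<times> {..<r})"
    have "(\<Sum>z\<in>Z. (norm (F z))\<^sup>2) = (\<Sum>z\<in>Z \<inter> ?Y. (norm (F z))\<^sup>2)"
    proof (rule sum.mono_neutral_right[OF Z])
      show "\<forall>z\<in>Z - Z \<inter> ?Y. (norm (F z))\<^sup>2 = 0"
      proof
        fix z assume z: "z \<in> Z - Z \<inter> ?Y"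
        obtain i h w where ihw: "z = (i, (h, w))" by (cases z) auto
        have "\<not> (i < n \<and> (h, w) \<in> carrier ?E)" using z by (force simp: ihw T_def C.E_simps(1))
        then show "(norm (F z))\<^sup>2 = 0" by (auto simp: F_def ihw)
      qed
    qed auto
    also have "\<dots> \<le> (\<Sum>z\<in>?Y. (norm (F z))\<^sup>2)" using T by (intro sum_mono2) auto
    also have "\<dots> = (\<Sum>i<n. \<Sum>h\<in>T. \<Sum>w<r. (norm (F (i, (h, w))))\<^sup>2)"
      by (simp add: sum.cartesian_product split_beta)
    also have "\<dots> \<le> (\<Sum>i<n. \<Sum>h\<in>T. \<Sum>w<r. (norm (f h))\<^sup>2)"
    proof (intro sum_mono power_mono)
      fix i h w
      show "norm (F (i, (h, w))) \<le> norm (f h)"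
        using Finite_Cartesian_Product.norm_nth_le[of "f h" "e i"] r(3) by (simp add: F_def norm_mult norm_power)
    qed simp
    also have "\<dots> = real n * real r * (\<Sum>h\<in>T. (norm (f h))\<^sup>2)" by (simp add: sum_distrib_left mult_ac)
    also have "(\<Sum>h\<in>T. (norm (f h))\<^sup>2) \<le> infsum (\<lambda>x. (norm (f x))\<^sup>2) (carrier G)"
      using f(1) T by (intro finite_sum_le_infsum) (auto simp: l2_def)
    finally show ?thesis unfolding S_def by (simp add: mult_left_mono)
  qed
  obtain x where x: "f x \<noteq> 0" using f(2) by auto
  then have xG: "x \<in> carrier G" using f(1) by (auto simp: l2_def)
  obtain k where "vec_nth (f x) k \<noteq> 0" using x by (auto simp: Finite_Cartesian_Product.vec_eq_iff)
  moreover obtain i where i: "i < n" "e i = k" using e by (auto simp: bij_betw_def image_iff) (metis UNIV_I imageE lessThan_iff)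
  ultimately have nz: "F (i, (x, 0)) \<noteq> 0" "(x, 0) \<in> carrier ?E" using xG r(1) by (simp_all add: F_def C.E_simps)
  have "\<not> liouville_number (of_nat (s1 * r) * l)"
    by (rule det_bound_no_liouville_eigenvalue[where \<omega> = \<omega> and f = F, OF det s0(2,3) c(1) _ coeffs eig bounded nz(1) i(1) nz(2)]) (simp add: N_def)
  moreover have "liouville_number (of_nat (s1 * r) * l)"
    by (rule liouville_number_of_nat_mult[OF l]) (use s1 r(1) in simp)
  ultimately show False by contradiction
qed

end
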